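(* Let $n\ge 1$, $d\ge 1$, let $F\subset\mathbb{P}^n$ be a generic degree $d$ hypersurface and let $s=s_{\min}(n,d)$. If $\mathrm{VSH}(F,s)$ is zero dimensional, then it is smooth (and hence reduced). Here "generic" means that the statement holds for all $F=V(f)$ with $[f]$ in some nonempty Zariski open subset of $\mathbb{P}S_d$.
   Context: Let $S=\mathbb{C}[X_0,\dots,X_n]$ and $T=\mathbb{C}[\partial_0,\dots,\partial_n]$, with $T$ acting on $S$ by differentiation ($\partial_i$ acts as $\partial/\partial X_i$; the action is written $D\circ f$). $S_d$ and $T_d$ denote the homogeneous pieces of degree $d$; $\mathbb{P}^n=\mathbb{P}T_1$ and $\check{\mathbb{P}}^n=\mathbb{P}S_1$, so $f\in S_d$ defines a hypersurface $F=V(f)\subset\mathbb{P}^n$. For $f\in S_d$, $f^\perp=\{D\in T: D\circ f=0\}$ is a homogeneous ideal, and $F^\perp=\mathbb{P}\big((f^\perp)_s\big)\subset\mathbb{P}T_s$ denotes the linear space given by its degree $s$ piece. A form $g\in S_d$ is a codimension one form if $(g^\perp)_1\ne 0$. $s_{\min}(n,d)$ is the minimal number of summands appearing in the presentations of the generic form of degree $d$ in $n+1$ variables as a sum of codimension one forms of degree $d$ (i.e. the smallest $s$ such that all forms in some nonempty Zariski open subset of $\mathbb{P}S_d$ are sums of $s$ codimension one forms). $\Delta_{n,s}\subset\mathbb{P}T_s$ is the variety of totally decomposable forms: its points are the classes of forms $L_1\cdots L_s$ that are products of $s$ linear forms $L_i\in T_1$. $\mathrm{VSH}(F,s)$ is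 the scheme-theoretic intersection $F^\perp\cap\Delta_{n,s}$ in $\mathbb{P}T_s$. *)

theory Defs
  imports Complex_Main "HOL-Library.Poly_Mapping" "HOL-Library.Extended_Nat"
begin

section \<open>Polynomials over the complex numbers\<close>

text \<open>
  Polynomials in variables indexed by \<open>'v\<close> are finitely supported functions from exponent
  vectors to coefficients; the ring structure is the convolution product of
  \<^theory>\<open>HOL-Library.Poly_Mapping\<close>. Two instances are used: \<open>'v = nat\<close> for \<open>S\<close> and \<open>T\<close>, and
  \<open>'v = nat \<Rightarrow>\<^sub>0 nat\<close> for the homogeneous coordinate rings of \<open>\<P>S\<^sub>d\<close> and \<open>\<P>T\<^sub>s\<close>, which have one
  variable for every monomial of degree \<open>d\<close>, resp. \<open>s\<close>.
\<close>

type_synonym 'v mpoly = "('v \<Rightarrow>\<^sub>0 nat) \<Rightarrow>\<^sub>0 complex"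

definition var :: "'v \<Rightarrow> 'v mpoly" where
  "var i = Poly_Mapping.single (Poly_Mapping.single i 1) 1"

definition monomials :: "'v set \<Rightarrow> nat \<Rightarrow> ('v \<Rightarrow>\<^sub>0 nat) set" where
  "monomials I d =
    {\<alpha>. Poly_Mapping.keys \<alpha> \<subseteq> I \<and> (\<Sum>i\<in>Poly_Mapping.keys \<alpha>. Poly_Mapping.lookup \<alpha> i) = d}"

definition polys :: "'v set \<Rightarrow> 'v mpoly set" where
  "polys I = {p. \<forall>\<alpha>\<in>Poly_Mapping.keys p. Poly_Mapping.keys \<alpha> \<subseteq> I}"

definition forms :: "'v set \<Rightarrow> nat \<Rightarrow> 'v mpoly set" where
  "forms I d = {p. Poly_Mapping.keys p \<subseteq> monomials I d}"

definition peval :: "'v mpoly \<Rightarrow> ('v \<Rightarrow>\<^sub>0 complex) \<Rightarrow> complex" where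
  "peval p a =
    (\<Sum>\<alpha>\<in>Poly_Mapping.keys p. Poly_Mapping.lookup p \<alpha> *
       (\<Prod>i\<in>Poly_Mapping.keys \<alpha>. Poly_Mapping.lookup a i ^ Poly_Mapping.lookup \<alpha> i))"

definition partial :: "'v \<Rightarrow> 'v mpoly \<Rightarrow> 'v mpoly" where
  "partial i p =
    (\<Sum>\<alpha>\<in>Poly_Mapping.keys p.
       Poly_Mapping.single (\<alpha> - Poly_Mapping.single i 1)
         (of_nat (Poly_Mapping.lookup \<alpha> i) * Poly_Mapping.lookup p \<alpha>))"

definition cscale :: "complex \<Rightarrow> ('v \<Rightarrow>\<^sub>0 complex) \<Rightarrow> ('v \<Rightarrow>\<^sub>0 complex)" where
  "cscale c v = Poly_Mapping.map ((*) c) v"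

lemma lookup_cscale [simp]: "Poly_Mapping.lookup (cscale c v) i = c * Poly_Mapping.lookup v i"
  by (simp add: cscale_def map.rep_eq when_def)

interpretation cvec: vector_space cscale
  by unfold_locales (rule poly_mapping_eqI, simp add: lookup_add algebra_simps)+


section \<open>Projective space, its Zariski topology, closed subschemes\<close>

text \<open>
  For a finite set \<open>I\<close> of coordinates, a point of the projective space with homogeneous
  coordinates indexed by \<open>I\<close> is given by any of its nonzero representatives, and a set of points
  by the cone of all representatives of its members (without the origin). In particular \<open>\<P>S\<^sub>d\<close> is
  \<open>proj_space (monomials {..n} d)\<close>, whose elements are the nonzero elements of \<open>forms {..n} d\<close>.
\<close>

definition proj_space :: "'i set \<Rightarrow> ('i \<Rightarrow>\<^sub>0 complex) set" where
  "proj_space I = {a. a \<noteq> 0 \<and> Poly_Mapping.keys a \<subseteq> I}"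

definition zero_locus :: "'i set \<Rightarrow> 'i mpoly set \<Rightarrow> ('i \<Rightarrow>\<^sub>0 complex) set" where
  "zero_locus I B = {a \<in> proj_space I. \<forall>g\<in>B. peval g a = 0}"

definition zariski_closed :: "'i set \<Rightarrow> ('i \<Rightarrow>\<^sub>0 complex) set \<Rightarrow> bool" where
  "zariski_closed I Z \<longleftrightarrow> (\<exists>B. B \<subseteq> (\<Union>m. forms I m) \<and> Z = zero_locus I B)"

definition zariski_open :: "'i set \<Rightarrow> ('i \<Rightarrow>\<^sub>0 complex) set \<Rightarrow> bool" where
  "zariski_open I U \<longleftrightarrow> U \<subseteq> proj_space I \<and> zariski_closed I (proj_space I - U)"

definition irreducible_closed :: "'i set \<Rightarrow> ('i \<Rightarrow>\<^sub>0 complex) set \<Rightarrow> bool" where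
  "irreducible_closed I Z \<longleftrightarrow> zariski_closed I Z \<and> Z \<noteq> {} \<and>
    (\<forall>A B. zariski_closed I A \<longrightarrow> zariski_closed I B \<longrightarrow> Z \<subseteq> A \<union> B \<longrightarrow> Z \<subseteq> A \<or> Z \<subseteq> B)"

definition irreducible_chain ::
    "'i set \<Rightarrow> ('i \<Rightarrow>\<^sub>0 complex) set \<Rightarrow> nat \<Rightarrow> (nat \<Rightarrow> ('i \<Rightarrow>\<^sub>0 complex) set) \<Rightarrow> bool" where
  "irreducible_chain I Z k C \<longleftrightarrow>
    (\<forall>j\<le>k. irreducible_closed I (C j) \<and> C j \<subseteq> Z) \<and> (\<forall>j<k. C j \<subset> C (Suc j))"

text \<open>Krull dimension of a closed subset; the empty set gets the value \<open>0\<close> here, so nonemptiness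
  is required separately in \<open>zero_dimensional\<close> below.\<close>

definition krull_dim :: "'i set \<Rightarrow> ('i \<Rightarrow>\<^sub>0 complex) set \<Rightarrow> enat" where
  "krull_dim I Z = Sup {enat k | k. \<exists>C. irreducible_chain I Z k C}"

text \<open>The dimension of the local ring of \<open>Z\<close> at the closed point \<open>a\<close>: its prime ideals correspond
  to the irreducible closed subsets of \<open>Z\<close> through \<open>a\<close>.\<close>

definition local_dim :: "'i set \<Rightarrow> ('i \<Rightarrow>\<^sub>0 complex) set \<Rightarrow> ('i \<Rightarrow>\<^sub>0 complex) \<Rightarrow> enat" where
  "local_dim I Z a = Sup {enat k | k. \<exists>C. irreducible_chain I Z k C \<and> (\<forall>j\<le>k. a \<in> C j)}"

text \<open>The homogeneous ideal of a projective variety. For a nonempty cone \<open>Z\<close> the set below is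
  homogeneous, since the homogeneous components of a polynomial vanishing on \<open>Z\<close> also vanish
  on \<open>Z\<close>. For empty \<open>Z\<close> it is the unit ideal, which also defines the empty subscheme.\<close>

definition vanishing_ideal :: "'i set \<Rightarrow> ('i \<Rightarrow>\<^sub>0 complex) set \<Rightarrow> 'i mpoly set" where
  "vanishing_ideal I Z = {g \<in> polys I. \<forall>a\<in>Z. peval g a = 0}"

text \<open>
  A closed subscheme of projective space is given by a homogeneous ideal \<open>J\<close> of \<open>polys I\<close>;
  its set of closed points is \<open>zero_locus I J\<close>. The scheme-theoretic intersection of the
  subschemes given by two ideals is given by the sum of these ideals.
\<close>

definition ideal_sum :: "'i mpoly set \<Rightarrow> 'i mpoly set \<Rightarrow> 'i mpoly set" where
  "ideal_sum J K = {g + h | g h. g \<in> J \<and> h \<in> K}"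

definition zero_dimensional :: "'i set \<Rightarrow> 'i mpoly set \<Rightarrow> bool" where
  "zero_dimensional I J \<longleftrightarrow> zero_locus I J \<noteq> {} \<and> krull_dim I (zero_locus I J) = 0"

text \<open>The kernel of the Jacobian of \<open>J\<close> at a representative \<open>a\<close> of a point, i.e. the affine cone over
  the embedded projective tangent space. By Euler's formula it contains \<open>a\<close>, so its dimension is one
  more than that of the Zariski tangent space of the projective scheme.\<close>

definition tangent_cone_space ::
    "'i set \<Rightarrow> 'i mpoly set \<Rightarrow> ('i \<Rightarrow>\<^sub>0 complex) \<Rightarrow> ('i \<Rightarrow>\<^sub>0 complex) set" where
  "tangent_cone_space I J a =
    {v. Poly_Mapping.keys v \<subseteq> I \<and>
        (\<forall>g\<in>J. (\<Sum>i\<in>I. peval (partial i g) a * Poly_Mapping.lookup v i) = 0)}"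

text \<open>Jacobian criterion for smoothness over the complex numbers; it suffices to test closed points.\<close>

definition smooth_scheme :: "'i set \<Rightarrow> 'i mpoly set \<Rightarrow> bool" where
  "smooth_scheme I J \<longleftrightarrow>
    (\<forall>a\<in>zero_locus I J.
       enat (cvec.dim (tangent_cone_space I J a)) = local_dim I (zero_locus I J) a + 1)"

text \<open>For every \<open>i\<close>, the ring of the affine chart where the coordinate \<open>x\<^sub>i\<close> does not vanish, i.e. the
  degree \<open>0\<close> part of the localisation of \<open>polys I / J\<close> at \<open>x\<^sub>i\<close>, has no nilpotents \<open>g / x\<^sub>i\<^sup>m \<noteq> 0\<close>.\<close>

definition reduced_scheme :: "'i set \<Rightarrow> 'i mpoly set \<Rightarrow> bool" where
  "reduced_scheme I J \<longleftrightarrow>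
    (\<forall>i\<in>I. \<forall>m k. \<forall>g\<in>forms I m.
       (\<exists>N. var i ^ N * g ^ k \<in> J) \<longrightarrow> (\<exists>N. var i ^ N * g \<in> J))"


section \<open>Apolarity\<close>

text \<open>The forms of degree \<open>d\<close> in \<open>X\<^sub>0, \<dots>, X\<^sub>n\<close> and in \<open>\<partial>\<^sub>0, \<dots>, \<partial>\<^sub>n\<close> are both \<open>forms {..n} d\<close>.
  As partial derivatives commute, the order of application in \<open>diff_monom\<close> is irrelevant.\<close>

definition diff_monom :: "(nat \<Rightarrow>\<^sub>0 nat) \<Rightarrow> nat mpoly \<Rightarrow> nat mpoly" where
  "diff_monom \<alpha> f =
    foldr (\<lambda>i. partial i ^^ Poly_Mapping.lookup \<alpha> i) (sorted_list_of_set (Poly_Mapping.keys \<alpha>)) f"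

definition diff_act :: "nat mpoly \<Rightarrow> nat mpoly \<Rightarrow> nat mpoly" where
  "diff_act D f = (\<Sum>\<alpha>\<in>Poly_Mapping.keys D. cscale (Poly_Mapping.lookup D \<alpha>) (diff_monom \<alpha> f))"

definition perp :: "nat \<Rightarrow> nat mpoly \<Rightarrow> nat mpoly set" where
  "perp n f = {D \<in> polys {..n}. diff_act D f = 0}"

definition codim_one_form :: "nat \<Rightarrow> nat \<Rightarrow> nat mpoly \<Rightarrow> bool" where
  "codim_one_form n d g \<longleftrightarrow> g \<in> forms {..n} d \<and> perp n g \<inter> forms {..n} 1 \<noteq> {0}"

definition s_min :: "nat \<Rightarrow> nat \<Rightarrow> nat" where
  "s_min n d = (LEAST s. \<exists>U. zariski_open (monomials {..n} d) U \<and> U \<noteq> {} \<and>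
     (\<forall>f\<in>U. \<exists>g. (\<forall>i<s. codim_one_form n d (g i)) \<and> f = (\<Sum>i<s. g i)))"

text \<open>\<open>F\<^sup>\<bottom> \<subset> \<P>T\<^sub>s\<close> for \<open>F = V(f)\<close>\<close>

definition perp_space :: "nat \<Rightarrow> nat \<Rightarrow> nat mpoly \<Rightarrow> nat mpoly set" where
  "perp_space n s f = perp n f \<inter> forms {..n} s - {0}"

definition decomposable_variety :: "nat \<Rightarrow> nat \<Rightarrow> nat mpoly set" where
  "decomposable_variety n s =
    {D. D \<noteq> 0 \<and> (\<exists>L. (\<forall>i<s. L i \<in> forms {..n} 1) \<and> D = (\<Prod>i<s. L i))}"

text \<open>The homogeneous ideal of the scheme \<open>VSH(F,s)\<close> in the coordinate ring of \<open>\<P>T\<^sub>s\<close>.\<close>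

definition VSH :: "nat \<Rightarrow> nat \<Rightarrow> nat mpoly \<Rightarrow> (nat \<Rightarrow>\<^sub>0 nat) mpoly set" where
  "VSH n s f =
    ideal_sum (vanishing_ideal (monomials {..n} s) (perp_space n s f))
              (vanishing_ideal (monomials {..n} s) (decomposable_variety n s))"

end

theory Submission
  imports Defs
    "HOL-Library.Product_Lexorder"
    "HOL-Computational_Algebra.Formal_Power_Series"
    "HOL-Computational_Algebra.Fundamental_Theorem_Algebra"
    "HOL-Computational_Algebra.Polynomial_FPS"
    "HOL-Analysis.Continuum_Not_Denumerable"
begin

text \<open>
  Let \<open>\<psi>(l) = (\<Sum>\<^sub>i l\<^sub>i \<Prod>\<^sub>j\<^sub>\<noteq>\<^sub>i L\<^sub>j) \<circ> f\<close> be the differential in \<open>L\<close> of \<open>L\<^sub>1\<cdots>L\<^sub>s \<circ> f\<close>. Suppose \<open>f\<close> has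
  algebraically independent coefficients and \<open>L\<^sub>1\<cdots>L\<^sub>s \<circ> f = 0\<close>. Applying to this equation a derivation
  of \<open>\<complex>\<close> that takes prescribed values on the coefficients of \<open>f\<close> shows that \<open>\<psi>\<close> is surjective, since
  \<open>L\<^sub>1\<cdots>L\<^sub>s\<close> acts surjectively on forms. A Nullstellensatz avoiding countably many hypersurfaces turns
  this into a nonempty open set of \<open>f\<close> for which \<open>\<psi>\<close> is surjective at every point of \<open>VSH(F,s)\<close>.

  For such \<open>f\<close>, a deformation in the kernel of \<open>\<psi>\<close> lifts order by order to a formal curve. Unless all
  deformations in the kernel just rescale the \<open>L\<^sub>i\<close>, the Zariski closure of such a curve is an irreducible
  subset of \<open>VSH(F,s)\<close> of positive dimension. So in the zero-dimensional case the kernel consists of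
  rescalings. Then no factor is repeated, the tangent space of the variety of decomposable forms is
  spanned by the products with one factor replaced, and the tangent space of \<open>VSH(F,s)\<close> is zero.
  Reducedness follows by Nakayama's lemma and the Nullstellensatz.
\<close>

text \<open>Algebraic independence is not a Zariski open condition; it enters only by contradiction.
  Critical \<open>f\<close>, together with their factors and a cokernel element \<open>h\<close>,
  solve a polynomial system. If no nonzero integer polynomial in the coefficients of
  \<open>f\<close> vanished on all solutions, the Nullstellensatz would give a solution off
  countably many hypersurfaces, that is, with algebraically independent coefficients. So such a
  polynomial exists, and its homogeneous components cut out the complement of the open set. The
  other obstacle is that \<open>VSH\<close> uses the full vanishing ideal of the set of decomposable
  forms, without generators. Closedness of this set and the bound on its tangent space need explicit
  members of the ideal. These are built on the locus \<open>D(p) = 1\<close>, where the factors can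
  be normalised and \<open>D\<close> is monic on lines \<open>T p - q\<close>; norms, computed with
  Newton's identities, remove the choice of roots, and homogenisation extends the result to all
  \<open>D\<close>. Formal curves need no convergence: the forms vanishing along a power series
  curve already define an irreducible set.\<close>

abbreviation lk :: "('a \<Rightarrow>\<^sub>0 'b::zero) \<Rightarrow> 'a \<Rightarrow> 'b" where "lk \<equiv> Poly_Mapping.lookup"
abbreviation sg :: "'a \<Rightarrow> 'b::zero \<Rightarrow> ('a \<Rightarrow>\<^sub>0 'b)" where "sg \<equiv> Poly_Mapping.single"
abbreviation ks :: "('a \<Rightarrow>\<^sub>0 'b::zero) \<Rightarrow> 'a set" where "ks \<equiv> Poly_Mapping.keys"

section \<open>Evaluation of polynomials in commutative rings\<close>

definition cst :: "complex \<Rightarrow> 'v mpoly" where "cst c = sg 0 c"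
definition xpow :: "('v \<Rightarrow>\<^sub>0 nat) \<Rightarrow> 'v mpoly" where "xpow \<alpha> = sg \<alpha> 1"

definition mev :: "('v \<Rightarrow> 'a::comm_ring_1) \<Rightarrow> ('v \<Rightarrow>\<^sub>0 nat) \<Rightarrow> 'a" where
  "mev x \<alpha> = (\<Prod>i\<in>ks \<alpha>. x i ^ lk \<alpha> i)"

text \<open>Target ring and coefficient map stay arbitrary because polynomials are evaluated at
  complex points, on lines (univariate polynomials), along formal curves (power series), at a scaled
  generic point (polynomials over power series), and by renaming variables (\<open>mpoly\<close>
  itself).\<close>

definition ev :: "(complex \<Rightarrow> 'a::comm_ring_1) \<Rightarrow> ('v \<Rightarrow> 'a) \<Rightarrow> 'v mpoly \<Rightarrow> 'a" where
  "ev h x p = (\<Sum>\<alpha>\<in>ks p. h (lk p \<alpha>) * mev x \<alpha>)"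

definition ring_hom_c :: "(complex \<Rightarrow> 'a::comm_ring_1) \<Rightarrow> bool" where
  "ring_hom_c h \<longleftrightarrow> h 1 = 1 \<and> (\<forall>a b. h (a + b) = h a + h b) \<and> (\<forall>a b. h (a * b) = h a * h b)"

lemma ring_hom_cD:
  assumes "ring_hom_c h"
  shows "h 1 = 1" "h (a + b) = h a + h b" "h (a * b) = h a * h b" "h 0 = 0" "h (- a) = - h a"
    "h (a - b) = h a - h b"
proof -
  show 1: "h 1 = 1" and 2: "\<And>a b. h (a + b) = h a + h b" and "h (a * b) = h a * h b"
    using assms by (auto simp: ring_hom_c_def)
  from 2[of 0 0] show 3: "h 0 = 0" by simp
  from 2[of a "- a"] 3 show 4: "h (- a) = - h a" by (simp add: eq_neg_iff_add_eq_0 add.commute)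
  show "h (a - b) = h a - h b"
    using 2[of "a - b" b] by simp
qed

lemma ring_hom_c_id [simp]: "ring_hom_c (\<lambda>a. a)" "ring_hom_c id"
  by (auto simp: ring_hom_c_def)

lemma mev_superset:
  assumes "finite A" "ks \<alpha> \<subseteq> A"
  shows "mev x \<alpha> = (\<Prod>i\<in>A. x i ^ lk \<alpha> i)"
  unfolding mev_def using assms
  by (intro prod.mono_neutral_left) (auto simp: in_keys_iff)

lemma mev_0 [simp]: "mev x 0 = 1"
  by (simp add: mev_def)

lemma mev_add: "mev x (\<alpha> + \<beta>) = mev x \<alpha> * mev x \<beta>"
proof -
  let ?A = "ks \<alpha> \<union> ks \<beta>"
  have "mev x (\<alpha> + \<beta>) = (\<Prod>i\<in>?A. x i ^ lk (\<alpha> + \<beta>) i)"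
    by (intro mev_superset) (auto dest: subsetD[OF Poly_Mapping.keys_add])
  also have "\<dots> = mev x \<alpha> * mev x \<beta>"
    by (simp add: lookup_add power_add prod.distrib mev_superset[of ?A \<alpha>] mev_superset[of ?A \<beta>])
  finally show ?thesis .
qed

lemma mev_single: "mev x (sg i k) = x i ^ k"
  by (cases "k = 0") (auto simp: mev_def)

lemma ev_superset:
  assumes "ring_hom_c h" "finite A" "ks p \<subseteq> A"
  shows "ev h x p = (\<Sum>\<alpha>\<in>A. h (lk p \<alpha>) * mev x \<alpha>)"
  unfolding ev_def using assms
  by (intro sum.mono_neutral_left) (auto simp: in_keys_iff ring_hom_cD(4))

lemma ev_0 [simp]: "ev h x 0 = 0"
  by (simp add: ev_def)

lemma ev_single: "ring_hom_c h \<Longrightarrow> ev h x (sg \<alpha> c) = h c * mev x \<alpha>"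
  by (cases "c = 0") (auto simp: ev_def ring_hom_cD(4))

lemma ev_add:
  assumes "ring_hom_c h"
  shows "ev h x (p + q) = ev h x p + ev h x q"
proof -
  let ?A = "ks p \<union> ks q"
  have "ev h x (p + q) = (\<Sum>\<alpha>\<in>?A. h (lk (p + q) \<alpha>) * mev x \<alpha>)"
    by (intro ev_superset[OF assms]) (auto dest: subsetD[OF Poly_Mapping.keys_add])
  also have "\<dots> = ev h x p + ev h x q"
    by (simp add: lookup_add ring_hom_cD[OF assms] distrib_right sum.distrib
        ev_superset[OF assms, of ?A p] ev_superset[OF assms, of ?A q])
  finally show ?thesis .
qed

lemma mpoly_sum_singles: "p = (\<Sum>\<alpha>\<in>ks p. sg \<alpha> (lk p \<alpha>))"
  by (rule poly_mapping_eqI) (auto simp: lookup_sum lookup_single when_def in_keys_iff)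

lemma mpoly_single_induct [case_names add single]:
  assumes "\<And>p q. P p \<Longrightarrow> P q \<Longrightarrow> P (p + q)" "\<And>\<alpha> c. P (sg \<alpha> c)"
  shows "P (p :: ('a \<Rightarrow>\<^sub>0 'b::comm_monoid_add))"
proof -
  have "P (\<Sum>\<alpha>\<in>A. sg \<alpha> (g \<alpha>))" if "finite A" for A and g :: "'a \<Rightarrow> 'b"
    using that
  proof induction
    case empty
    show ?case using assms(2)[of undefined 0] by simp
  next
    case (insert x F)
    thus ?case by (simp add: assms)
  qed
  moreover have "p = (\<Sum>\<alpha>\<in>ks p. sg \<alpha> (lk p \<alpha>))"
    by (rule poly_mapping_eqI) (auto simp: lookup_sum lookup_single when_def in_keys_iff)
  ultimately show ?thesis by (metis finite_keys)
qed

lemma ev_mult: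
  assumes "ring_hom_c h"
  shows "ev h x (p * q) = ev h x p * ev h x q"
proof (induction p rule: mpoly_single_induct)
  case (add p1 p2)
  thus ?case by (simp add: distrib_right ev_add[OF assms])
next
  case (single \<alpha> c)
  show ?case
  proof (induction q rule: mpoly_single_induct)
    case (add q1 q2)
    thus ?case by (simp add: distrib_left ev_add[OF assms])
  next
    case (single \<beta> d)
    show ?case
      by (simp add: mult_single ev_single[OF assms] ring_hom_cD[OF assms] mev_add mult_ac)
  qed
qed

lemma ev_cst: "ring_hom_c h \<Longrightarrow> ev h x (cst c) = h c"
  by (simp add: cst_def ev_single)

lemma cst_0 [simp]: "cst 0 = 0" and cst_1 [simp]: "cst 1 = 1"
  by (simp_all add: cst_def)

lemma cst_add: "cst (a + b) = cst a + cst b"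
  and cst_mult: "cst (a * b) = cst a * cst b"
  and cst_minus: "cst (- a) = - cst a"
  and cst_diff: "cst (a - b) = cst a - cst b"
  by (simp_all add: cst_def single_add mult_single single_uminus single_diff)

lemma lookup_cst_mult [simp]: "lk (cst c * p) \<alpha> = c * lk p \<alpha>"
  by (simp add: cst_def flip: mult_map_scale_conv_mult)
     (simp add: Poly_Mapping.map.rep_eq when_def)

lemma cscale_cst: "cscale c p = cst c * p"
  by (rule poly_mapping_eqI) simp

lemma ev_1: "ring_hom_c h \<Longrightarrow> ev h x 1 = 1"
  using ev_cst[of h x 1] by (simp add: ring_hom_cD(1))

lemma ev_var: "ring_hom_c h \<Longrightarrow> ev h x (var i) = x i"
  by (simp add: var_def ev_single mev_single ring_hom_cD(1))

lemma ev_uminus: "ring_hom_c h \<Longrightarrow> ev h x (- p) = - ev h x p"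
  using ev_add[of h x p "- p"] by (simp add: eq_neg_iff_add_eq_0 add.commute)

lemma ev_diff: "ring_hom_c h \<Longrightarrow> ev h x (p - q) = ev h x p - ev h x q"
  using ev_add[of h x p "- q"] by (simp add: ev_uminus)

lemma ev_sum: "ring_hom_c h \<Longrightarrow> ev h x (sum f A) = (\<Sum>a\<in>A. ev h x (f a))"
  by (induction A rule: infinite_finite_induct) (simp_all add: ev_add)

lemma ev_prod: "ring_hom_c h \<Longrightarrow> ev h x (prod f A) = (\<Prod>a\<in>A. ev h x (f a))"
  by (induction A rule: infinite_finite_induct) (simp_all add: ev_mult ev_1)

lemma ev_power: "ring_hom_c h \<Longrightarrow> ev h x (p ^ k) = ev h x p ^ k"
  by (induction k) (simp_all add: ev_mult ev_1)

lemmas ev_simps = ev_add ev_mult ev_cst ev_1 ev_var ev_uminus ev_diff ev_sum ev_prod ev_power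

lemma mev_cong: "(\<And>i. i \<in> ks \<alpha> \<Longrightarrow> x i = y i) \<Longrightarrow> mev x \<alpha> = mev y \<alpha>"
  unfolding mev_def by (intro prod.cong) auto

lemma ev_cong_polys:
  assumes "p \<in> polys I" "\<And>i. i \<in> I \<Longrightarrow> x i = y i"
  shows "ev h x p = ev h y p"
  unfolding ev_def using assms by (intro sum.cong refl arg_cong2[where f="(*)"] mev_cong) (auto simp: polys_def)

abbreviation evc :: "('v \<Rightarrow> complex) \<Rightarrow> 'v mpoly \<Rightarrow> complex" where "evc \<equiv> ev (\<lambda>a. a)"

lemma peval_evc: "peval p a = evc (lk a) p"
  by (simp add: peval_def ev_def mev_def)

section \<open>Closure properties\<close>

lemma polys_single: "sg \<alpha> c \<in> polys I \<longleftrightarrow> c = 0 \<or> ks \<alpha> \<subseteq> I"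
  by (auto simp: polys_def)

lemma polys_cst [simp]: "cst c \<in> polys I"
  by (simp add: cst_def polys_single)

lemma polys_0 [simp]: "0 \<in> polys I" and polys_1 [simp]: "1 \<in> polys I"
  using polys_cst[of 0 I] polys_cst[of 1 I] by simp_all

lemma polys_var: "i \<in> I \<Longrightarrow> var i \<in> polys I"
  by (simp add: var_def polys_single)

lemma polys_add: "p \<in> polys I \<Longrightarrow> q \<in> polys I \<Longrightarrow> p + q \<in> polys I"
  unfolding polys_def using Poly_Mapping.keys_add[of p q] by blast

lemma polys_mult: assumes "p \<in> polys I" "q \<in> polys I" shows "p * q \<in> polys I"
proof -
  have "ks \<gamma> \<subseteq> I" if g: "\<gamma> \<in> ks (p * q)" for \<gamma>
  proof -
    obtain \<alpha> \<beta> where "\<gamma> = \<alpha> + \<beta>" "\<alpha> \<in> ks p" "\<beta> \<in> ks q"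
      using subsetD[OF keys_mult g] by blast
    thus ?thesis using assms Poly_Mapping.keys_add[of \<alpha> \<beta>] unfolding polys_def by blast
  qed
  thus ?thesis by (simp add: polys_def)
qed

lemma polys_uminus: "p \<in> polys I \<Longrightarrow> - p \<in> polys I"
  by (simp add: polys_def)

lemma polys_diff: "p \<in> polys I \<Longrightarrow> q \<in> polys I \<Longrightarrow> p - q \<in> polys I"
  using polys_add[of p I "- q"] polys_uminus[of q I] by simp

lemma polys_sum: "(\<And>a. a \<in> A \<Longrightarrow> f a \<in> polys I) \<Longrightarrow> sum f A \<in> polys I"
  by (induction A rule: infinite_finite_induct) (auto intro: polys_add)

lemma polys_prod: "(\<And>a. a \<in> A \<Longrightarrow> f a \<in> polys I) \<Longrightarrow> prod f A \<in> polys I"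
  by (induction A rule: infinite_finite_induct) (auto intro: polys_mult)

lemma polys_power: "p \<in> polys I \<Longrightarrow> p ^ k \<in> polys I"
  by (induction k) (auto intro: polys_mult)

lemmas polys_intros = polys_cst polys_0 polys_1 polys_var polys_add polys_mult polys_uminus
  polys_diff polys_sum polys_prod polys_power

lemma polys_mono: "I \<subseteq> I' \<Longrightarrow> polys I \<subseteq> polys I'"
  by (auto simp: polys_def)

lemma single_prod_sum:
  "finite A \<Longrightarrow> (\<Prod>a\<in>A. sg (f a) (1::complex)) = sg (\<Sum>a\<in>A. f a) 1"
  by (induction A rule: finite_induct) (simp_all add: mult_single)

lemma var_power: "var i ^ k = sg (sg i k) 1"
  by (induction k) (simp_all add: var_def mult_single flip: single_add)

lemma expo_sum_singles: "(\<alpha> :: 'a \<Rightarrow>\<^sub>0 nat) = (\<Sum>i\<in>ks \<alpha>. sg i (lk \<alpha> i))"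
  by (rule poly_mapping_eqI) (auto simp: lookup_sum lookup_single when_def in_keys_iff)

lemma single_eq_prod_var: "sg \<alpha> c = cst c * (\<Prod>i\<in>ks \<alpha>. var i ^ lk \<alpha> i)"
proof -
  have "(\<Prod>i\<in>ks \<alpha>. var i ^ lk \<alpha> i) = sg \<alpha> (1::complex)"
    unfolding var_power single_prod_sum[OF finite_keys] expo_sum_singles[symmetric] ..
  thus ?thesis by (simp add: cst_def mult_single)
qed

lemma polys_induct [consumes 1, case_names cst var add mult]:
  assumes "p \<in> polys I" "\<And>c. P (cst c)" "\<And>i. i \<in> I \<Longrightarrow> P (var i)"
    "\<And>p q. p \<in> polys I \<Longrightarrow> q \<in> polys I \<Longrightarrow> P p \<Longrightarrow> P q \<Longrightarrow> P (p + q)"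
    "\<And>p q. p \<in> polys I \<Longrightarrow> q \<in> polys I \<Longrightarrow> P p \<Longrightarrow> P q \<Longrightarrow> P (p * q)"
  shows "P p"
proof -
  let ?Q = "\<lambda>p. p \<in> polys I \<and> P p"
  have one: "?Q 1" and zero: "?Q 0" using assms(2)[of 1] assms(2)[of 0] by simp_all
  have pow: "?Q (var i ^ k)" if "i \<in> I" for i k
    using that by (induction k) (auto simp: one intro!: polys_intros assms)
  have pr: "?Q (\<Prod>i\<in>A. var i ^ g i)" if "A \<subseteq> I" "finite A" for A and g :: "_ \<Rightarrow> nat"
    using that(2,1) pow by (induction A rule: finite_induct) (auto simp: one intro!: polys_intros assms)
  have si: "?Q (sg \<alpha> c)" if "ks \<alpha> \<subseteq> I" for \<alpha> c
    unfolding single_eq_prod_var using pr[OF that, of "lk \<alpha>"] assms(2)[of c]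
    by (auto intro!: polys_intros assms)
  have su: "?Q (\<Sum>\<alpha>\<in>A. sg \<alpha> (g \<alpha>))" if "finite A" "\<And>\<alpha>. \<alpha> \<in> A \<Longrightarrow> ks \<alpha> \<subseteq> I" for A g
    using that by (induction A rule: finite_induct) (auto simp: zero si intro!: polys_intros assms)
  have "?Q (\<Sum>\<alpha>\<in>ks p. sg \<alpha> (lk p \<alpha>))"
    using assms(1) by (intro su) (auto simp: polys_def)
  thus ?thesis unfolding mpoly_sum_singles[symmetric] ..
qed

lemma polys_UNIV [simp]: "p \<in> polys UNIV"
  by (simp add: polys_def)

text \<open>The universal property of polynomial rings. Every specialisation of a parameter below,
  such as inserting a value into a univariate polynomial or taking the constant term of a power
  series, is an instance.\<close>

lemma ev_ev:
  assumes "ring_hom_c h" "ring_hom_c k" "ring_hom_c g"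
    "\<And>a b. \<phi> (a + b) = \<phi> a + \<phi> b" "\<And>a b. \<phi> (a * b) = \<phi> a * \<phi> b" "\<And>c. \<phi> (h c) = k c"
  shows "\<phi> (ev h x p) = ev k (\<lambda>i. \<phi> (x i)) p"
  using polys_UNIV[of p]
  by (induction p rule: polys_induct) (simp_all add: ev_simps assms)

section \<open>Degrees and homogeneous components\<close>

definition mdeg :: "('v \<Rightarrow>\<^sub>0 nat) \<Rightarrow> nat" where
  "mdeg \<alpha> = (\<Sum>i\<in>ks \<alpha>. lk \<alpha> i)"

lemma mdeg_superset: "finite A \<Longrightarrow> ks \<alpha> \<subseteq> A \<Longrightarrow> mdeg \<alpha> = (\<Sum>i\<in>A. lk \<alpha> i)"
  unfolding mdeg_def by (intro sum.mono_neutral_left) (auto simp: in_keys_iff)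

lemma mdeg_add: "mdeg (\<alpha> + \<beta>) = mdeg \<alpha> + mdeg \<beta>"
proof -
  let ?A = "ks \<alpha> \<union> ks \<beta>"
  have "mdeg (\<alpha> + \<beta>) = (\<Sum>i\<in>?A. lk (\<alpha> + \<beta>) i)"
    by (intro mdeg_superset) (auto dest: subsetD[OF Poly_Mapping.keys_add])
  also have "\<dots> = mdeg \<alpha> + mdeg \<beta>"
    by (simp add: lookup_add sum.distrib mdeg_superset[of ?A \<alpha>] mdeg_superset[of ?A \<beta>])
  finally show ?thesis .
qed

lemma mdeg_single [simp]: "mdeg (sg i k) = k"
  by (cases "k = 0") (auto simp: mdeg_def)

lemma mdeg_0 [simp]: "mdeg 0 = 0"
  by (simp add: mdeg_def)

lemma in_monomials: "\<alpha> \<in> monomials I d \<longleftrightarrow> ks \<alpha> \<subseteq> I \<and> mdeg \<alpha> = d"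
  by (simp add: monomials_def mdeg_def)

lemma keys_add_nat: "ks (\<alpha> + \<beta>) = ks \<alpha> \<union> ks (\<beta> :: 'a \<Rightarrow>\<^sub>0 nat)"
  by (auto simp: in_keys_iff lookup_add)

lemma monomials_add: "\<alpha> \<in> monomials I a \<Longrightarrow> \<beta> \<in> monomials I b \<Longrightarrow> \<alpha> + \<beta> \<in> monomials I (a + b)"
  by (auto simp: in_monomials mdeg_add keys_add_nat)

lemma finite_monomials [simp]:
  assumes "finite I" shows "finite (monomials I d)"
proof -
  have "inj_on (\<lambda>\<alpha>. restrict (lk \<alpha>) I) (monomials I d)"
  proof (rule inj_onI)
    fix \<alpha> \<beta> assume *: "\<alpha> \<in> monomials I d" "\<beta> \<in> monomials I d" "restrict (lk \<alpha>) I = restrict (lk \<beta>) I"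
    show "\<alpha> = \<beta>"
    proof (rule poly_mapping_eqI)
      fix i show "lk \<alpha> i = lk \<beta> i"
      proof (cases "i \<in> I")
        case True thus ?thesis using fun_cong[OF *(3), of i] by simp
      next
        case False
        hence "i \<notin> ks \<alpha>" "i \<notin> ks \<beta>" using * by (auto simp: in_monomials)
        thus ?thesis by (simp add: in_keys_iff)
      qed
    qed
  qed
  moreover have le: "lk \<alpha> i \<le> d" if "\<alpha> \<in> monomials I d" "i \<in> I" for \<alpha> i
    using member_le_sum[of i I "lk \<alpha>"] assms mdeg_superset[of I \<alpha>] that by (auto simp: in_monomials)
  hence "(\<lambda>\<alpha>. restrict (lk \<alpha>) I) ` monomials I d \<subseteq> PiE I (\<lambda>_. {..d})"
    by auto
  moreover have "finite (PiE I (\<lambda>_. {..d}))" using assms by (intro finite_PiE) auto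
  ultimately show ?thesis by (meson finite_imageD finite_subset)
qed

lemma forms_add: "p \<in> forms I d \<Longrightarrow> q \<in> forms I d \<Longrightarrow> p + q \<in> forms I d"
  unfolding forms_def using Poly_Mapping.keys_add[of p q] by blast

lemma forms_0 [simp]: "0 \<in> forms I d"
  by (simp add: forms_def)

lemma forms_single: "sg \<alpha> c \<in> forms I d \<longleftrightarrow> c = 0 \<or> \<alpha> \<in> monomials I d"
  by (auto simp: forms_def)

lemma forms_mult:
  assumes "p \<in> forms I a" "q \<in> forms I b" shows "p * q \<in> forms I (a + b)"
  using keys_mult[of p q] assms unfolding forms_def by (blast intro: monomials_add)

lemma forms_cst: "cst c \<in> forms I 0"
  by (simp add: cst_def forms_single in_monomials)

lemma forms_1: "1 \<in> forms I 0"
  using forms_cst[of 1] by simp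

lemma forms_cst_mult: "p \<in> forms I d \<Longrightarrow> cst c * p \<in> forms I d"
  using forms_mult[OF forms_cst, of p I d c] by simp

lemma forms_uminus: "p \<in> forms I d \<Longrightarrow> - p \<in> forms I d"
  by (simp add: forms_def)

lemma forms_diff: "p \<in> forms I d \<Longrightarrow> q \<in> forms I d \<Longrightarrow> p - q \<in> forms I d"
  using forms_add[of p I d "- q"] forms_uminus[of q I d] by simp

lemma forms_sum: "(\<And>a. a \<in> A \<Longrightarrow> f a \<in> forms I d) \<Longrightarrow> sum f A \<in> forms I d"
  by (induction A rule: infinite_finite_induct) (auto intro: forms_add)

lemma forms_prod:
  assumes "finite A" "\<And>a. a \<in> A \<Longrightarrow> f a \<in> forms I 1"
  shows "prod f A \<in> forms I (card A)"
  using assms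
proof (induction A rule: finite_induct)
  case empty thus ?case by (simp add: forms_1)
next
  case (insert x F)
  thus ?case using forms_mult[of "f x" I 1 "prod f F" "card F"] by simp
qed

lemma forms_power: "p \<in> forms I a \<Longrightarrow> p ^ k \<in> forms I (k * a)"
  by (induction k) (auto simp: forms_1 intro: forms_mult)

lemma forms_var: "i \<in> I \<Longrightarrow> var i \<in> forms I 1"
  by (simp add: var_def forms_single in_monomials)

lemma forms_polys: "p \<in> forms I d \<Longrightarrow> p \<in> polys I"
  unfolding forms_def polys_def monomials_def by blast

definition homc :: "nat \<Rightarrow> 'v mpoly \<Rightarrow> 'v mpoly" where
  "homc m p = (\<Sum>\<alpha>\<in>{\<alpha> \<in> ks p. mdeg \<alpha> = m}. sg \<alpha> (lk p \<alpha>))"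

lemma lookup_homc: "lk (homc m p) \<alpha> = (if mdeg \<alpha> = m then lk p \<alpha> else 0)"
proof -
  have "lk (homc m p) \<alpha> = (\<Sum>\<beta>\<in>{\<beta> \<in> ks p. mdeg \<beta> = m}. if \<beta> = \<alpha> then lk p \<alpha> else 0)"
    by (auto simp: homc_def lookup_sum lookup_single when_def intro: sum.cong)
  thus ?thesis by (auto simp: in_keys_iff)
qed

lemma homc_add: "homc m (p + q) = homc m p + homc m q"
  by (rule poly_mapping_eqI) (simp add: lookup_homc lookup_add)

lemma homc_0 [simp]: "homc m 0 = 0"
  by (rule poly_mapping_eqI) (simp add: lookup_homc)

lemma homc_forms: assumes "p \<in> polys I" shows "homc m p \<in> forms I m"
proof -
  have "\<alpha> \<in> monomials I m" if "\<alpha> \<in> ks (homc m p)" for \<alpha>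
    using that assms by (auto simp: in_keys_iff lookup_homc polys_def in_monomials split: if_splits)
  thus ?thesis by (auto simp: forms_def)
qed

definition tdeg :: "'v mpoly \<Rightarrow> nat" where
  "tdeg p = Max (insert 0 (mdeg ` ks p))"

lemma mdeg_le_tdeg: "\<alpha> \<in> ks p \<Longrightarrow> mdeg \<alpha> \<le> tdeg p"
  unfolding tdeg_def by (intro Max_ge) auto

lemma homc_sum_le: assumes "tdeg p \<le> K" shows "(\<Sum>m\<le>K. homc m p) = p"
proof (rule poly_mapping_eqI)
  fix \<alpha>
  have "lk (\<Sum>m\<le>K. homc m p) \<alpha> = (\<Sum>m\<le>K. if m = mdeg \<alpha> then lk p \<alpha> else 0)"
    by (simp add: lookup_sum lookup_homc eq_commute cong: if_cong)
  also have "\<dots> = lk p \<alpha>"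
    using mdeg_le_tdeg[of \<alpha> p] assms by (cases "lk p \<alpha> = 0") (auto simp: in_keys_iff)
  finally show "lk (\<Sum>m\<le>K. homc m p) \<alpha> = lk p \<alpha>" .
qed

lemma homc_gt: "tdeg p < m \<Longrightarrow> homc m p = 0"
  using mdeg_le_tdeg[of _ p] by (intro poly_mapping_eqI) (force simp: lookup_homc in_keys_iff)

lemma homc_form: "p \<in> forms I d \<Longrightarrow> homc m p = (if m = d then p else 0)"
  by (rule poly_mapping_eqI) (auto simp: lookup_homc forms_def in_monomials in_keys_iff)

lemma mev_scale: "mev (\<lambda>i. c * x i) \<alpha> = c ^ mdeg \<alpha> * mev x \<alpha>"
  by (simp add: mev_def mdeg_def power_mult_distrib prod.distrib power_sum)

lemma ev_scale_form:
  assumes "ring_hom_c h" "p \<in> forms I m"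
  shows "ev h (\<lambda>i. c * x i) p = c ^ m * ev h x p"
proof -
  have "ev h (\<lambda>i. c * x i) p = (\<Sum>\<alpha>\<in>ks p. h (lk p \<alpha>) * (c ^ m * mev x \<alpha>))"
    unfolding ev_def mev_scale using assms(2)
    by (intro sum.cong refl) (auto simp: forms_def in_monomials)
  thus ?thesis by (simp add: ev_def sum_distrib_left mult_ac)
qed

text \<open>On the line through the origin and \<open>x\<close> the polynomial becomes univariate in
  \<open>c\<close>, with the value of \<open>homc m p\<close> at \<open>x\<close> as its coefficient
  of order \<open>m\<close>; infinitely many zeros kill all coefficients. This makes vanishing
  ideals of cones homogeneous.\<close>

lemma homc_vanish:
  assumes "p \<in> polys I" "infinite C" "\<And>c. c \<in> C \<Longrightarrow> evc (\<lambda>i. c * x i) p = 0"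
  shows "evc x (homc m p) = 0"
proof -
  define P where "P = (\<Sum>m\<le>tdeg p. monom (evc x (homc m p)) m)"
  have P: "poly P c = evc (\<lambda>i. c * x i) p" for c
  proof -
    have "evc (\<lambda>i. c * x i) p = evc (\<lambda>i. c * x i) (\<Sum>m\<le>tdeg p. homc m p)"
      by (simp add: homc_sum_le)
    also have "\<dots> = (\<Sum>m\<le>tdeg p. c ^ m * evc x (homc m p))"
      by (simp add: ev_sum ev_scale_form[OF _ homc_forms[OF assms(1)]])
    finally show ?thesis by (simp add: P_def poly_sum poly_monom mult.commute)
  qed
  have "C \<subseteq> {c. poly P c = 0}" using P assms(3) by auto
  hence "P = 0" using assms(2) poly_roots_finite[of P] by (meson finite_subset)
  have "coeff P m = (if m \<le> tdeg p then evc x (homc m p) else 0)"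
    unfolding P_def by (simp add: coeff_sum)
  with \<open>P = 0\<close> homc_gt[of p m] show ?thesis by (auto split: if_splits)
qed

section \<open>Partial derivatives\<close>

lemma lookup_partial: "lk (partial i p) \<beta> = of_nat (lk \<beta> i + 1) * lk p (\<beta> + sg i 1)"
proof -
  have "lk (partial i p) \<beta> = (\<Sum>\<alpha>\<in>ks p. if \<alpha> = \<beta> + sg i 1 then of_nat (lk \<beta> i + 1) * lk p (\<beta> + sg i 1) else 0)"
    unfolding partial_def lookup_sum
  proof (intro sum.cong refl)
    fix \<alpha> assume "\<alpha> \<in> ks p"
    show "lk (sg (\<alpha> - sg i 1) (of_nat (lk \<alpha> i) * lk p \<alpha>)) \<beta> =
        (if \<alpha> = \<beta> + sg i 1 then of_nat (lk \<beta> i + 1) * lk p (\<beta> + sg i 1) else 0)"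
    proof (cases "lk \<alpha> i = 0")
      case True
      hence "\<alpha> \<noteq> \<beta> + sg i 1" by (auto simp: lookup_add)
      thus ?thesis using True by simp
    next
      case False
      have "\<alpha> - sg i 1 = \<beta> \<longleftrightarrow> \<alpha> = \<beta> + sg i 1"
      proof
        assume "\<alpha> - sg i 1 = \<beta>"
        thus "\<alpha> = \<beta> + sg i 1"
          using False by (intro poly_mapping_eqI) (auto simp: lookup_add lookup_minus lookup_single when_def)
      qed simp
      thus ?thesis by (auto simp: lookup_single when_def lookup_add)
    qed
  qed
  thus ?thesis by (auto simp: in_keys_iff)
qed

lemma partial_add: "partial i (p + q) = partial i p + partial i q"
  by (rule poly_mapping_eqI) (simp add: lookup_partial lookup_add distrib_left)

lemma partial_0 [simp]: "partial i 0 = 0"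
  by (rule poly_mapping_eqI) (simp add: lookup_partial)

lemma partial_single: "partial i (sg \<alpha> c) = sg (\<alpha> - sg i 1) (of_nat (lk \<alpha> i) * c)"
  by (cases "c = 0") (auto simp: partial_def)

lemma partial_cst [simp]: "partial i (cst c) = 0"
  by (simp add: cst_def partial_single)

lemma partial_1 [simp]: "partial i 1 = 0"
  using partial_cst[of i 1] by simp

lemma partial_var: "partial i (var j) = (if i = j then 1 else 0)"
  by (auto simp: var_def partial_single lookup_single when_def)

lemma partial_mult: "partial i (p * q) = partial i p * q + p * partial i q"
proof (induction p rule: mpoly_single_induct)
  case (add p1 p2)
  thus ?case by (simp add: distrib_right distrib_left partial_add)
next
  case (single \<alpha> c)
  show ?case
  proof (induction q rule: mpoly_single_induct)
    case (add q1 q2)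
    thus ?case by (simp add: distrib_left distrib_right partial_add)
  next
    case (single \<beta> d)
    have sub: "(\<alpha> - sg i 1) + \<beta> = \<alpha> + \<beta> - sg i 1" if "lk \<alpha> i \<noteq> 0" for \<alpha> \<beta> :: "'a \<Rightarrow>\<^sub>0 nat"
      using that by (intro poly_mapping_eqI) (auto simp: lookup_add lookup_minus lookup_single when_def)
    have 1: "partial i (sg \<alpha> c) * sg \<beta> d = sg (\<alpha> + \<beta> - sg i 1) (of_nat (lk \<alpha> i) * c * d)"
      using sub[of \<alpha> \<beta>] by (cases "lk \<alpha> i = 0") (auto simp: partial_single mult_single)
    have 2: "sg \<alpha> c * partial i (sg \<beta> d) = sg (\<alpha> + \<beta> - sg i 1) (of_nat (lk \<beta> i) * c * d)"
      using sub[of \<beta> \<alpha>] by (cases "lk \<beta> i = 0") (auto simp: partial_single mult_single add.commute mult_ac)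
    show ?case
      unfolding 1 2 by (simp add: mult_single partial_single lookup_add algebra_simps flip: single_add)
  qed
qed

lemma partial_diff: "partial i (p - q) = partial i p - partial i q"
  by (rule poly_mapping_eqI) (simp add: lookup_partial lookup_minus algebra_simps)

lemma partial_sum: "partial i (sum f A) = (\<Sum>a\<in>A. partial i (f a))"
  by (induction A rule: infinite_finite_induct) (simp_all add: partial_add)

lemma partial_prod:
  "finite A \<Longrightarrow> partial i (prod f A) = (\<Sum>a\<in>A. partial i (f a) * prod f (A - {a}))"
proof (induction A rule: finite_induct)
  case (insert x F)
  have "(\<Sum>a\<in>F. partial i (f a) * prod f (insert x F - {a})) = (\<Sum>a\<in>F. partial i (f a) * (f x * prod f (F - {a})))"
  proof (intro sum.cong refl)
    fix a assume "a \<in> F"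
    hence "insert x F - {a} = insert x (F - {a})" using insert by auto
    thus "partial i (f a) * prod f (insert x F - {a}) = partial i (f a) * (f x * prod f (F - {a}))"
      using insert by simp
  qed
  thus ?case using insert
    by (simp add: partial_mult sum_distrib_left mult_ac)
qed auto

lemma polys_partial: "p \<in> polys I \<Longrightarrow> partial i p \<in> polys I"
  by (induction p rule: polys_induct) (auto simp: partial_add partial_mult partial_var intro!: polys_intros)

text \<open>Chain rule; it links the Jacobian in \<open>tangent_cone_space\<close> to derivatives
  along explicit curves.\<close>

lemma DERIV_evc:
  assumes "p \<in> polys I" "finite I" "\<And>i. i \<in> I \<Longrightarrow> ((\<lambda>t. c t i) has_field_derivative c' i) (at t0)"
  shows "((\<lambda>t. evc (c t) p) has_field_derivative (\<Sum>i\<in>I. evc (c t0) (partial i p) * c' i)) (at t0)"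
  using assms(1)
proof (induction p rule: polys_induct)
  case (cst a)
  show ?case by (simp add: ev_simps)
next
  case (var i)
  have "(\<Sum>j\<in>I. evc (c t0) (partial j (var i)) * c' j) = c' i"
    using var assms(2) by (simp add: partial_var ev_simps if_distrib if_distribR cong: if_cong)
  thus ?case using assms(3)[OF var] by (simp add: ev_simps)
next
  case (add p q)
  show ?case
    using DERIV_add[OF add(3,4)] by (simp add: ev_simps partial_add distrib_right sum.distrib)
next
  case (mult p q)
  show ?case
    using DERIV_mult[OF mult(3,4)]
    by (simp add: ev_simps partial_mult distrib_left distrib_right sum.distrib sum_distrib_left sum_distrib_right mult_ac add_ac)
qed

text \<open>Hadamard's form of the first order expansion: the quotients \<open>M k\<close> are
  polynomials with the values of the partial derivatives at \<open>a\<close>, so members of an ideal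
  become a linear system in the \<open>var k - cst (a k)\<close>.\<close>

lemma taylor1:
  assumes "p \<in> polys I" "finite I"
  obtains M where "\<And>k. M k \<in> polys I" "\<And>k. evc a (M k) = evc a (partial k p)"
    "p = cst (evc a p) + (\<Sum>k\<in>I. M k * (var k - cst (a k)))"
proof -
  have "\<exists>M. (\<forall>k. M k \<in> polys I) \<and> (\<forall>k. evc a (M k) = evc a (partial k p)) \<and>
    p = cst (evc a p) + (\<Sum>k\<in>I. M k * (var k - cst (a k)))" (is "\<exists>M. ?Q p M")
    using assms(1)
  proof (induction p rule: polys_induct)
    case (cst c)
    have "?Q (cst c) (\<lambda>_. 0)" by (simp add: ev_simps)
    thus ?case by (intro exI[of _ "\<lambda>_. 0"])
  next
    case (var i)
    have "?Q (var i) (\<lambda>k. if k = i then 1 else 0)"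
      using var assms(2) by (auto simp: ev_simps partial_var if_distrib if_distribR cong: if_cong)
    thus ?case by (intro exI[of _ "\<lambda>k. if k = i then 1 else 0"])
  next
    case (add p q)
    then obtain M N where MN: "?Q p M" "?Q q N" by blast
    have "?Q (p + q) (\<lambda>k. M k + N k)"
    proof (intro conjI allI)
      have "p + q = (cst (evc a p) + (\<Sum>k\<in>I. M k * (var k - cst (a k)))) +
         (cst (evc a q) + (\<Sum>k\<in>I. N k * (var k - cst (a k))))"
        using MN by (simp only:)
      thus "p + q = cst (evc a (p + q)) + (\<Sum>k\<in>I. (M k + N k) * (var k - cst (a k)))"
        by (simp add: ev_simps cst_add distrib_right sum.distrib)
    qed (use MN in \<open>auto simp: ev_simps partial_add intro: polys_intros\<close>)
    thus ?case by (intro exI[of _ "\<lambda>k. M k + N k"])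
  next
    case (mult p q)
    then obtain M N where MN: "?Q p M" "?Q q N" by blast
    have "?Q (p * q) (\<lambda>k. M k * q + cst (evc a p) * N k)"
    proof (intro conjI allI)
      let ?S = "\<Sum>k\<in>I. M k * (var k - cst (a k))" let ?T = "\<Sum>k\<in>I. N k * (var k - cst (a k))"
      have p: "p = cst (evc a p) + ?S" and q: "q = cst (evc a q) + ?T" using MN by blast+
      have "p * q = (cst (evc a p) + ?S) * q" using p by simp
      also have "\<dots> = cst (evc a p) * q + ?S * q" by (simp add: distrib_right)
      also have "cst (evc a p) * q = cst (evc a p) * (cst (evc a q) + ?T)" using q by simp
      finally show "p * q = cst (evc a (p * q)) + (\<Sum>k\<in>I. (M k * q + cst (evc a p) * N k) * (var k - cst (a k)))"
        by (simp add: ev_simps cst_mult distrib_right distrib_left sum.distrib sum_distrib_left sum_distrib_right mult_ac)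
    qed (use MN mult in \<open>auto simp: ev_simps partial_mult intro!: polys_intros\<close>)
    thus ?case by (intro exI[of _ "\<lambda>k. M k * q + cst (evc a p) * N k"])
  qed
  thus ?thesis using that by blast
qed

section \<open>A Nullstellensatz avoiding countably many hypersurfaces\<close>

definition poly_ideal :: "'v set \<Rightarrow> 'v mpoly set \<Rightarrow> bool" where
  "poly_ideal I J \<longleftrightarrow> J \<subseteq> polys I \<and> 0 \<in> J \<and> (\<forall>p\<in>J. \<forall>q\<in>J. p + q \<in> J) \<and>
     (\<forall>r\<in>polys I. \<forall>p\<in>J. r * p \<in> J)"

lemma poly_idealD:
  assumes "poly_ideal I J"
  shows "p \<in> J \<Longrightarrow> p \<in> polys I" "0 \<in> J" "p \<in> J \<Longrightarrow> q \<in> J \<Longrightarrow> p + q \<in> J"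
    "r \<in> polys I \<Longrightarrow> p \<in> J \<Longrightarrow> r * p \<in> J" "r \<in> polys I \<Longrightarrow> p \<in> J \<Longrightarrow> p * r \<in> J"
  using assms by (auto simp: poly_ideal_def mult.commute)

lemma poly_ideal_diff: "poly_ideal I J \<Longrightarrow> p \<in> J \<Longrightarrow> q \<in> J \<Longrightarrow> p - q \<in> J"
  using poly_idealD(4)[of I J "- 1" q] poly_idealD(3)[of I J p "- q"] polys_uminus[of 1 I] by simp

lemma poly_ideal_sum: "poly_ideal I J \<Longrightarrow> (\<And>a. a \<in> A \<Longrightarrow> f a \<in> J) \<Longrightarrow> sum f A \<in> J"
  by (induction A rule: infinite_finite_induct) (auto intro: poly_idealD)

section \<open>Countability, polynomials in one variable, linear dependence\<close>

lemma countable_poly_mappings: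
  assumes "countable A" "countable B"
  shows "countable {p :: 'a \<Rightarrow>\<^sub>0 'b::comm_monoid_add. ks p \<subseteq> A \<and> (\<forall>a\<in>ks p. lk p a \<in> B)}"
proof -
  define F where "F xs = (\<Sum>(a, b)\<leftarrow>xs. sg a b)" for xs :: "('a \<times> 'b) list"
  have "countable (F ` lists (A \<times> B))" using assms by simp
  moreover have "{p :: 'a \<Rightarrow>\<^sub>0 'b. ks p \<subseteq> A \<and> (\<forall>a\<in>ks p. lk p a \<in> B)} \<subseteq> F ` lists (A \<times> B)"
  proof
    fix p :: "'a \<Rightarrow>\<^sub>0 'b" assume p: "p \<in> {p. ks p \<subseteq> A \<and> (\<forall>a\<in>ks p. lk p a \<in> B)}"
    obtain as where as: "set as = ks p" "distinct as" using finite_distinct_list[of "ks p"] by auto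
    have "p = (\<Sum>a\<in>ks p. sg a (lk p a))"
      by (rule poly_mapping_eqI) (auto simp: lookup_sum lookup_single when_def in_keys_iff)
    also have "\<dots> = F (map (\<lambda>a. (a, lk p a)) as)"
      unfolding F_def using as by (simp add: sum_list_distinct_conv_sum_set o_def flip: as(1))
    finally show "p \<in> F ` lists (A \<times> B)" using as p by (intro image_eqI) auto
  qed
  ultimately show ?thesis by (rule countable_subset[rotated])
qed

definition upoly :: "'v \<Rightarrow> complex poly \<Rightarrow> 'v mpoly" where
  "upoly i P = (\<Sum>k\<le>degree P. cst (coeff P k) * var i ^ k)"

lemma upoly_bound: "degree P \<le> N \<Longrightarrow> upoly i P = (\<Sum>k\<le>N. cst (coeff P k) * var i ^ k)"
  unfolding upoly_def by (intro sum.mono_neutral_left) (auto simp: coeff_eq_0)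

lemma upoly_0 [simp]: "upoly i 0 = 0" and upoly_const: "upoly i [:c:] = cst c"
  by (simp_all add: upoly_def)

lemma upoly_1 [simp]: "upoly i 1 = 1"
  using upoly_const[of i 1] by (simp add: one_pCons)

lemma upoly_pCons: "upoly i (pCons a P) = cst a + var i * upoly i P"
proof -
  have "upoly i (pCons a P) = (\<Sum>k\<le>Suc (degree P). cst (coeff (pCons a P) k) * var i ^ k)"
    by (rule upoly_bound) (rule degree_pCons_le)
  also have "\<dots> = cst a + (\<Sum>k\<le>degree P. cst (coeff P k) * var i ^ Suc k)"
    by (simp add: sum.atMost_Suc_shift del: sum.atMost_Suc)
  finally show ?thesis by (simp add: upoly_def sum_distrib_left mult_ac)
qed

lemma upoly_add: "upoly i (P + Q) = upoly i P + upoly i Q"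
proof -
  let ?N = "max (degree P) (degree Q)"
  have "upoly i (P + Q) = (\<Sum>k\<le>?N. cst (coeff (P + Q) k) * var i ^ k)"
    by (intro upoly_bound degree_add_le) auto
  thus ?thesis
    by (simp add: upoly_bound[of P ?N] upoly_bound[of Q ?N] cst_add distrib_right sum.distrib)
qed

lemma upoly_smult: "upoly i (smult c P) = cst c * upoly i P"
  by (simp add: upoly_bound[of "smult c P" "degree P"] upoly_def sum_distrib_left cst_mult mult_ac)

lemma upoly_mult: "upoly i (P * Q) = upoly i P * upoly i Q"
  by (induction P) (simp_all add: upoly_add upoly_smult upoly_pCons distrib_right distrib_left mult_ac)

lemma upoly_sum: "upoly i (sum f A) = (\<Sum>a\<in>A. upoly i (f a))"
  by (induction A rule: infinite_finite_induct) (simp_all add: upoly_add)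

lemma upoly_prod: "upoly i (prod f A) = (\<Prod>a\<in>A. upoly i (f a))"
  by (induction A rule: infinite_finite_induct) (simp_all add: upoly_mult)

lemma upoly_linear: "upoly i [:- c, 1:] = var i - cst c"
  by (simp add: upoly_pCons cst_minus)

lemma polys_upoly: "i \<in> I \<Longrightarrow> upoly i P \<in> polys I"
  unfolding upoly_def by (intro polys_intros)

text \<open>The family lives in the finite-dimensional space spanned by \<open>K\<close>.
  Injectivity lets a dependence of the image set be read as one of the indexed family.\<close>

lemma linear_dependence:
  fixes b :: "'c \<Rightarrow> ('v \<Rightarrow>\<^sub>0 complex)"
  assumes "finite K" "\<And>c. c \<in> C \<Longrightarrow> ks (b c) \<subseteq> K" "inj_on b C" "infinite C"
  obtains S u where "finite S" "S \<subseteq> C" "\<exists>c\<in>S. u c \<noteq> 0" "(\<Sum>c\<in>S. cscale (u c) (b c)) = 0"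
proof -
  obtain C' where C': "C' \<subseteq> C" "finite C'" "card C' = Suc (card K)"
    using infinite_arbitrarily_large[OF assms(4)] by metis
  have inj: "inj_on b C'" using assms(3) C'(1) by (rule inj_on_subset)
  have span: "b ` C' \<subseteq> cvec.span ((\<lambda>k. sg k 1) ` K)"
  proof safe
    fix c assume c: "c \<in> C'"
    have "b c = (\<Sum>k\<in>K. cscale (lk (b c) k) (sg k 1))"
    proof (rule poly_mapping_eqI)
      fix k
      have "lk (b c) k = 0" if "k \<notin> K"
        using assms(2)[of c] c C'(1) that by (auto simp: in_keys_iff subset_iff)
      thus "lk (b c) k = lk (\<Sum>k\<in>K. cscale (lk (b c) k) (sg k 1)) k"
        using assms(1) by (auto simp: lookup_sum lookup_single when_def if_distrib cong: if_cong)
    qed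
    also have "\<dots> \<in> cvec.span ((\<lambda>k. sg k 1) ` K)"
      by (intro cvec.span_sum cvec.span_scale cvec.span_base) auto
    finally show "b c \<in> cvec.span ((\<lambda>k. sg k 1) ` K)" .
  qed
  have "cvec.dependent (b ` C')"
  proof (rule ccontr)
    assume "cvec.independent (b ` C')"
    from cvec.independent_span_bound[OF _ this span] assms(1)
    have "card (b ` C') \<le> card ((\<lambda>k. sg k (1::complex)) ` K)" by simp
    also have "\<dots> \<le> card K" using assms(1) by (rule card_image_le)
    finally show False using card_image[OF inj] C' by simp
  qed
  then obtain u where u: "\<exists>v\<in>b ` C'. u v \<noteq> 0" "(\<Sum>v\<in>b ` C'. cscale (u v) v) = 0"
    using cvec.dependent_finite[of "b ` C'"] C' by auto
  have "(\<Sum>c\<in>C'. cscale ((u \<circ> b) c) (b c)) = 0"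
    using u(2) by (simp add: sum.reindex[OF inj])
  thus ?thesis using u(1) that[of C' "u \<circ> b"] C' by auto
qed

text \<open>An ideal \<open>\<m>\<close> maximal among those containing \<open>J\<close> and
  avoiding \<open>M\<close> is prime. If it contained no \<open>var i - cst t\<close>, each of the
  uncountably many \<open>var i - cst c\<close> would divide an element of \<open>M\<close> modulo
  \<open>\<m>\<close>. By countability, infinitely many of the quotients share this element and
  their support, so they are linearly dependent, and clearing denominators puts a nonzero univariate
  polynomial into \<open>\<m>\<close>, which splits. Hence the variables are constants modulo
  \<open>\<m>\<close>, and these constants are the point.\<close>

theorem nullstellensatz_countable:
  fixes I :: "'v set"
  assumes "finite I" "poly_ideal I J" "countable M" "M \<subseteq> polys I" "1 \<in> M"
    "\<And>a b. a \<in> M \<Longrightarrow> b \<in> M \<Longrightarrow> a * b \<in> M" "J \<inter> M = {}"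
  shows "\<exists>x. (\<forall>p\<in>J. evc x p = 0) \<and> (\<forall>p\<in>M. evc x p \<noteq> 0)"
proof -
  define \<A> where "\<A> = {\<m>. poly_ideal I \<m> \<and> J \<subseteq> \<m> \<and> \<m> \<inter> M = {}}"
  have "\<exists>\<m>\<in>\<A>. \<forall>X\<in>\<A>. \<m> \<subseteq> X \<longrightarrow> X = \<m>"
  proof (rule subset_Zorn_nonempty)
    show "\<A> \<noteq> {}" using assms by (auto simp: \<A>_def)
    fix \<C> assume ne: "\<C> \<noteq> {}" and ch: "subset.chain \<A> \<C>"
    have sub: "\<And>X. X \<in> \<C> \<Longrightarrow> X \<in> \<A>" using ch by (auto simp: subset.chain_def)
    hence id: "\<And>X. X \<in> \<C> \<Longrightarrow> poly_ideal I X" by (auto simp: \<A>_def)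
    have "p + q \<in> \<Union>\<C>" if pq: "p \<in> \<Union>\<C>" "q \<in> \<Union>\<C>" for p q
    proof -
      obtain X Y where XY: "X \<in> \<C>" "Y \<in> \<C>" "p \<in> X" "q \<in> Y" using pq by blast
      hence "X \<subseteq> Y \<or> Y \<subseteq> X" using ch by (auto simp: subset.chain_def)
      thus ?thesis using XY id poly_idealD(3) by blast
    qed
    moreover have "r * p \<in> \<Union>\<C>" if "p \<in> \<Union>\<C>" "r \<in> polys I" for p r
      using that id poly_idealD(4) by blast
    moreover have "0 \<in> \<Union>\<C>" "\<Union>\<C> \<subseteq> polys I" using ne id poly_idealD(1,2) by blast+
    ultimately have "poly_ideal I (\<Union>\<C>)" unfolding poly_ideal_def by blast
    moreover have "J \<subseteq> \<Union>\<C>" "\<Union>\<C> \<inter> M = {}" using ne sub by (auto simp: \<A>_def)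
    ultimately show "\<Union>\<C> \<in> \<A>" by (simp add: \<A>_def)
  qed
  then obtain \<m> where m: "poly_ideal I \<m>" "J \<subseteq> \<m>" "\<m> \<inter> M = {}"
    and max: "\<And>X. poly_ideal I X \<Longrightarrow> J \<subseteq> X \<Longrightarrow> X \<inter> M = {} \<Longrightarrow> \<m> \<subseteq> X \<Longrightarrow> X = \<m>"
    unfolding \<A>_def mem_Collect_eq Ball_def Bex_def by metis
  \<comment> \<open>By maximality the ideal generated by \<open>\<m>\<close> and \<open>a\<close>
    meets \<open>M\<close>: every \<open>a\<close> outside \<open>\<m>\<close> is invertible up to a
    factor in \<open>M\<close>.\<close>
  have inv: "\<exists>b\<in>polys I. \<exists>\<mu>\<in>M. b * a - \<mu> \<in> \<m>" if a: "a \<in> polys I" "a \<notin> \<m>" for a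
  proof -
    let ?X = "{p + b * a | p b. p \<in> \<m> \<and> b \<in> polys I}"
    have X: "poly_ideal I ?X"
      unfolding poly_ideal_def
    proof (intro conjI ballI)
      show "?X \<subseteq> polys I" using a poly_idealD(1)[OF m(1)] by (auto intro: polys_intros)
      show "0 \<in> ?X" using poly_idealD(2)[OF m(1)] by (intro CollectI exI[of _ 0]) auto
    next
      fix p q assume "p \<in> ?X" "q \<in> ?X"
      then obtain p1 p2 q1 q2 where *: "p = p1 + p2 * a" "q = q1 + q2 * a" "p1 \<in> \<m>" "q1 \<in> \<m>"
        "p2 \<in> polys I" "q2 \<in> polys I" by blast
      have "p + q = (p1 + q1) + (p2 + q2) * a" by (simp add: * algebra_simps)
      thus "p + q \<in> ?X" using * poly_idealD(3)[OF m(1)] by (blast intro: polys_add)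
    next
      fix r p assume "r \<in> polys I" "p \<in> ?X"
      then obtain p1 p2 where *: "p = p1 + p2 * a" "p1 \<in> \<m>" "p2 \<in> polys I" by blast
      have "r * p = r * p1 + (r * p2) * a" by (simp add: * algebra_simps)
      thus "r * p \<in> ?X" using * \<open>r \<in> polys I\<close> poly_idealD(4)[OF m(1)] by (blast intro: polys_mult)
    qed
    have "\<m> \<subseteq> ?X"
    proof
      fix p assume "p \<in> \<m>" thus "p \<in> ?X" by (intro CollectI exI[of _ p] exI[of _ 0]) simp
    qed
    moreover have "a \<in> ?X" using poly_idealD(2)[OF m(1)]
      by (intro CollectI exI[of _ 0] exI[of _ 1]) simp
    ultimately have "?X \<inter> M \<noteq> {}" using max[OF X] a m(2) by blast
    then obtain p b where pb: "p \<in> \<m>" "b \<in> polys I" "p + b * a \<in> M" by blast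
    have "b * a - (p + b * a) = 0 - p" by simp
    hence "b * a - (p + b * a) \<in> \<m>"
      using poly_ideal_diff[OF m(1) poly_idealD(2)[OF m(1)] pb(1)] by simp
    thus ?thesis using pb by blast
  qed
  have prime: "a \<in> \<m> \<or> b \<in> \<m>" if ab: "a * b \<in> \<m>" "a \<in> polys I" "b \<in> polys I" for a b
  proof (rule ccontr)
    assume "\<not> ?thesis"
    then obtain r \<mu> s \<nu> where *: "r \<in> polys I" "\<mu> \<in> M" "r * a - \<mu> \<in> \<m>" "s \<in> polys I" "\<nu> \<in> M" "s * b - \<nu> \<in> \<m>"
      using inv ab by meson
    have "\<mu> * \<nu> = (r * s) * (a * b) - (r * a) * (s * b - \<nu>) - (r * a - \<mu>) * \<nu>"
      by (simp add: algebra_simps)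
    also have "\<dots> \<in> \<m>"
    proof (intro poly_ideal_diff[OF m(1)])
      show "r * s * (a * b) \<in> \<m>" using * ab by (auto intro!: poly_idealD(4)[OF m(1), of "r * s"] poly_idealD(4)[OF m(1), of "r * a"] polys_intros)
      show "r * a * (s * b - \<nu>) \<in> \<m>" using * ab by (auto intro!: poly_idealD(4)[OF m(1), of "r * s"] poly_idealD(4)[OF m(1), of "r * a"] polys_intros)
      show "(r * a - \<mu>) * \<nu> \<in> \<m>" using * ab assms(4) by (intro poly_idealD(5)[OF m(1)]) auto
    qed
    finally show False using assms(6) * m(3) by blast
  qed
  have cst_in: "c = 0" if "cst c \<in> \<m>" for c
  proof (rule ccontr)
    assume "c \<noteq> 0"
    hence "1 = cst (1 / c) * cst c" by (simp flip: cst_mult)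
    also have "\<dots> \<in> \<m>" using that by (intro poly_idealD(4)[OF m(1)]) auto
    finally show False using assms(5) m(3) by blast
  qed
  have roots: "\<exists>t. var i - cst t \<in> \<m>" if "P \<noteq> 0" "upoly i P \<in> \<m>" "i \<in> I" for P i
    using that
  proof (induction "degree P" arbitrary: P)
    case 0
    then obtain c where "P = [:c:]" by (metis degree_eq_zeroE)
    thus ?case using 0 cst_in[of c] by (simp add: upoly_const)
  next
    case (Suc n)
    then obtain t where "poly P t = 0"
      using fundamental_theorem_of_algebra[of P] constant_degree[of P] by auto
    then obtain Q where Q: "P = [:- t, 1:] * Q" unfolding poly_eq_0_iff_dvd by (auto elim: dvdE)
    have "degree Q = n" using Suc(2,3) Q by (auto simp: degree_mult_eq simp del: mult_pCons_left)
    moreover have "(var i - cst t) * upoly i Q \<in> \<m>"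
      using Suc.prems(2) unfolding Q upoly_mult upoly_linear .
    hence "var i - cst t \<in> \<m> \<or> upoly i Q \<in> \<m>" using Suc.prems
      by (intro prime) (auto intro!: polys_intros polys_upoly)
    moreover have "Q \<noteq> 0" using Q Suc.prems(1) by auto
    ultimately show ?case using Suc.hyps(1)[of Q] Suc.prems(3) by blast
  qed
  have "\<exists>t. var i - cst t \<in> \<m>" if i: "i \<in> I" for i
  proof (rule ccontr)
    assume neg: "\<nexists>t. var i - cst t \<in> \<m>"
    have "\<exists>b\<in>polys I. \<exists>\<mu>\<in>M. b * (var i - cst c) - \<mu> \<in> \<m>" for c
      using neg i by (intro inv) (auto intro!: polys_intros)
    then obtain b \<mu> where b: "\<And>c. b c \<in> polys I" "\<And>c. \<mu> c \<in> M" "\<And>c. b c * (var i - cst c) - \<mu> c \<in> \<m>"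
      by metis
    \<comment> \<open>Besides \<open>\<mu> c\<close> only the support of \<open>b c\<close> is
      recorded: this takes countably many values, while polynomials with one common support lie in a
      finite-dimensional space.\<close>
    define \<kappa> where "\<kappa> c = (\<mu> c, ks (b c))" for c
    have "countable {\<alpha> :: 'v \<Rightarrow>\<^sub>0 nat. ks \<alpha> \<subseteq> I \<and> (\<forall>a\<in>ks \<alpha>. lk \<alpha> a \<in> UNIV)}"
      using assms(1) by (intro countable_poly_mappings) (auto intro: countable_finite)
    hence "countable {\<alpha> :: 'v \<Rightarrow>\<^sub>0 nat. ks \<alpha> \<subseteq> I}" by simp
    hence "countable (M \<times> {K. finite K \<and> K \<subseteq> {\<alpha> :: 'v \<Rightarrow>\<^sub>0 nat. ks \<alpha> \<subseteq> I}})"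
      using assms(3) by (intro countable_SIGMA countable_Collect_finite_subset) auto
    moreover have "range \<kappa> \<subseteq> M \<times> {K. finite K \<and> K \<subseteq> {\<alpha>. ks \<alpha> \<subseteq> I}}"
      using b(1,2) by (auto simp: \<kappa>_def polys_def)
    ultimately have cr: "countable (range \<kappa>)" by (rule countable_subset[rotated])
    have "\<exists>k. infinite (\<kappa> -` {k})"
    proof (rule ccontr)
      assume "\<not> ?thesis"
      hence "countable (\<Union>k\<in>range \<kappa>. \<kappa> -` {k})"
        using cr by (intro countable_UN) (auto intro: countable_finite)
      moreover have "(\<Union>k\<in>range \<kappa>. \<kappa> -` {k}) = UNIV" by auto
      moreover have "uncountable (UNIV :: complex set)"
      proof
        assume "countable (UNIV :: complex set)"
        hence "countable (range complex_of_real)" by (rule countable_subset[rotated]) simp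
        hence "countable (UNIV :: real set)" by (rule countable_image_inj_on) (simp add: inj_on_def)
        thus False using uncountable_UNIV_real by blast
      qed
      ultimately show False by simp
    qed
    then obtain \<mu>0 K where inf: "infinite (\<kappa> -` {(\<mu>0, K)})" by force
    define C where "C = \<kappa> -` {(\<mu>0, K)}"
    have C: "\<mu> c = \<mu>0" "ks (b c) = K" if "c \<in> C" for c using that by (auto simp: C_def \<kappa>_def)
    have infC: "infinite C" using inf by (simp add: C_def)
    then obtain c0 where "c0 \<in> C" using infinite_imp_nonempty by blast
    have finK: "finite K" and \<mu>0: "\<mu>0 \<in> M" using C[OF \<open>c0 \<in> C\<close>] b(2) by auto
    have "inj_on b C"
    proof (rule inj_onI, rule ccontr)
      fix c c' assume *: "c \<in> C" "c' \<in> C" "b c = b c'" "c \<noteq> c'"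
      have "(b c * (var i - cst c) - \<mu>0) - (b c * (var i - cst c') - \<mu>0) \<in> \<m>"
        using poly_ideal_diff[OF m(1) b(3)[of c] b(3)[of c']] * C by simp
      hence "b c * cst (c' - c) \<in> \<m>" by (simp add: algebra_simps cst_diff)
      hence "b c \<in> \<m>" using prime[of "b c" "cst (c' - c)"] b(1) cst_in[of "c' - c"] * by auto
      hence "b c * (var i - cst c) \<in> \<m>"
        using i by (auto intro!: poly_idealD(5)[OF m(1)] polys_intros)
      from poly_ideal_diff[OF m(1) this b(3)[of c]] have "\<mu>0 \<in> \<m>"
        using C(1)[OF *(1)] by simp
      thus False using \<mu>0 m(3) by auto
    qed
    then obtain S u where S: "finite S" "S \<subseteq> C" "\<exists>c\<in>S. u c \<noteq> 0" "(\<Sum>c\<in>S. cscale (u c) (b c)) = 0"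
      using linear_dependence[OF finK _ _ infC, of b] C by blast
    \<comment> \<open>Modulo \<open>\<m>\<close>, \<open>b c\<close> stands for
      \<open>\<mu>0 / (var i - cst c)\<close>; multiplying the dependence by all
      \<open>var i - cst c\<close> gives this polynomial. At \<open>c1\<close> a single summand
      survives, so it is nonzero.\<close>
    define P where "P = (\<Sum>c\<in>S. smult (u c) (\<Prod>c'\<in>S - {c}. [:- c', 1:]))"
    obtain c1 where c1: "c1 \<in> S" "u c1 \<noteq> 0" using S by blast
    have "poly P c1 = (\<Sum>c\<in>S. if c = c1 then u c * (\<Prod>c'\<in>S - {c}. c1 - c') else 0)"
      unfolding P_def poly_sum poly_smult poly_prod
    proof (intro sum.cong refl)
      fix c assume "c \<in> S"
      show "u c * (\<Prod>x\<in>S - {c}. poly [:- x, 1:] c1) = (if c = c1 then u c * (\<Prod>c'\<in>S - {c}. c1 - c') else 0)"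
      proof (cases "c = c1")
        case False
        hence "c1 \<in> S - {c}" using c1 by simp
        hence "(\<Prod>x\<in>S - {c}. poly [:- x, 1:] c1) = 0" using S(1) by (intro prod_zero) auto
        thus ?thesis using False by simp
      qed simp
    qed
    also have "\<dots> = u c1 * (\<Prod>c'\<in>S - {c1}. c1 - c')" using c1 S(1) by simp
    also have "\<dots> \<noteq> 0" using c1 S(1) by auto
    finally have "P \<noteq> 0" by auto
    have upP: "upoly i P = (\<Sum>c\<in>S. cst (u c) * (\<Prod>c'\<in>S - {c}. var i - cst c'))"
      unfolding P_def by (simp add: upoly_sum upoly_smult upoly_prod upoly_linear)
    have "(\<Prod>c\<in>S. var i - cst c) * (\<Sum>c\<in>S. cst (u c) * b c) =
        (\<Sum>c\<in>S. cst (u c) * (b c * (var i - cst c)) * (\<Prod>c'\<in>S - {c}. var i - cst c'))"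
      using S(1) by (auto simp: sum_distrib_left prod.remove mult_ac intro!: sum.cong)
    hence z: "(\<Sum>c\<in>S. cst (u c) * (b c * (var i - cst c)) * (\<Prod>c'\<in>S - {c}. var i - cst c')) = 0"
      using S(4) by (simp add: cscale_cst)
    have "\<mu>0 * upoly i P = (\<Sum>c\<in>S. cst (u c) * (b c * (var i - cst c)) * (\<Prod>c'\<in>S - {c}. var i - cst c'))
       - (\<Sum>c\<in>S. (cst (u c) * (\<Prod>c'\<in>S - {c}. var i - cst c')) * (b c * (var i - cst c) - \<mu>0))"
      unfolding upP by (simp add: sum_distrib_left algebra_simps flip: sum_subtractf)
    also have "\<dots> = 0 - (\<Sum>c\<in>S. (cst (u c) * (\<Prod>c'\<in>S - {c}. var i - cst c')) * (b c * (var i - cst c) - \<mu>0))"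
      unfolding z ..
    also have "\<dots> \<in> \<m>"
    proof (rule poly_ideal_diff[OF m(1) poly_idealD(2)[OF m(1)]], rule poly_ideal_sum[OF m(1)], rule poly_idealD(4)[OF m(1)])
      fix c assume "c \<in> S"
      thus "b c * (var i - cst c) - \<mu>0 \<in> \<m>" using b(3)[of c] C(1)[of c] S(2) by auto
    qed (use i in \<open>auto intro!: polys_intros\<close>)
    finally have "\<mu>0 * upoly i P \<in> \<m>" .
    hence "upoly i P \<in> \<m>" using prime[of \<mu>0 "upoly i P"] \<mu>0 m(3) assms(4) polys_upoly[OF i] by auto
    thus False using roots[OF \<open>P \<noteq> 0\<close> _ i] neg by blast
  qed
  then obtain x where x: "\<And>i. i \<in> I \<Longrightarrow> var i - cst (x i) \<in> \<m>" by metis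
  have ev_in: "p - cst (evc x p) \<in> \<m>" if "p \<in> polys I" for p
    using that
  proof (induction p rule: polys_induct)
    case (cst c) thus ?case using poly_idealD(2)[OF m(1)] by (simp add: ev_simps)
  next
    case (var i) thus ?case using x by (simp add: ev_simps)
  next
    case (add p q)
    thus ?case using poly_idealD(3)[OF m(1) add(3,4)] by (simp add: ev_simps cst_add algebra_simps)
  next
    case (mult p q)
    have "p * (q - cst (evc x q)) + (p - cst (evc x p)) * cst (evc x q) \<in> \<m>"
      using mult by (intro poly_idealD(3)[OF m(1) poly_idealD(4)[OF m(1)] poly_idealD(5)[OF m(1)]]) auto
    thus ?case by (simp add: ev_simps cst_mult algebra_simps)
  qed
  show ?thesis
  proof (intro exI[of _ x] conjI ballI)
    fix p assume "p \<in> J"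
    hence p: "p \<in> \<m>" using m(2) by blast
    have "p - (p - cst (evc x p)) \<in> \<m>"
      by (intro poly_ideal_diff[OF m(1)] p ev_in poly_idealD(1)[OF m(1)])
    thus "evc x p = 0" using cst_in by simp
  next
    fix p assume "p \<in> M"
    thus "evc x p \<noteq> 0" using ev_in[of p] assms(4) m(3) by (auto simp: subset_iff)
  qed
qed

text \<open>The countable set is that of the powers of \<open>h\<close>; this is the strong form of
  the Nullstellensatz.\<close>

corollary nullstellensatz_power:
  fixes I :: "'v set"
  assumes "finite I" "poly_ideal I J" "h \<in> polys I" "\<And>k. h ^ k \<notin> J"
  shows "\<exists>x. (\<forall>p\<in>J. evc x p = 0) \<and> evc x h \<noteq> 0"
proof -
  have "\<exists>x. (\<forall>p\<in>J. evc x p = 0) \<and> (\<forall>p\<in>range (\<lambda>k. h ^ k). evc x p \<noteq> 0)"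
  proof (rule nullstellensatz_countable[OF assms(1,2)])
    show "countable (range (\<lambda>k. h ^ k))" by simp
    show "range (\<lambda>k. h ^ k) \<subseteq> polys I" using assms(3) by (auto intro: polys_power)
    show "1 \<in> range (\<lambda>k. h ^ k)" by (rule image_eqI[of _ _ 0]) auto
    show "a * b \<in> range (\<lambda>k. h ^ k)" if "a \<in> range (\<lambda>k. h ^ k)" "b \<in> range (\<lambda>k. h ^ k)" for a b
      using that by (auto simp flip: power_add)
    show "J \<inter> range (\<lambda>k. h ^ k) = {}" using assms(4) by auto
  qed
  then obtain x where x: "\<forall>p\<in>J. evc x p = 0" "\<forall>p\<in>range (\<lambda>k. h ^ k). evc x p \<noteq> 0" by blast
  have "h \<in> range (\<lambda>k. h ^ k)" by (rule image_eqI[of _ _ 1]) auto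
  thus ?thesis using x by blast
qed

text \<open>The case of the zero ideal. The sort \<open>linorder\<close> orders the exponents, which
  makes the polynomials an integral domain, so no power of \<open>p\<close> is zero.\<close>

lemma poly_nonvanishing_point:
  fixes p :: "('v::linorder) mpoly"
  assumes "p \<noteq> 0"
  shows "\<exists>x. evc x p \<noteq> 0"
proof -
  define I where "I = (\<Union>\<alpha>\<in>ks p. ks \<alpha>)"
  have "\<exists>x. (\<forall>q\<in>{0}. evc x q = 0) \<and> evc x p \<noteq> 0"
    using assms by (intro nullstellensatz_power[of I]) (auto simp: I_def poly_ideal_def polys_def)
  thus ?thesis by blast
qed

lemma poly_eq_of_evc_eq:
  fixes p q :: "('v::linorder) mpoly"
  assumes "\<And>x. evc x p = evc x q"
  shows "p = q"
  using poly_nonvanishing_point[of "p - q"] assms by (auto simp: ev_simps)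

section \<open>Extending derivations to the complex numbers\<close>

definition subring :: "complex set \<Rightarrow> bool" where
  "subring K \<longleftrightarrow> 1 \<in> K \<and> (\<forall>a\<in>K. \<forall>b\<in>K. a - b \<in> K \<and> a * b \<in> K)"

definition derivation_on :: "complex set \<Rightarrow> (complex \<Rightarrow> complex) \<Rightarrow> bool" where
  "derivation_on K \<delta> \<longleftrightarrow> (\<forall>a\<in>K. \<forall>b\<in>K. \<delta> (a + b) = \<delta> a + \<delta> b \<and> \<delta> (a * b) = \<delta> a * b + a * \<delta> b)"

text \<open>A derivation on a subring is encoded by its graph, which is a subring of the dual numbers.\<close>

definition derivation_graph :: "(complex \<times> complex) set \<Rightarrow> bool" where
  "derivation_graph G \<longleftrightarrow> (1, 0) \<in> G \<and>
    (\<forall>a a' b b'. (a, a') \<in> G \<longrightarrow> (b, b') \<in> G \<longrightarrow> (a - b, a' - b') \<in> G \<and> (a * b, a' * b + a * b') \<in> G) \<and>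
    (\<forall>c. (0, c) \<in> G \<longrightarrow> c = 0)"

lemma derivation_graphD:
  assumes "derivation_graph G"
  shows "(1, 0) \<in> G" "(a, a') \<in> G \<Longrightarrow> (b, b') \<in> G \<Longrightarrow> (a - b, a' - b') \<in> G"
    "(a, a') \<in> G \<Longrightarrow> (b, b') \<in> G \<Longrightarrow> (a * b, a' * b + a * b') \<in> G"
    "(0, c) \<in> G \<Longrightarrow> c = 0" "(0, 0) \<in> G"
    "(a, a') \<in> G \<Longrightarrow> (b, b') \<in> G \<Longrightarrow> (a + b, a' + b') \<in> G"
    "(a, a') \<in> G \<Longrightarrow> (a, a'') \<in> G \<Longrightarrow> a' = a''"
proof -
  show 1: "(1, 0) \<in> G" and 2: "\<And>a a' b b'. (a, a') \<in> G \<Longrightarrow> (b, b') \<in> G \<Longrightarrow> (a - b, a' - b') \<in> G"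
    and "(a, a') \<in> G \<Longrightarrow> (b, b') \<in> G \<Longrightarrow> (a * b, a' * b + a * b') \<in> G"
    and 4: "\<And>c. (0, c) \<in> G \<Longrightarrow> c = 0"
    using assms unfolding derivation_graph_def by blast+
  show 5: "(0, 0) \<in> G" using 2[OF 1 1] by simp
  show "(a, a') \<in> G \<Longrightarrow> (b, b') \<in> G \<Longrightarrow> (a + b, a' + b') \<in> G"
    using 2[of a a' "- b" "- b'"] 2[OF 5, of b b'] by simp
  show "(a, a') \<in> G \<Longrightarrow> (a, a'') \<in> G \<Longrightarrow> a' = a''"
    using 2[of a a' a a''] 4[of "a' - a''"] by simp
qed

text \<open>Polynomials over the ring of dual numbers \<open>a + a' \<epsilon>\<close> with
  coefficients in \<open>G\<close>, split into their two components.\<close>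

definition pairs :: "(complex \<times> complex) set \<Rightarrow> (complex poly \<times> complex poly) set" where
  "pairs G = {(p, p'). \<forall>k. (coeff p k, coeff p' k) \<in> G}"

lemma pairs_sum:
  assumes "derivation_graph G" "\<And>k. k \<in> A \<Longrightarrow> (f k, f' k) \<in> G"
  shows "(\<Sum>k\<in>A. f k, \<Sum>k\<in>A. f' k) \<in> G"
  using assms(2)
  by (induction A rule: infinite_finite_induct) (auto intro: derivation_graphD[OF assms(1)])

lemma pairs_intros:
  assumes "derivation_graph G"
  shows "(p, p') \<in> pairs G \<Longrightarrow> (q, q') \<in> pairs G \<Longrightarrow> (p - q, p' - q') \<in> pairs G"
    "(p, p') \<in> pairs G \<Longrightarrow> (q, q') \<in> pairs G \<Longrightarrow> (p * q, p' * q + p * q') \<in> pairs G"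
    "(c, c') \<in> G \<Longrightarrow> (monom c k, monom c' k) \<in> pairs G"
    "(p, p') \<in> pairs G \<Longrightarrow> (pderiv p, pderiv p') \<in> pairs G"
proof -
  note D = derivation_graphD[OF assms]
  show "(p, p') \<in> pairs G \<Longrightarrow> (q, q') \<in> pairs G \<Longrightarrow> (p - q, p' - q') \<in> pairs G"
    using D(2) by (auto simp: pairs_def)
  show "(p, p') \<in> pairs G \<Longrightarrow> (q, q') \<in> pairs G \<Longrightarrow> (p * q, p' * q + p * q') \<in> pairs G"
    using D(3) by (auto simp: pairs_def coeff_mult simp flip: sum.distrib intro!: pairs_sum[OF assms])
  show "(c, c') \<in> G \<Longrightarrow> (monom c k, monom c' k) \<in> pairs G"
    using D(5) by (auto simp: pairs_def)
  have nat: "(of_nat k, 0) \<in> G" for k :: nat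
    by (induction k) (use D(1,5) D(6)[of 1 0] in auto)
  show "(p, p') \<in> pairs G \<Longrightarrow> (pderiv p, pderiv p') \<in> pairs G"
    using D(3)[OF nat] by (auto simp: pairs_def coeff_pderiv simp del: of_nat_Suc)
qed

text \<open>The \<epsilon>-part of \<open>p + p' \<epsilon>\<close> at the dual number
  \<open>x + y \<epsilon>\<close>.\<close>

definition dual_value :: "complex \<Rightarrow> complex \<Rightarrow> complex poly \<times> complex poly \<Rightarrow> complex" where
  "dual_value x y = (\<lambda>(p, p'). poly p' x + poly (pderiv p) x * y)"

text \<open>With this \<open>y\<close>, the dual number \<open>x + y \<epsilon>\<close> satisfies
  every relation that \<open>x\<close> satisfies over the domain of the derivation. If
  \<open>x\<close> satisfies no nontrivial relation, any \<open>y\<close> works. Otherwise take a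
  relation \<open>p0\<close> of least degree: its derivative does not vanish at \<open>x\<close>, by
  minimality in characteristic 0, so \<open>p0\<close> determines \<open>y\<close>, and all other
  relations reduce to \<open>p0\<close>.\<close>

lemma derivation_extend_point:
  assumes G: "derivation_graph G"
  obtains y where "\<And>p p'. (p, p') \<in> pairs G \<Longrightarrow> poly p x = 0 \<Longrightarrow> dual_value x y (p, p') = 0"
proof (cases "\<exists>p p'. (p, p') \<in> pairs G \<and> p \<noteq> 0 \<and> poly p x = 0")
  case False
  have "dual_value x 0 (p, p') = 0" if "(p, p') \<in> pairs G" "poly p x = 0" for p p'
  proof -
    have "p = 0" using False that by blast
    hence "p' = 0" using that derivation_graphD(4)[OF G] by (intro poly_eqI) (auto simp: pairs_def)
    thus ?thesis using \<open>p = 0\<close> by (simp add: dual_value_def)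
  qed
  thus ?thesis using that by blast
next
  case True
  define N where "N = (LEAST N. \<exists>p p'. (p, p') \<in> pairs G \<and> p \<noteq> 0 \<and> poly p x = 0 \<and> degree p = N)"
  have "\<exists>p p'. (p, p') \<in> pairs G \<and> p \<noteq> 0 \<and> poly p x = 0 \<and> degree p = N"
    unfolding N_def by (rule LeastI_ex) (use True in blast)
  then obtain p0 p0' where p0: "(p0, p0') \<in> pairs G" "p0 \<noteq> 0" "poly p0 x = 0" "degree p0 = N" by blast
  have min: "p = 0" if "(p, p') \<in> pairs G" "poly p x = 0" "degree p < N" for p p'
    using not_less_Least[OF that(3)[unfolded N_def]] that by blast
  have N: "N > 0" using p0 by (metis degree_eq_zeroE gr0I mult_zero_right poly_pCons add_0_right pCons_0_0 poly_0)
  have d0: "poly (pderiv p0) x \<noteq> 0"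
  proof
    assume "poly (pderiv p0) x = 0"
    hence "pderiv p0 = 0" using N p0
      by (intro min[OF pairs_intros(4)[OF G p0(1)]]) (auto simp: degree_pderiv)
    thus False using p0(4) N by (simp add: pderiv_eq_0_iff)
  qed
  define y where "y = - poly p0' x / poly (pderiv p0) x"
  have y0: "dual_value x y (p0, p0') = 0" using d0 by (simp add: y_def dual_value_def)
  have "dual_value x y (p, p') = 0" if "(p, p') \<in> pairs G" "poly p x = 0" for p p'
    using that
  proof (induction "degree p" arbitrary: p p' rule: less_induct)
    case less
    show ?case
    proof (cases "p = 0")
      case True
      hence "p' = 0" using less(2) derivation_graphD(4)[OF G] by (intro poly_eqI) (auto simp: pairs_def)
      thus ?thesis using \<open>p = 0\<close> by (simp add: dual_value_def)
    next
      case False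
      hence deg: "degree p \<ge> N" using min[OF less(2,3)] by force
      define c c' l l' where "c = lead_coeff p0" "c' = coeff p0' (degree p0)"
        "l = lead_coeff p" "l' = coeff p' (degree p)"
      note cl = this
      have cG: "(c, c') \<in> G" "(l, l') \<in> G" using p0(1) less(2) by (auto simp: cl pairs_def)
      define k where "k = degree p - N"
      \<comment> \<open>One step of pseudo-division by \<open>p0\<close>: the coefficients only form
        a ring, so \<open>p\<close> is multiplied by the leading coefficient of \<open>p0\<close>
        instead of dividing by it.\<close>
      define r r' where "r = monom c 0 * p - monom l k * p0"
        "r' = (monom c' 0 * p + monom c 0 * p') - (monom l' k * p0 + monom l k * p0')"
      note r = this
      have rG: "(r, r') \<in> pairs G" unfolding r
        by (intro pairs_intros[OF G] cG less(2) p0(1))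
      have rx: "poly r x = 0" using less(3) p0(3) by (simp add: r)
      have c0: "c \<noteq> 0" "l \<noteq> 0" using p0(2) False by (auto simp: cl)
      have "dual_value x y (r, r') = 0"
      proof (cases "r = 0")
        case True
        hence "r' = 0" using rG derivation_graphD(4)[OF G] by (intro poly_eqI) (auto simp: pairs_def)
        thus ?thesis using True by (simp add: dual_value_def)
      next
        case False
        have "degree r \<le> degree p" using c0 deg p0(4) False
          unfolding r by (intro degree_diff_le) (auto intro!: order.trans[OF degree_mult_le] simp: degree_monom_eq k_def)
        moreover have "coeff r (degree p) = 0"
          using deg p0(4) by (simp add: r cl k_def coeff_monom_mult)
        ultimately have "degree r < degree p" using False
          by (metis leading_coeff_0_iff le_neq_implies_less)
        thus ?thesis using less(1)[OF _ rG rx] by blast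
      qed
      moreover have "dual_value x y (r, r') = c * dual_value x y (p, p') - poly (monom l k) x * dual_value x y (p0, p0')"
        using less(3) p0(3)
        by (simp add: r dual_value_def pderiv_diff pderiv_mult pderiv_monom poly_monom algebra_simps)
      ultimately show ?thesis using c0 y0 by simp
    qed
  qed
  thus ?thesis using that by blast
qed

text \<open>Zorn's lemma for graphs: a maximal graph is defined at every \<open>x\<close>, since
  adjoining the dual number of \<open>derivation_extend_point\<close> would otherwise enlarge it. A
  subring may be the starting point because a fraction is a root of a linear polynomial.\<close>

theorem derivation_extends:
  assumes "subring K" "derivation_on K \<delta>0"
  obtains \<delta> where "derivation_on UNIV \<delta>" "\<And>a. a \<in> K \<Longrightarrow> \<delta> a = \<delta>0 a"
proof -
  define G0 where "G0 = (\<lambda>a. (a, \<delta>0 a)) ` K"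
  have K: "1 \<in> K" "\<And>a b. a \<in> K \<Longrightarrow> b \<in> K \<Longrightarrow> a - b \<in> K" "\<And>a b. a \<in> K \<Longrightarrow> b \<in> K \<Longrightarrow> a * b \<in> K"
    and d: "\<And>a b. a \<in> K \<Longrightarrow> b \<in> K \<Longrightarrow> \<delta>0 (a + b) = \<delta>0 a + \<delta>0 b"
      "\<And>a b. a \<in> K \<Longrightarrow> b \<in> K \<Longrightarrow> \<delta>0 (a * b) = \<delta>0 a * b + a * \<delta>0 b"
    using assms by (auto simp: subring_def derivation_on_def)
  have K0: "0 \<in> K" using K(2)[OF K(1) K(1)] by simp
  have d0: "\<delta>0 0 = 0" using d(1)[OF K0 K0] by simp
  have d1: "\<delta>0 1 = 0" using d(2)[OF K(1) K(1)] by simp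
  have dd: "\<delta>0 (a - b) = \<delta>0 a - \<delta>0 b" if "a \<in> K" "b \<in> K" for a b
    using d(1)[OF K(2)[OF that] that(2)] by simp
  have G0: "derivation_graph G0"
    unfolding derivation_graph_def G0_def using K d0 d1 dd d(2) by auto
  define \<A> where "\<A> = {G. derivation_graph G \<and> G0 \<subseteq> G}"
  have "\<exists>G\<in>\<A>. \<forall>X\<in>\<A>. G \<subseteq> X \<longrightarrow> X = G"
  proof (rule subset_Zorn_nonempty)
    show "\<A> \<noteq> {}" using G0 by (auto simp: \<A>_def)
    fix \<C> assume ne: "\<C> \<noteq> {}" and ch: "subset.chain \<A> \<C>"
    have sub: "\<And>X. X \<in> \<C> \<Longrightarrow> derivation_graph X \<and> G0 \<subseteq> X" using ch by (auto simp: subset.chain_def \<A>_def)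
    have ex: "\<exists>Z\<in>\<C>. u \<in> Z \<and> v \<in> Z" if "u \<in> \<Union>\<C>" "v \<in> \<Union>\<C>" for u v
    proof -
      obtain X Y where XY: "X \<in> \<C>" "Y \<in> \<C>" "u \<in> X" "v \<in> Y" using \<open>u \<in> \<Union>\<C>\<close> \<open>v \<in> \<Union>\<C>\<close> by blast
      hence "X \<subseteq> Y \<or> Y \<subseteq> X" using ch by (auto simp: subset.chain_def)
      thus ?thesis using XY by blast
    qed
    have "derivation_graph (\<Union>\<C>)"
      unfolding derivation_graph_def
    proof (intro conjI allI impI)
      show "(1, 0) \<in> \<Union>\<C>" using ne sub derivation_graphD(1) by blast
    next
      fix a a' b b' assume "(a, a') \<in> \<Union>\<C>" "(b, b') \<in> \<Union>\<C>"
      then obtain Z where "Z \<in> \<C>" "(a, a') \<in> Z" "(b, b') \<in> Z" using ex by blast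
      thus "(a - b, a' - b') \<in> \<Union>\<C>" "(a * b, a' * b + a * b') \<in> \<Union>\<C>"
        using sub derivation_graphD(2,3)[of Z a a' b b'] by blast+
    next
      fix c assume "(0, c) \<in> \<Union>\<C>" thus "c = 0" using sub derivation_graphD(4) by blast
    qed
    moreover have "G0 \<subseteq> \<Union>\<C>" using ne sub by blast
    ultimately show "\<Union>\<C> \<in> \<A>" by (simp add: \<A>_def)
  qed
  then obtain G where G: "derivation_graph G" "G0 \<subseteq> G"
    and max: "\<And>X. derivation_graph X \<Longrightarrow> G \<subseteq> X \<Longrightarrow> X = G"
    unfolding \<A>_def by (metis (no_types, lifting) mem_Collect_eq order.trans)
  have "\<exists>y. (x, y) \<in> G" for x
  proof -
    obtain y where y: "\<And>p p'. (p, p') \<in> pairs G \<Longrightarrow> poly p x = 0 \<Longrightarrow> dual_value x y (p, p') = 0"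
      using derivation_extend_point[OF G(1)] by metis
    define X where "X = (\<lambda>(p, p'). (poly p x, dual_value x y (p, p'))) ` pairs G"
    have X_I: "(poly p x, dual_value x y (p, p')) \<in> X" if "(p, p') \<in> pairs G" for p p'
      unfolding X_def using that by (intro image_eqI[of _ _ "(p, p')"]) auto
    have GX: "G \<subseteq> X"
    proof
      fix u assume "u \<in> G"
      then obtain a a' where u: "u = (a, a')" "(a, a') \<in> G" by (cases u) auto
      from X_I[OF pairs_intros(3)[OF G(1) u(2), of 0]] show "u \<in> X"
        by (simp add: u dual_value_def pderiv_monom poly_monom)
    qed
    have "derivation_graph X"
      unfolding derivation_graph_def
    proof (intro conjI allI impI)
      show "(1, 0) \<in> X" using GX derivation_graphD(1)[OF G(1)] by blast
    next
      fix a a' b b' assume "(a, a') \<in> X" "(b, b') \<in> X"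
      then obtain p p' q q' where pq: "(p, p') \<in> pairs G" "(q, q') \<in> pairs G"
        "a = poly p x" "a' = dual_value x y (p, p')" "b = poly q x" "b' = dual_value x y (q, q')"
        unfolding X_def by auto
      from X_I[OF pairs_intros(1)[OF G(1) pq(1,2)]] show "(a - b, a' - b') \<in> X"
        by (simp add: pq dual_value_def pderiv_diff algebra_simps)
      from X_I[OF pairs_intros(2)[OF G(1) pq(1,2)]] show "(a * b, a' * b + a * b') \<in> X"
        by (simp add: pq dual_value_def pderiv_mult algebra_simps)
    next
      fix c assume "(0, c) \<in> X"
      thus "c = 0" using y unfolding X_def by auto
    qed
    from max[OF this GX] have "X = G" .
    have "(monom 1 1, monom 0 0) \<in> pairs G"
      using derivation_graphD(1,5)[OF G(1)] by (auto simp: pairs_def)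
    from X_I[OF this] have "(x, y) \<in> X"
      by (simp add: dual_value_def pderiv_monom poly_monom)
    thus ?thesis using \<open>X = G\<close> by blast
  qed
  then obtain \<delta> where \<delta>: "\<And>x. (x, \<delta> x) \<in> G" by metis
  show ?thesis
  proof
    show "derivation_on UNIV \<delta>"
      unfolding derivation_on_def
    proof (intro ballI conjI)
      fix a b
      show "\<delta> (a + b) = \<delta> a + \<delta> b"
        using derivation_graphD(7)[OF G(1) \<delta> derivation_graphD(6)[OF G(1) \<delta> \<delta>]] .
      show "\<delta> (a * b) = \<delta> a * b + a * \<delta> b"
        using derivation_graphD(7)[OF G(1) \<delta> derivation_graphD(3)[OF G(1) \<delta> \<delta>]] .
    qed
    show "\<delta> a = \<delta>0 a" if "a \<in> K" for a
    proof -
      have "(a, \<delta>0 a) \<in> G" using G(2) that by (auto simp: G0_def)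
      thus ?thesis by (rule derivation_graphD(7)[OF G(1) \<delta>])
    qed
  qed
qed

lemma lookup_mult_cst [simp]: "lk (p * cst c) \<alpha> = c * lk p \<alpha>"
  using lookup_cst_mult[of c p \<alpha>] by (simp add: mult.commute)

lemma single_index_eq_iff [simp]: "sg x (Suc 0) = sg y (Suc 0) \<longleftrightarrow> x = y"
  by (metis keys_single singleton_inject nat.distinct(1))

section \<open>Polynomial functions\<close>

text \<open>Polynomial dependence is stated for functions on points, so that norms and eliminations
  can be constructed by manipulating values.\<close>

definition polyfun :: "'v set \<Rightarrow> (('v \<Rightarrow> complex) \<Rightarrow> complex) \<Rightarrow> bool" where
  "polyfun I F \<longleftrightarrow> (\<exists>p\<in>polys I. \<forall>x. F x = evc x p)"

lemma polyfun_const: "polyfun I (\<lambda>_. c)"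
  unfolding polyfun_def by (rule bexI[of _ "cst c"]) (auto simp: ev_simps)

lemma polyfun_var: "i \<in> I \<Longrightarrow> polyfun I (\<lambda>x. x i)"
  unfolding polyfun_def by (rule bexI[of _ "var i"]) (auto simp: ev_simps polys_var)

lemma polyfun_add:
  assumes "polyfun I F" "polyfun I G" shows "polyfun I (\<lambda>x. F x + G x)"
proof -
  obtain p q where "p \<in> polys I" "\<forall>x. F x = evc x p" "q \<in> polys I" "\<forall>x. G x = evc x q"
    using assms unfolding polyfun_def by blast
  thus ?thesis unfolding polyfun_def by (intro bexI[of _ "p + q"]) (auto simp: ev_simps polys_add)
qed

lemma polyfun_mult:
  assumes "polyfun I F" "polyfun I G" shows "polyfun I (\<lambda>x. F x * G x)"
proof -
  obtain p q where "p \<in> polys I" "\<forall>x. F x = evc x p" "q \<in> polys I" "\<forall>x. G x = evc x q"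
    using assms unfolding polyfun_def by blast
  thus ?thesis unfolding polyfun_def by (intro bexI[of _ "p * q"]) (auto simp: ev_simps polys_mult)
qed

lemma polyfun_uminus: "polyfun I F \<Longrightarrow> polyfun I (\<lambda>x. - F x)"
  using polyfun_mult[OF polyfun_const[of I "-1"], of F] by simp

lemma polyfun_diff: "polyfun I F \<Longrightarrow> polyfun I G \<Longrightarrow> polyfun I (\<lambda>x. F x - G x)"
  using polyfun_add[of I F "\<lambda>x. - G x"] polyfun_uminus[of I G] by simp

lemma polyfun_divide_const: "polyfun I F \<Longrightarrow> polyfun I (\<lambda>x. F x / c)"
  using polyfun_mult[OF polyfun_const[of I "1 / c"], of F] by simp

lemma polyfun_sum: "(\<And>a. a \<in> A \<Longrightarrow> polyfun I (F a)) \<Longrightarrow> polyfun I (\<lambda>x. \<Sum>a\<in>A. F a x)"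
  by (induction A rule: infinite_finite_induct) (auto intro: polyfun_add polyfun_const)

lemma polyfun_prod: "(\<And>a. a \<in> A \<Longrightarrow> polyfun I (F a)) \<Longrightarrow> polyfun I (\<lambda>x. \<Prod>a\<in>A. F a x)"
  by (induction A rule: infinite_finite_induct) (auto intro: polyfun_mult polyfun_const)

lemma polyfun_power: "polyfun I F \<Longrightarrow> polyfun I (\<lambda>x. F x ^ k)"
  by (induction k) (auto intro: polyfun_mult polyfun_const)

lemmas polyfun_intros = polyfun_const polyfun_var polyfun_add polyfun_mult polyfun_uminus
  polyfun_diff polyfun_divide_const polyfun_sum polyfun_prod polyfun_power

lemma polyfun_compose:
  assumes "polyfun K F" "\<And>k. k \<in> K \<Longrightarrow> polyfun I (\<lambda>x. \<phi> x k)"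
  shows "polyfun I (\<lambda>x. F (\<phi> x))"
proof -
  obtain p where p: "p \<in> polys K" "\<forall>x. F x = evc x p" using assms unfolding polyfun_def by blast
  have "polyfun I (\<lambda>x. evc (\<phi> x) p)"
    using p(1) by (induction p rule: polys_induct) (auto simp: ev_simps intro: polyfun_intros assms(2))
  thus ?thesis using p(2) by simp
qed

text \<open>A polynomial whose coefficients depend polynomially on parameters. The uniform bound on
  the supports keeps sums over its coefficients polynomial in the parameters.\<close>

definition polyfam :: "'v set \<Rightarrow> (('v \<Rightarrow> complex) \<Rightarrow> 'w mpoly) \<Rightarrow> bool" where
  "polyfam I G \<longleftrightarrow> (\<exists>A. finite A \<and> (\<forall>x. ks (G x) \<subseteq> A)) \<and> (\<forall>\<gamma>. polyfun I (\<lambda>x. lk (G x) \<gamma>))"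

lemma polyfam_const: "polyfam I (\<lambda>_. p)"
  unfolding polyfam_def
proof (intro conjI allI)
  show "\<exists>A. finite A \<and> (\<forall>x. ks p \<subseteq> A)" by (rule exI[of _ "ks p"]) simp
qed (rule polyfun_const)

lemma polyfam_scale: assumes "polyfun I F" shows "polyfam I (\<lambda>x. cst (F x) * p)"
  unfolding polyfam_def
proof (intro conjI allI)
  show "\<exists>A. finite A \<and> (\<forall>x. ks (cst (F x) * p) \<subseteq> A)"
    by (rule exI[of _ "ks p"]) (auto simp: in_keys_iff)
  show "polyfun I (\<lambda>x. lk (cst (F x) * p) \<gamma>)" for \<gamma>
    using assms by (auto intro: polyfun_intros)
qed

lemma polyfam_add:
  assumes "polyfam I G" "polyfam I H" shows "polyfam I (\<lambda>x. G x + H x)"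
proof -
  obtain A B where "finite A" "\<forall>x. ks (G x) \<subseteq> A" "finite B" "\<forall>x. ks (H x) \<subseteq> B"
    using assms unfolding polyfam_def by blast
  hence "finite (A \<union> B)" "\<forall>x. ks (G x + H x) \<subseteq> A \<union> B"
    by (auto dest!: subsetD[OF Poly_Mapping.keys_add])
  thus ?thesis using assms unfolding polyfam_def by (auto simp: lookup_add intro: polyfun_add)
qed

lemma polyfam_sum: "(\<And>a. a \<in> A \<Longrightarrow> polyfam I (G a)) \<Longrightarrow> polyfam I (\<lambda>x. \<Sum>a\<in>A. G a x)"
  by (induction A rule: infinite_finite_induct) (auto intro: polyfam_add polyfam_const)

lemma sum_singles_superset:
  fixes p :: "'a \<Rightarrow>\<^sub>0 'b::comm_monoid_add"
  assumes "finite A" "ks p \<subseteq> A" shows "p = (\<Sum>\<alpha>\<in>A. sg \<alpha> (lk p \<alpha>))"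
  using assms by (intro poly_mapping_eqI) (auto simp: lookup_sum lookup_single when_def in_keys_iff)

lemma single_eq_cst_xpow: "sg \<alpha> c = cst c * xpow \<alpha>"
  by (simp add: cst_def xpow_def mult_single)

lemma sum_xpow_superset:
  assumes "finite A" "ks p \<subseteq> A" shows "p = (\<Sum>\<alpha>\<in>A. cst (lk p \<alpha>) * xpow \<alpha>)"
  using sum_singles_superset[OF assms] by (simp add: single_eq_cst_xpow)

lemma polyfam_mult:
  assumes "polyfam I G" "polyfam I H" shows "polyfam I (\<lambda>x. G x * H x)"
proof -
  obtain A B where A: "finite A" "\<And>x. ks (G x) \<subseteq> A" and B: "finite B" "\<And>x. ks (H x) \<subseteq> B"
    using assms unfolding polyfam_def by blast
  have "G x * H x = (\<Sum>\<alpha>\<in>A. \<Sum>\<beta>\<in>B. cst (lk (G x) \<alpha> * lk (H x) \<beta>) * (xpow \<alpha> * xpow \<beta>))" for x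
  proof -
    have "G x * H x = (\<Sum>\<alpha>\<in>A. cst (lk (G x) \<alpha>) * xpow \<alpha>) * (\<Sum>\<beta>\<in>B. cst (lk (H x) \<beta>) * xpow \<beta>)"
      using sum_xpow_superset[OF A(1,2)] sum_xpow_superset[OF B(1,2)] by simp
    thus ?thesis by (simp add: sum_product cst_mult mult_ac)
  qed
  moreover have "polyfam I (\<lambda>x. \<Sum>\<alpha>\<in>A. \<Sum>\<beta>\<in>B. cst (lk (G x) \<alpha> * lk (H x) \<beta>) * (xpow \<alpha> * xpow \<beta>))"
    using assms by (intro polyfam_sum polyfam_scale polyfun_mult) (auto simp: polyfam_def)
  ultimately show ?thesis by simp
qed

lemma polyfam_prod: "(\<And>a. a \<in> A \<Longrightarrow> polyfam I (G a)) \<Longrightarrow> polyfam I (\<lambda>x. \<Prod>a\<in>A. G a x)"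
  by (induction A rule: infinite_finite_induct) (auto intro: polyfam_mult polyfam_const)

section \<open>The apolar pairing\<close>

definition mfact :: "('v \<Rightarrow>\<^sub>0 nat) \<Rightarrow> complex" where
  "mfact \<gamma> = (\<Prod>i\<in>ks \<gamma>. fact (lk \<gamma> i))"

lemma mfact_superset: "finite A \<Longrightarrow> ks \<gamma> \<subseteq> A \<Longrightarrow> mfact \<gamma> = (\<Prod>i\<in>A. fact (lk \<gamma> i))"
  unfolding mfact_def by (intro prod.mono_neutral_left) (auto simp: in_keys_iff)

lemma mfact_nonzero [simp]: "mfact \<gamma> \<noteq> 0"
  by (simp add: mfact_def)

lemma mfact_add_single: "mfact (\<gamma> + sg i 1) = mfact \<gamma> * of_nat (lk \<gamma> i + 1)"
proof -
  let ?A = "insert i (ks \<gamma>)"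
  have "mfact (\<gamma> + sg i 1) = (\<Prod>j\<in>?A. fact (lk (\<gamma> + sg i 1) j))"
    by (intro mfact_superset) (auto simp: keys_add_nat split: if_splits)
  also have "\<dots> = fact (lk \<gamma> i + 1) * (\<Prod>j\<in>?A - {i}. fact (lk \<gamma> j))"
    by (subst prod.remove[of _ i]) (auto simp: lookup_add lookup_single when_def split: if_splits intro!: prod.cong)
  also have "\<dots> = of_nat (lk \<gamma> i + 1) * (\<Prod>j\<in>?A. fact (lk \<gamma> j))"
    by (subst (2) prod.remove[of _ i]) (auto simp: algebra_simps)
  finally show ?thesis by (simp add: mfact_superset[of ?A \<gamma>] mult.commute subset_insertI)
qed

text \<open>The constant term of \<open>G \<circ> f\<close>: the operator with exponent \<gamma>
  takes the monomial \<gamma> to \<gamma>! and yields no constant term from any other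
  monomial.\<close>

definition apol :: "'v mpoly \<Rightarrow> 'v mpoly \<Rightarrow> complex" where
  "apol f G = (\<Sum>\<gamma>\<in>ks G. lk G \<gamma> * (mfact \<gamma> * lk f \<gamma>))"

lemma apol_superset: "finite A \<Longrightarrow> ks G \<subseteq> A \<Longrightarrow> apol f G = (\<Sum>\<gamma>\<in>A. lk G \<gamma> * (mfact \<gamma> * lk f \<gamma>))"
  unfolding apol_def by (intro sum.mono_neutral_left) (auto simp: in_keys_iff)

lemma apol_add: "apol f (G + H) = apol f G + apol f H"
proof -
  let ?A = "ks G \<union> ks H"
  have "apol f (G + H) = (\<Sum>\<gamma>\<in>?A. lk (G + H) \<gamma> * (mfact \<gamma> * lk f \<gamma>))"
    by (intro apol_superset) (auto dest: subsetD[OF Poly_Mapping.keys_add])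
  thus ?thesis
    by (simp add: lookup_add distrib_right sum.distrib apol_superset[of ?A G] apol_superset[of ?A H])
qed

lemma apol_0 [simp]: "apol f 0 = 0"
  by (simp add: apol_def)

lemma apol_cst_mult: "apol f (cst c * G) = c * apol f G"
proof -
  have "apol f (cst c * G) = (\<Sum>\<gamma>\<in>ks G. lk (cst c * G) \<gamma> * (mfact \<gamma> * lk f \<gamma>))"
    by (intro apol_superset) (auto simp: in_keys_iff)
  thus ?thesis by (simp add: apol_def sum_distrib_left mult_ac)
qed

lemma apol_sum: "apol f (sum G A) = (\<Sum>a\<in>A. apol f (G a))"
  by (induction A rule: infinite_finite_induct) (simp_all add: apol_add)

lemma apol_scale_left: "apol (cst c * f) G = c * apol f G"
  by (simp add: apol_def sum_distrib_left mult_ac)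

lemma apol_xpow: "apol f (xpow \<gamma>) = mfact \<gamma> * lk f \<gamma>"
  by (simp add: apol_def xpow_def)

lemma apol_mult_expand:
  assumes "finite A" "ks h \<subseteq> A"
  shows "apol f (G * h) = (\<Sum>\<beta>\<in>A. lk h \<beta> * apol f (G * xpow \<beta>))"
proof -
  have "apol f (G * h) = apol f (G * (\<Sum>\<beta>\<in>A. cst (lk h \<beta>) * xpow \<beta>))"
    using sum_xpow_superset[OF assms] by simp
  also have "G * (\<Sum>\<beta>\<in>A. cst (lk h \<beta>) * xpow \<beta>) = (\<Sum>\<beta>\<in>A. cst (lk h \<beta>) * (G * xpow \<beta>))"
    by (simp add: sum_distrib_left mult_ac)
  finally show ?thesis by (simp add: apol_sum apol_cst_mult)
qed

lemma linear_form_expand: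
  assumes "finite I" "l \<in> forms I 1" shows "l = (\<Sum>j\<in>I. cst (lk l (sg j 1)) * var j)"
proof -
  have "monomials I 1 = (\<lambda>j. sg j 1) ` I"
  proof (intro set_eqI iffI)
    fix \<alpha> assume \<alpha>: "\<alpha> \<in> monomials I 1"
    have s: "sum (lk \<alpha>) I = 1" using \<alpha> assms(1) mdeg_superset[of I \<alpha>] by (simp add: in_monomials)
    then obtain j where j: "j \<in> I" "lk \<alpha> j \<noteq> 0" by (metis sum.neutral zero_neq_one)
    have "sum (lk \<alpha>) I = lk \<alpha> j + sum (lk \<alpha>) (I - {j})" using j assms(1) by (simp add: sum.remove)
    hence 1: "lk \<alpha> j = 1" "sum (lk \<alpha>) (I - {j}) = 0" using s j by auto
    have "lk \<alpha> k = 0" if "k \<noteq> j" for k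
    proof (cases "k \<in> I")
      case True thus ?thesis using 1(2) assms(1) that by auto
    next
      case False thus ?thesis using \<alpha> by (auto simp: in_monomials in_keys_iff)
    qed
    hence "\<alpha> = sg j 1" using 1 by (intro poly_mapping_eqI) (auto simp: lookup_single when_def)
    thus "\<alpha> \<in> (\<lambda>j. sg j 1) ` I" using j by blast
  qed (auto simp: in_monomials)
  moreover have "inj_on (\<lambda>j. sg j (1::nat)) I"
    by (simp add: inj_on_def)
  moreover have "l = (\<Sum>\<alpha>\<in>monomials I 1. cst (lk l \<alpha>) * xpow \<alpha>)"
    using assms by (intro sum_xpow_superset) (auto simp: forms_def)
  ultimately show ?thesis by (simp add: sum.reindex var_def xpow_def)
qed

text \<open>Exponents of degree \<open>d - s\<close>, where \<open>D \<circ> f\<close> has its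
  coefficients. In additive form the condition leaves the set empty for \<open>s > d\<close>, where
  truncated subtraction would keep the exponent 0.\<close>

definition cofactor_exps :: "nat \<Rightarrow> nat \<Rightarrow> nat \<Rightarrow> (nat \<Rightarrow>\<^sub>0 nat) set" where
  "cofactor_exps n d s = {\<beta>. ks \<beta> \<subseteq> {..n} \<and> mdeg \<beta> + s = d}"

lemma finite_cofactor_exps [simp]: "finite (cofactor_exps n d s)"
proof -
  have "cofactor_exps n d s \<subseteq> monomials {..n} (d - s)"
    by (auto simp: cofactor_exps_def in_monomials)
  thus ?thesis by (rule finite_subset) simp
qed

text \<open>\<open>D \<circ> f = 0\<close> as finitely many equations, linear in \<open>D\<close>
  and in \<open>f\<close>: up to the nonzero factor \<open>mfact \<beta>\<close>, the pairing is the
  coefficient of \<open>D \<circ> f\<close> at \<beta>.\<close>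

definition annihilates :: "nat \<Rightarrow> nat \<Rightarrow> nat \<Rightarrow> nat mpoly \<Rightarrow> nat mpoly \<Rightarrow> bool" where
  "annihilates n d s D f \<longleftrightarrow> (\<forall>\<beta>\<in>cofactor_exps n d s. apol f (D * xpow \<beta>) = 0)"

lemma annihilates_cst_mult: "annihilates n d s D f \<Longrightarrow> annihilates n d s (cst c * D) f"
  by (simp add: annihilates_def mult.assoc apol_cst_mult)

text \<open>Weighting coefficients with factorials turns differentiation into a shift of exponents,
  so iterated derivatives compose without falling factorials.\<close>

lemma lookup_partial_mfact:
  "mfact \<beta> * lk (partial i p) \<beta> = mfact (\<beta> + sg i 1) * lk p (\<beta> + sg i 1)"
  unfolding lookup_partial mfact_add_single by (simp add: mult_ac del: of_nat_Suc)

lemma lookup_partial_iter_mfact: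
  "mfact \<beta> * lk ((partial i ^^ k) p) \<beta> = mfact (\<beta> + sg i k) * lk p (\<beta> + sg i k)"
proof (induction k arbitrary: \<beta>)
  case (Suc k)
  have "mfact \<beta> * lk ((partial i ^^ Suc k) p) \<beta> = mfact (\<beta> + sg i 1) * lk ((partial i ^^ k) p) (\<beta> + sg i 1)"
    by (simp add: lookup_partial_mfact)
  also have "\<dots> = mfact (\<beta> + sg i 1 + sg i k) * lk p (\<beta> + sg i 1 + sg i k)" by (rule Suc)
  also have "\<beta> + sg i 1 + sg i k = \<beta> + sg i (Suc k)"
    by (simp add: add.assoc flip: single_add)
  finally show ?case .
qed simp

lemma lookup_diff_monom: "mfact \<beta> * lk (diff_monom \<alpha> f) \<beta> = mfact (\<alpha> + \<beta>) * lk f (\<alpha> + \<beta>)"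
proof -
  have "mfact \<beta> * lk (foldr (\<lambda>i. partial i ^^ lk \<alpha> i) xs f) \<beta> =
      mfact (\<beta> + (\<Sum>i\<leftarrow>xs. sg i (lk \<alpha> i))) * lk f (\<beta> + (\<Sum>i\<leftarrow>xs. sg i (lk \<alpha> i)))" for xs \<beta>
    by (induction xs arbitrary: \<beta>) (simp_all add: lookup_partial_iter_mfact add.assoc)
  moreover have "(\<Sum>i\<leftarrow>sorted_list_of_set (ks \<alpha>). sg i (lk \<alpha> i)) = \<alpha>"
    using expo_sum_singles[of \<alpha>] by (simp add: sum_list_distinct_conv_sum_set)
  ultimately show ?thesis by (simp add: diff_monom_def add.commute)
qed

lemma lookup_diff_act: "mfact \<beta> * lk (diff_act D f) \<beta> = apol f (D * xpow \<beta>)"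
proof -
  have "mfact \<beta> * lk (diff_act D f) \<beta> = (\<Sum>\<alpha>\<in>ks D. lk D \<alpha> * (mfact \<beta> * lk (diff_monom \<alpha> f) \<beta>))"
    by (simp add: diff_act_def lookup_sum sum_distrib_left mult_ac)
  also have "\<dots> = (\<Sum>\<alpha>\<in>ks D. lk D \<alpha> * apol f (xpow \<beta> * xpow \<alpha>))"
    unfolding lookup_diff_monom
    by (intro sum.cong refl) (metis add.commute apol_xpow mult_single mult_1 xpow_def)
  also have "\<dots> = apol f (xpow \<beta> * D)" by (subst apol_mult_expand[of "ks D"]) auto
  finally show ?thesis by (simp add: mult.commute)
qed

text \<open>The coefficients of \<open>D \<circ> f\<close> outside \<open>cofactor_exps\<close>
  vanish for reasons of degree and of variables, so only the remaining ones are conditions.\<close>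

lemma perp_iff_annihilates:
  assumes "D \<in> forms {..n} s" "f \<in> forms {..n} d"
  shows "D \<in> perp n f \<longleftrightarrow> annihilates n d s D f"
proof
  assume "D \<in> perp n f"
  thus "annihilates n d s D f"
    by (auto simp: perp_def annihilates_def simp flip: lookup_diff_act)
next
  assume *: "annihilates n d s D f"
  have "lk (diff_act D f) \<beta> = 0" for \<beta>
  proof -
    have "apol f (D * xpow \<beta>) = 0"
    proof (cases "\<beta> \<in> cofactor_exps n d s")
      case True thus ?thesis using * by (simp add: annihilates_def)
    next
      case False
      have "apol f (xpow \<beta> * D) = (\<Sum>\<alpha>\<in>ks D. lk D \<alpha> * apol f (xpow \<beta> * xpow \<alpha>))"
        by (intro apol_mult_expand) auto
      also have "\<dots> = 0"
      proof (intro sum.neutral ballI)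
        fix \<alpha> assume "\<alpha> \<in> ks D"
        hence "\<alpha> \<in> monomials {..n} s" using assms(1) by (auto simp: forms_def)
        hence \<alpha>: "ks \<alpha> \<subseteq> {..n}" "mdeg \<alpha> = s" by (simp_all add: in_monomials)
        have "\<beta> + \<alpha> \<notin> monomials {..n} d"
          using False \<alpha> by (auto simp: in_monomials cofactor_exps_def mdeg_add keys_add_nat)
        hence "lk f (\<beta> + \<alpha>) = 0" using assms(2) by (auto simp: forms_def in_keys_iff)
        thus "lk D \<alpha> * apol f (xpow \<beta> * xpow \<alpha>) = 0"
          using apol_xpow[of f "\<beta> + \<alpha>"] by (simp add: xpow_def mult_single)
      qed
      finally show ?thesis by (simp add: mult.commute)
    qed
    thus ?thesis using lookup_diff_act[of \<beta> D f] by simp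
  qed
  hence "diff_act D f = 0" by (intro poly_mapping_eqI) simp
  thus "D \<in> perp n f" using forms_polys[OF assms(1)] by (simp add: perp_def)
qed

section \<open>Generic forms\<close>

abbreviation others :: "nat \<Rightarrow> nat \<Rightarrow> (nat \<Rightarrow> nat mpoly) \<Rightarrow> nat mpoly" where
  "others s i L \<equiv> (\<Prod>j\<in>{..<s} - {i}. L j)"

text \<open>At a decomposition in a critical configuration the map from first order deformations of the
  linear factors to the conormal equations fails to be surjective, as witnessed by \<open>h\<close>.\<close>

definition critical :: "nat \<Rightarrow> nat \<Rightarrow> nat \<Rightarrow> nat mpoly \<Rightarrow> bool" where
  "critical n d s f \<longleftrightarrow> (\<exists>L h. (\<forall>i<s. L i \<in> forms {..n} 1 \<and> L i \<noteq> 0) \<and>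
     annihilates n d s (\<Prod>i<s. L i) f \<and> h \<noteq> 0 \<and> ks h \<subseteq> cofactor_exps n d s \<and>
     (\<forall>i<s. \<forall>l\<in>forms {..n} 1. apol f (l * others s i L * h) = 0))"

section \<open>Derivations of the complex numbers acting on coefficients\<close>

definition cmap :: "(complex \<Rightarrow> complex) \<Rightarrow> 'v mpoly \<Rightarrow> 'v mpoly" where
  "cmap \<delta> G = (\<Sum>\<alpha>\<in>ks G. sg \<alpha> (\<delta> (lk G \<alpha>)))"

context
  fixes \<delta> :: "complex \<Rightarrow> complex"
  assumes der: "derivation_on UNIV \<delta>"
begin

lemma der_add: "\<delta> (a + b) = \<delta> a + \<delta> b" and der_mult: "\<delta> (a * b) = \<delta> a * b + a * \<delta> b"
  using der by (auto simp: derivation_on_def)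

lemma der_0 [simp]: "\<delta> 0 = 0"
  using der_add[of 0 0] by simp

lemma der_1 [simp]: "\<delta> 1 = 0"
  using der_mult[of 1 1] by simp

lemma der_sum: "\<delta> (sum f A) = (\<Sum>a\<in>A. \<delta> (f a))"
  by (induction A rule: infinite_finite_induct) (simp_all add: der_add)

lemma der_fact: "\<delta> (fact k) = 0"
proof -
  have "\<delta> (of_nat m) = 0" for m by (induction m) (simp_all add: der_add)
  thus ?thesis by (metis of_nat_fact)
qed

lemma der_mfact: "\<delta> (mfact \<gamma>) = 0"
proof -
  have "\<delta> (\<Prod>i\<in>A. fact (g i)) = 0" for A :: "'b set" and g
    by (induction A rule: infinite_finite_induct) (simp_all add: der_mult der_fact)
  thus ?thesis by (simp add: mfact_def)
qed

lemma lookup_cmap: "lk (cmap \<delta> G) \<alpha> = \<delta> (lk G \<alpha>)"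
  by (auto simp: cmap_def lookup_sum lookup_single when_def in_keys_iff)

lemma keys_cmap: "ks (cmap \<delta> G) \<subseteq> ks G"
  by (auto simp: in_keys_iff lookup_cmap)

lemma cmap_add: "cmap \<delta> (G + H) = cmap \<delta> G + cmap \<delta> H"
  by (rule poly_mapping_eqI) (simp add: lookup_cmap lookup_add der_add)

lemma cmap_1 [simp]: "cmap \<delta> 1 = 0"
  by (rule poly_mapping_eqI) (simp add: lookup_cmap lookup_one when_def)

lemma cmap_mult: "cmap \<delta> (G * H) = cmap \<delta> G * H + G * cmap \<delta> H"
proof (induction G rule: mpoly_single_induct)
  case (add p q) thus ?case by (simp add: distrib_right distrib_left cmap_add)
next
  case (single \<alpha> c)
  have cs: "cmap \<delta> (sg \<alpha> c) = sg \<alpha> (\<delta> c)" for \<alpha> c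
    by (rule poly_mapping_eqI) (simp add: lookup_cmap lookup_single when_def)
  show ?case
  proof (induction H rule: mpoly_single_induct)
    case (add p q) thus ?case by (simp add: distrib_right distrib_left cmap_add)
  next
    case (single \<beta> d)
    show ?case by (simp add: mult_single cs der_mult flip: single_add)
  qed
qed

lemma cmap_prod:
  "finite A \<Longrightarrow> cmap \<delta> (prod f A) = (\<Sum>a\<in>A. cmap \<delta> (f a) * prod f (A - {a}))"
proof (induction A rule: finite_induct)
  case (insert x F)
  have "(\<Sum>a\<in>F. cmap \<delta> (f a) * prod f (insert x F - {a})) = (\<Sum>a\<in>F. cmap \<delta> (f a) * (f x * prod f (F - {a})))"
  proof (intro sum.cong refl)
    fix a assume "a \<in> F"
    hence "insert x F - {a} = insert x (F - {a})" using insert by auto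
    thus "cmap \<delta> (f a) * prod f (insert x F - {a}) = cmap \<delta> (f a) * (f x * prod f (F - {a}))"
      using insert by simp
  qed
  thus ?case using insert by (simp add: cmap_mult sum_distrib_left mult_ac)
qed auto

text \<open>Leibniz rule for the bilinear pairing; the weights \<open>mfact\<close> are integers and
  are killed by \<open>\<delta>\<close>.\<close>

lemma der_apol: "\<delta> (apol f G) = apol f (cmap \<delta> G) + apol (cmap \<delta> f) G"
proof -
  have "apol f (cmap \<delta> G) = (\<Sum>\<gamma>\<in>ks G. lk (cmap \<delta> G) \<gamma> * (mfact \<gamma> * lk f \<gamma>))"
    using keys_cmap by (intro apol_superset) auto
  thus ?thesis
    by (simp add: apol_def der_sum der_mult der_mfact lookup_cmap sum.distrib)
qed

end

text \<open>Suppose no nonzero integer polynomial in the coefficients of \<open>f\<close> vanishes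
  on the set \<open>Z\<close> of critical configurations. Then some solution of the system has an
  \<open>f\<close> with algebraically independent coefficients. For each \<gamma>, a derivation with
  value 1 on the coefficient \<gamma> of \<open>f\<close> and 0 on the others is applied to
  \<open>apol f G = 0\<close>, where \<open>G\<close> is the product of all \<open>L i\<close> and
  of \<open>h\<close>. The terms differentiating a factor or \<open>h\<close> vanish by the system,
  and what remains is a nonzero multiple of the coefficient \<gamma> of \<open>G\<close>. So
  \<open>G = 0\<close>, against the nonvanishing conditions.\<close>

lemma generic_not_critical_poly:
  "\<exists>q \<in> polys (monomials {..n} d). q \<noteq> 0 \<and>
     (\<forall>f\<in>forms {..n} d. critical n d s f \<longrightarrow> evc (lk f) q = 0)"
proof -
  let ?mon = "monomials {..n} d" and ?B = "cofactor_exps n d s"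
  \<comment> \<open>All unknowns are tagged tuples of one linearly ordered type, because a point
    where the resulting polynomial is nonzero comes from
    \<open>poly_nonvanishing_point\<close>.\<close>
  define F :: "(nat \<Rightarrow>\<^sub>0 nat) \<Rightarrow> nat \<times> nat \<times> nat \<times> (nat \<Rightarrow>\<^sub>0 nat)" where "F \<alpha> = (0, 0, 0, \<alpha>)" for \<alpha>
  \<comment> \<open>\<open>VL\<close> and \<open>VW\<close> are the coefficients of the \<open>L\<^sub>i\<close> and of \<open>h\<close>; \<open>VY\<close> and \<open>VZ\<close> certify that these are nonzero\<close>
  define VL VY :: "nat \<Rightarrow> nat \<Rightarrow> nat \<times> nat \<times> nat \<times> (nat \<Rightarrow>\<^sub>0 nat)"
    where "VL i j = (1, i, j, 0)" and "VY i j = (2, i, j, 0)" for i j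
  define VW VZ :: "(nat \<Rightarrow>\<^sub>0 nat) \<Rightarrow> nat \<times> nat \<times> nat \<times> (nat \<Rightarrow>\<^sub>0 nat)"
    where "VW \<beta> = (3, 0, 0, \<beta>)" and "VZ \<beta> = (4, 0, 0, \<beta>)" for \<beta>
  note V_def = F_def VL_def VY_def VW_def VZ_def
  define I where "I = F ` ?mon \<union> (\<lambda>(i, j). VL i j) ` ({..<s} \<times> {..n}) \<union>
    (\<lambda>(i, j). VY i j) ` ({..<s} \<times> {..n}) \<union> VW ` ?B \<union> VZ ` ?B"
  have finI: "finite I" by (simp add: I_def)
  have inI: "\<alpha> \<in> ?mon \<Longrightarrow> F \<alpha> \<in> I" "i < s \<Longrightarrow> j \<le> n \<Longrightarrow> VL i j \<in> I" "i < s \<Longrightarrow> j \<le> n \<Longrightarrow> VY i j \<in> I"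
    "\<beta> \<in> ?B \<Longrightarrow> VW \<beta> \<in> I" "\<beta> \<in> ?B \<Longrightarrow> VZ \<beta> \<in> I" for \<alpha> \<beta> i j
    by (auto simp: I_def)
  define ff where "ff x = (\<Sum>\<alpha>\<in>?mon. cst (x (F \<alpha>)) * xpow \<alpha>)" for x :: "_ \<Rightarrow> complex"
  define LL where "LL x i = (\<Sum>j\<le>n. cst (x (VL i j)) * var j)" for x :: "_ \<Rightarrow> complex" and i
  define hh where "hh x = (\<Sum>\<beta>\<in>?B. cst (x (VW \<beta>)) * xpow \<beta>)" for x :: "_ \<Rightarrow> complex"
  have lk_ff: "lk (ff x) \<alpha> = (if \<alpha> \<in> ?mon then x (F \<alpha>) else 0)" for x \<alpha>
    by (simp add: ff_def lookup_sum xpow_def lookup_single when_def if_distrib cong: if_cong)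
  have fam_L: "polyfam I (\<lambda>x. LL x i)" if "i < s" for i
    unfolding LL_def using that by (intro polyfam_sum polyfam_scale polyfun_var inI) auto
  have fam_h: "polyfam I hh"
    unfolding hh_def by (intro polyfam_sum polyfam_scale polyfun_var inI)
  have pf_apol: "polyfun I (\<lambda>x. apol (ff x) (G x))" if fam: "polyfam I G" for G
  proof -
    obtain A where A: "finite A" "\<And>x. ks (G x) \<subseteq> A" using fam by (auto simp: polyfam_def)
    have "polyfun I (\<lambda>x. \<Sum>\<gamma>\<in>A. lk (G x) \<gamma> * (mfact \<gamma> * (if \<gamma> \<in> ?mon then x (F \<gamma>) else 0)))"
    proof (intro polyfun_sum polyfun_mult polyfun_const)
      fix \<gamma> show "polyfun I (\<lambda>x. lk (G x) \<gamma>)" using fam by (simp add: polyfam_def)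
      show "polyfun I (\<lambda>x. if \<gamma> \<in> ?mon then x (F \<gamma>) else 0)"
        by (cases "\<gamma> \<in> ?mon") (auto intro: polyfun_intros inI)
    qed
    thus ?thesis by (simp add: apol_superset[OF A(1,2)] lk_ff)
  qed
  \<comment> \<open>\<open>E1\<close>: the product annihilates \<open>f\<close>. \<open>E2\<close>,
    \<open>E3\<close>: each \<open>L i\<close> and \<open>h\<close> is nonzero, turned into
    equations by auxiliary unknowns. \<open>E4\<close>: the differential is orthogonal to
    \<open>h\<close>, tested on the basis \<open>var j\<close> of the linear forms.\<close>
  define E1 where "E1 \<beta> x = apol (ff x) ((\<Prod>i<s. LL x i) * xpow \<beta>)" for \<beta> x
  define E2 where "E2 i x = (\<Sum>j\<le>n. x (VY i j) * x (VL i j)) - 1" for i and x :: "_ \<Rightarrow> complex"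
  define E3 where "E3 x = (\<Sum>\<beta>\<in>?B. x (VZ \<beta>) * x (VW \<beta>)) - 1" for x :: "_ \<Rightarrow> complex"
  define E4 where "E4 i j x = apol (ff x) (var j * others s i (LL x) * hh x)" for i j x
  have pE1: "polyfun I (E1 \<beta>)" for \<beta>
    unfolding E1_def by (intro pf_apol polyfam_mult polyfam_prod polyfam_const fam_L) auto
  have pE2: "polyfun I (E2 i)" if "i < s" for i
    unfolding E2_def using that by (intro polyfun_intros inI) auto
  have pE3: "polyfun I E3"
    unfolding E3_def by (intro polyfun_intros inI) auto
  have pE4: "polyfun I (E4 i j)" for i j
    unfolding E4_def by (intro pf_apol polyfam_mult polyfam_prod polyfam_const fam_L fam_h) auto
  define Z where "Z = {x. (\<forall>\<beta>\<in>?B. E1 \<beta> x = 0) \<and> (\<forall>i<s. E2 i x = 0) \<and> E3 x = 0 \<and> (\<forall>i<s. \<forall>j\<le>n. E4 i j x = 0)}"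
  define J where "J = {p \<in> polys I. \<forall>x\<in>Z. evc x p = 0}"
  \<comment> \<open>Integer coefficients make the hypersurfaces to be avoided countable in number,
    and avoiding them means algebraic independence of the coefficients of \<open>f\<close>.\<close>
  define ZP where "ZP = {q \<in> polys (F ` ?mon). \<forall>\<alpha>. lk q \<alpha> \<in> \<int>}"
  define M where "M = ZP - {0}"
  have J: "poly_ideal I J"
    unfolding poly_ideal_def J_def by (auto simp: ev_simps intro: polys_intros)
  have ZPsub: "ZP \<subseteq> polys I" unfolding ZP_def using polys_mono[of "F ` ?mon" I] by (auto simp: I_def)
  have ZP_add: "p + q \<in> ZP" and ZP_diff: "p - q \<in> ZP" if "p \<in> ZP" "q \<in> ZP" for p q
    using that by (auto simp: ZP_def lookup_add lookup_minus intro: polys_intros)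
  have ZP_1: "1 \<in> ZP" by (auto simp: ZP_def lookup_one when_def)
  have ZP_var: "var (F \<alpha>) \<in> ZP" if "\<alpha> \<in> ?mon" for \<alpha>
    using that by (auto simp: ZP_def var_def lookup_single when_def polys_single)
  have ZP_mult: "p * q \<in> ZP" if "p \<in> ZP" "q \<in> ZP" for p q
  proof -
    have "lk (p * q) \<gamma> \<in> \<int>" for \<gamma>
    proof -
      have "p * q = (\<Sum>\<alpha>\<in>ks p. cst (lk p \<alpha>) * xpow \<alpha>) * (\<Sum>\<beta>\<in>ks q. cst (lk q \<beta>) * xpow \<beta>)"
        using sum_xpow_superset[of "ks p" p] sum_xpow_superset[of "ks q" q] by simp
      hence "p * q = (\<Sum>\<alpha>\<in>ks p. \<Sum>\<beta>\<in>ks q. cst (lk p \<alpha> * lk q \<beta>) * (xpow \<alpha> * xpow \<beta>))"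
        by (simp add: sum_product cst_mult mult_ac)
      hence "lk (p * q) \<gamma> = (\<Sum>\<alpha>\<in>ks p. \<Sum>\<beta>\<in>ks q. lk p \<alpha> * lk q \<beta> * (1 when \<alpha> + \<beta> = \<gamma>))"
        by (simp add: lookup_sum xpow_def mult_single lookup_single)
      also have "\<dots> \<in> \<int>" using that by (intro Ints_sum Ints_mult) (auto simp: ZP_def when_def)
      finally show ?thesis .
    qed
    thus ?thesis using that by (auto simp: ZP_def intro: polys_mult)
  qed
  have countM: "countable M"
  proof -
    have "countable {\<alpha> :: (nat \<times> nat \<times> nat \<times> (nat \<Rightarrow>\<^sub>0 nat)) \<Rightarrow>\<^sub>0 nat. ks \<alpha> \<subseteq> F ` ?mon \<and> (\<forall>a\<in>ks \<alpha>. lk \<alpha> a \<in> UNIV)}"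
      by (rule countable_poly_mappings[OF countable_finite]) auto
    moreover have "countable (\<int> :: complex set)" by (simp add: Ints_def)
    ultimately have "countable {q :: (nat \<times> nat \<times> nat \<times> (nat \<Rightarrow>\<^sub>0 nat)) mpoly.
       ks q \<subseteq> {\<alpha>. ks \<alpha> \<subseteq> F ` ?mon \<and> (\<forall>a\<in>ks \<alpha>. lk \<alpha> a \<in> UNIV)} \<and> (\<forall>a\<in>ks q. lk q a \<in> \<int>)}"
      by (rule countable_poly_mappings)
    thus ?thesis by (rule countable_subset[rotated]) (auto simp: M_def ZP_def polys_def)
  qed
  have "J \<inter> M \<noteq> {}"
  proof
    assume disj: "J \<inter> M = {}"
    have "\<exists>x. (\<forall>p\<in>J. evc x p = 0) \<and> (\<forall>p\<in>M. evc x p \<noteq> 0)"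
      using ZPsub ZP_1 ZP_mult by (intro nullstellensatz_countable[OF finI J countM _ _ _ disj]) (auto simp: M_def)
    then obtain x where xJ: "\<And>p. p \<in> J \<Longrightarrow> evc x p = 0" and xM: "\<And>p. p \<in> M \<Longrightarrow> evc x p \<noteq> 0" by blast
    have zero: "E x = 0" if E: "polyfun I E" "\<And>y. y \<in> Z \<Longrightarrow> E y = 0" for E
    proof -
      obtain p where p: "p \<in> polys I" "\<forall>y. E y = evc y p" using E(1) by (auto simp: polyfun_def)
      hence "p \<in> J" using E(2) by (auto simp: J_def)
      thus ?thesis using p xJ by simp
    qed
    have x1: "E1 \<beta> x = 0" if "\<beta> \<in> ?B" for \<beta> using that by (auto intro!: zero[OF pE1] simp: Z_def)
    have x2: "E2 i x = 0" if "i < s" for i using that by (auto intro!: zero[OF pE2] simp: Z_def)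
    have x3: "E3 x = 0" by (rule zero[OF pE3]) (auto simp: Z_def)
    have x4: "E4 i j x = 0" if "i < s" "j \<le> n" for i j using that by (auto intro!: zero[OF pE4] simp: Z_def)
    define G where "G = (\<Prod>i<s. LL x i) * hh x"
    have LLf: "LL x i \<in> forms {..n} 1" for i
      unfolding LL_def by (intro forms_sum forms_cst_mult forms_var) auto
    have hk: "ks (hh x) \<subseteq> ?B"
    proof
      fix \<beta> assume "\<beta> \<in> ks (hh x)"
      hence "(\<Sum>\<alpha>\<in>?B. if \<alpha> = \<beta> then x (VW \<alpha>) else 0) \<noteq> 0"
        by (simp add: hh_def in_keys_iff lookup_sum xpow_def lookup_single when_def if_distrib cong: if_cong)
      thus "\<beta> \<in> ?B" by (simp split: if_splits)
    qed
    have inj: "p = q" if "p \<in> ZP" "q \<in> ZP" "evc x p = evc x q" for p q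
      using xM[of "p - q"] ZP_diff[OF that(1,2)] that(3) by (auto simp: M_def ev_simps)
    have G0: "lk G \<gamma> = 0" if \<gamma>: "\<gamma> \<in> ?mon" for \<gamma>
    proof -
      \<comment> \<open>The partial derivative with respect to the coefficient \<gamma>, transported
        to complex numbers. Evaluation at \<open>x\<close> is injective on \<open>ZP\<close>, so the
        chosen preimage is the only one.\<close>
      define \<delta>0 where "\<delta>0 a = evc x (partial (F \<gamma>) (SOME p. p \<in> ZP \<and> evc x p = a))" for a
      have \<delta>0: "\<delta>0 (evc x p) = evc x (partial (F \<gamma>) p)" if "p \<in> ZP" for p
      proof -
        have "(SOME q. q \<in> ZP \<and> evc x q = evc x p) = p"
          by (rule some_equality) (use that inj in auto)
        thus ?thesis by (simp add: \<delta>0_def)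
      qed
      have ex: "p \<in> ZP \<Longrightarrow> evc x p \<in> evc x ` ZP" for p by blast
      have "subring (evc x ` ZP)"
        unfolding subring_def
      proof (intro conjI ballI)
        show "1 \<in> evc x ` ZP" using ex[OF ZP_1] by (simp add: ev_simps)
        fix a b assume "a \<in> evc x ` ZP" "b \<in> evc x ` ZP"
        then obtain p q where "p \<in> ZP" "q \<in> ZP" "a = evc x p" "b = evc x q" by blast
        thus "a - b \<in> evc x ` ZP" "a * b \<in> evc x ` ZP"
          using ex[OF ZP_diff, of p q] ex[OF ZP_mult, of p q] by (simp_all add: ev_simps)
      qed
      moreover have "derivation_on (evc x ` ZP) \<delta>0"
        unfolding derivation_on_def
      proof (intro ballI)
        fix a b assume "a \<in> evc x ` ZP" "b \<in> evc x ` ZP"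
        then obtain p q where pq: "p \<in> ZP" "q \<in> ZP" "a = evc x p" "b = evc x q" by blast
        show "\<delta>0 (a + b) = \<delta>0 a + \<delta>0 b \<and> \<delta>0 (a * b) = \<delta>0 a * b + a * \<delta>0 b"
          using \<delta>0[OF ZP_add[OF pq(1,2)]] \<delta>0[OF ZP_mult[OF pq(1,2)]] \<delta>0[OF pq(1)] \<delta>0[OF pq(2)]
          by (simp add: pq(3,4) ev_simps partial_add partial_mult)
      qed
      ultimately obtain \<delta> where \<delta>: "derivation_on UNIV \<delta>" "\<And>a. a \<in> evc x ` ZP \<Longrightarrow> \<delta> a = \<delta>0 a"
        using derivation_extends by metis
      have \<delta>F: "\<delta> (x (F \<alpha>)) = (if \<alpha> = \<gamma> then 1 else 0)" if "\<alpha> \<in> ?mon" for \<alpha>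
      proof -
        have "\<delta> (evc x (var (F \<alpha>))) = evc x (partial (F \<gamma>) (var (F \<alpha>)))"
          using ZP_var[OF that] \<delta>(2) \<delta>0 by simp
        thus ?thesis by (simp add: ev_simps partial_var F_def split: if_splits)
      qed
      have lin: "apol (ff x) (l * others s i (LL x) * hh x) = 0" if "i < s" "l \<in> forms {..n} 1" for i l
      proof -
        have "l * others s i (LL x) * hh x =
            (\<Sum>j\<le>n. cst (lk l (sg j 1)) * (var j * others s i (LL x) * hh x))"
          by (subst linear_form_expand[OF _ that(2)]) (simp_all add: sum_distrib_right mult.assoc)
        thus ?thesis using x4 that(1) by (simp add: apol_sum apol_cst_mult E4_def)
      qed
      have ann: "apol (ff x) ((\<Prod>i<s. LL x i) * g) = 0" if "ks g \<subseteq> ?B" for g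
        using x1 by (subst apol_mult_expand[OF _ that]) (auto simp: E1_def)
      \<comment> \<open>Product rule: the \<open>cmap \<delta> (LL x i)\<close> are again linear
        forms, so \<open>E4\<close> disposes of the terms of the sum, and \<open>E1\<close> of the
        last term.\<close>
      have "cmap \<delta> G = (\<Sum>i<s. cmap \<delta> (LL x i) * others s i (LL x) * hh x) + (\<Prod>i<s. LL x i) * cmap \<delta> (hh x)"
        unfolding G_def by (simp add: cmap_mult[OF \<delta>(1)] cmap_prod[OF \<delta>(1)] sum_distrib_right)
      moreover have "cmap \<delta> (LL x i) \<in> forms {..n} 1" for i
        using LLf[of i] keys_cmap[OF \<delta>(1), of "LL x i"] by (auto simp: forms_def)
      ultimately have "apol (ff x) (cmap \<delta> G) = 0"
        using ann[of "cmap \<delta> (hh x)"] hk keys_cmap[OF \<delta>(1), of "hh x"] lin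
        by (simp add: apol_add apol_sum subset_trans[of _ "ks (hh x)"])
      moreover have "apol (ff x) G = 0" unfolding G_def by (rule ann[OF hk])
      ultimately have "apol (cmap \<delta> (ff x)) G = 0"
        using der_apol[OF \<delta>(1), of "ff x" G] der_0[OF \<delta>(1)] by simp
      moreover have "cmap \<delta> (ff x) = xpow \<gamma>"
        using \<gamma> \<delta>F der_0[OF \<delta>(1)]
        by (intro poly_mapping_eqI) (auto simp: lookup_cmap[OF \<delta>(1)] lk_ff xpow_def lookup_single when_def)
      ultimately have "(\<Sum>\<alpha>\<in>ks G. if \<alpha> = \<gamma> then lk G \<gamma> * mfact \<gamma> else 0) = 0"
        by (simp add: apol_def xpow_def lookup_single when_def if_distrib cong: if_cong)
      thus ?thesis by (auto simp: in_keys_iff split: if_splits)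
    qed
    have "ks G \<subseteq> ?mon"
    proof
      fix \<gamma> assume "\<gamma> \<in> ks G"
      then obtain \<alpha> \<beta> where ab: "\<gamma> = \<alpha> + \<beta>" "\<alpha> \<in> ks (\<Prod>i<s. LL x i)" "\<beta> \<in> ?B"
        using subsetD[OF keys_mult] hk unfolding G_def by blast
      have "(\<Prod>i<s. LL x i) \<in> forms {..n} s" using forms_prod[of "{..<s}" "LL x" "{..n}"] LLf by simp
      hence "\<alpha> \<in> monomials {..n} s" using ab(2) by (auto simp: forms_def)
      thus "\<gamma> \<in> ?mon" using ab(1,3) by (auto simp: in_monomials cofactor_exps_def keys_add_nat mdeg_add)
    qed
    hence "G = 0" using G0 by (intro poly_mapping_eqI) (force simp: in_keys_iff)
    hence "(\<exists>i<s. LL x i = 0) \<or> hh x = 0" by (auto simp: G_def)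
    thus False
    proof
      assume "\<exists>i<s. LL x i = 0"
      then obtain i where i: "i < s" "LL x i = 0" by blast
      have "x (VL i j) = 0" if "j \<le> n" for j
      proof -
        have "lk (LL x i) (sg j 1) = (\<Sum>k\<le>n. if k = j then x (VL i j) else 0)"
          unfolding LL_def lookup_sum by (intro sum.cong) (auto simp: var_def lookup_single when_def)
        thus ?thesis using i(2) that by simp
      qed
      thus False using x2[OF i(1)] by (simp add: E2_def)
    next
      assume h: "hh x = 0"
      have "x (VW \<beta>) = 0" if "\<beta> \<in> ?B" for \<beta>
      proof -
        have "lk (hh x) \<beta> = x (VW \<beta>)" using that
          by (simp add: hh_def lookup_sum xpow_def lookup_single when_def if_distrib cong: if_cong)
        thus ?thesis using h by simp
      qed
      thus False using x3 by (simp add: E3_def)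
    qed
  qed
  then obtain q0 where q0: "q0 \<in> J" "q0 \<in> M" by blast
  \<comment> \<open>Removal of the tags: the last component of \<open>F \<alpha>\<close> is
    \<alpha>.\<close>
  define q where "q = ev cst (\<lambda>v. var (snd (snd (snd v)))) q0"
  have hc: "ring_hom_c cst" by (simp add: ring_hom_c_def cst_add cst_mult)
  have evq: "evc y q = evc (\<lambda>v. y (snd (snd (snd v)))) q0" for y
    unfolding q_def by (subst ev_ev[where g = "\<lambda>a. a" and k = "\<lambda>a. a"]) (auto simp: hc ev_simps)
  have q0p: "q0 \<in> polys (F ` ?mon)" "q0 \<noteq> 0" using q0 by (auto simp: M_def ZP_def)
  have qp: "q \<in> polys ?mon"
  proof -
    have "ev cst (\<lambda>v. var (snd (snd (snd v)))) p \<in> polys ?mon" if "p \<in> polys (F ` ?mon)" for p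
      using that by (induction p rule: polys_induct) (auto simp: ev_simps hc F_def intro!: polys_intros)
    thus ?thesis using q0p by (simp add: q_def)
  qed
  have qn: "q \<noteq> 0"
  proof -
    obtain x where x: "evc x q0 \<noteq> 0" using poly_nonvanishing_point[OF q0p(2)] by blast
    have "evc (\<lambda>\<alpha>. x (F \<alpha>)) q = evc x q0"
      unfolding evq by (rule ev_cong_polys[OF q0p(1)]) (auto simp: F_def)
    thus ?thesis using x by auto
  qed
  have "evc (lk f) q = 0" if f: "f \<in> forms {..n} d" and cr: "critical n d s f" for f
  proof -
    obtain L h where L: "\<And>i. i < s \<Longrightarrow> L i \<in> forms {..n} 1" "\<And>i. i < s \<Longrightarrow> L i \<noteq> 0"
      "annihilates n d s (\<Prod>i<s. L i) f" "h \<noteq> 0" "ks h \<subseteq> ?B"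
      "\<And>i l. i < s \<Longrightarrow> l \<in> forms {..n} 1 \<Longrightarrow> apol f (l * others s i L * h) = 0"
      using cr unfolding critical_def by blast
    have Lexp: "L i = (\<Sum>j\<le>n. cst (lk (L i) (sg j 1)) * var j)" if "i < s" for i
      using linear_form_expand[OF _ L(1)[OF that]] by simp
    have "\<exists>j\<le>n. lk (L i) (sg j 1) \<noteq> 0" if i: "i < s" for i
    proof (rule ccontr)
      assume "\<not> ?thesis"
      hence "(\<Sum>j\<le>n. cst (lk (L i) (sg j 1)) * var j) = 0" by (intro sum.neutral) auto
      thus False using Lexp[OF i] L(2)[OF i] by simp
    qed
    then obtain jj where jj: "\<And>i. i < s \<Longrightarrow> jj i \<le> n" "\<And>i. i < s \<Longrightarrow> lk (L i) (sg (jj i) 1) \<noteq> 0" by metis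
    obtain b0 where b0: "b0 \<in> ?B" "lk h b0 \<noteq> 0" using L(4,5) by (metis in_keys_iff keys_eq_empty ex_in_conv subsetD)
    \<comment> \<open>A critical \<open>f\<close> extends to a point of \<open>Z\<close>; the
      certificates are inverses of one nonzero coefficient of each \<open>L i\<close> and of
      \<open>h\<close>.\<close>
    define x :: "nat \<times> nat \<times> nat \<times> (nat \<Rightarrow>\<^sub>0 nat) \<Rightarrow> complex" where "x = (\<lambda>(t, i, j, \<alpha>). if t = 0 then lk f \<alpha> else if t = 1 then lk (L i) (sg j 1)
      else if t = 2 then (if j = jj i then 1 / lk (L i) (sg j 1) else 0)
      else if t = 3 then lk h \<alpha> else (if \<alpha> = b0 then 1 / lk h b0 else (0::complex)))"
    have xv: "x (F \<alpha>) = lk f \<alpha>" "x (VL i j) = lk (L i) (sg j 1)"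
      "x (VY i j) = (if j = jj i then 1 / lk (L i) (sg j 1) else 0)"
      "x (VW \<alpha>) = lk h \<alpha>" "x (VZ \<alpha>) = (if \<alpha> = b0 then 1 / lk h b0 else 0)" for \<alpha> i j
      by (simp_all add: x_def V_def)
    have ffx: "ff x = f" unfolding ff_def xv using f by (intro sum_xpow_superset[symmetric]) (auto simp: forms_def)
    have LLx: "LL x i = L i" if "i < s" for i unfolding LL_def xv using Lexp[OF that] by simp
    have hhx: "hh x = h" unfolding hh_def xv using L(5) by (intro sum_xpow_superset[symmetric]) auto
    have pr: "(\<Prod>i\<in>A. LL x i) = (\<Prod>i\<in>A. L i)" if "A \<subseteq> {..<s}" for A
      using that by (intro prod.cong refl LLx) auto
    have "x \<in> Z"
      unfolding Z_def
    proof (intro CollectI conjI ballI allI impI)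
      fix \<beta> assume "\<beta> \<in> ?B" thus "E1 \<beta> x = 0" using L(3) by (simp add: E1_def ffx pr annihilates_def)
    next
      fix i assume i: "i < s"
      have "(\<Sum>j\<le>n. x (VY i j) * x (VL i j)) = (\<Sum>j\<le>n. if j = jj i then 1 else 0)"
        unfolding xv using jj[OF i] by (intro sum.cong) auto
      thus "E2 i x = 0" using jj(1)[OF i] by (simp add: E2_def)
    next
      have "(\<Sum>\<beta>\<in>?B. x (VZ \<beta>) * x (VW \<beta>)) = (\<Sum>\<beta>\<in>?B. if \<beta> = b0 then 1 else 0)"
        unfolding xv using b0 by (intro sum.cong) auto
      thus "E3 x = 0" using b0 by (simp add: E3_def)
    next
      fix i j assume "i < s" "j \<le> n"
      thus "E4 i j x = 0" using L(6)[of i "var j"] forms_var[of j "{..n}"] by (simp add: E4_def ffx hhx pr)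
    qed
    hence "evc x q0 = 0" using q0(1) by (auto simp: J_def)
    moreover have "evc (lk f) q = evc x q0"
      unfolding evq by (rule ev_cong_polys[OF q0p(1)]) (auto simp: xv F_def x_def)
    ultimately show ?thesis by simp
  qed
  thus ?thesis using qp qn by blast
qed

lemma critical_scale:
  assumes "critical n d s f" shows "critical n d s (cst c * f)"
proof -
  obtain L h where "(\<forall>i<s. L i \<in> forms {..n} 1 \<and> L i \<noteq> 0) \<and>
     annihilates n d s (\<Prod>i<s. L i) f \<and> h \<noteq> 0 \<and> ks h \<subseteq> cofactor_exps n d s \<and>
     (\<forall>i<s. \<forall>l\<in>forms {..n} 1. apol f (l * others s i L * h) = 0)"
    using assms unfolding critical_def by blast
  thus ?thesis unfolding critical_def
    by (intro exI[of _ L] exI[of _ h]) (auto simp: annihilates_def apol_scale_left)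
qed

text \<open>The polynomial at hand need not be homogeneous, but being critical is invariant under
  scaling, so all its homogeneous components vanish at a critical form. The open set is where one of
  them does not vanish.\<close>

theorem generic_not_critical:
  obtains U where "zariski_open (monomials {..n} d) U" "U \<noteq> {}"
    "\<And>f. f \<in> U \<Longrightarrow> f \<in> forms {..n} d \<and> \<not> critical n d s f"
proof -
  let ?I = "monomials {..n} d"
  obtain q where q: "q \<in> polys ?I" "q \<noteq> 0"
    "\<And>f. f \<in> forms {..n} d \<Longrightarrow> critical n d s f \<Longrightarrow> evc (lk f) q = 0"
    using generic_not_critical_poly[of n d s] by blast
  define U where "U = {f \<in> proj_space ?I. \<exists>m. evc (lk f) (homc m q) \<noteq> 0}"
  have forms: "f \<in> forms {..n} d" if "f \<in> proj_space ?I" for f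
    using that by (auto simp: proj_space_def forms_def)
  show ?thesis
  proof
    show "zariski_open ?I U"
      unfolding zariski_open_def zariski_closed_def
    proof (intro conjI exI[of _ "range (\<lambda>m. homc m q)"])
      show "U \<subseteq> proj_space ?I" by (auto simp: U_def)
      show "range (\<lambda>m. homc m q) \<subseteq> \<Union> (range (forms ?I))" using homc_forms[OF q(1)] by blast
      show "proj_space ?I - U = zero_locus ?I (range (\<lambda>m. homc m q))"
        by (auto simp: U_def zero_locus_def peval_evc)
    qed
  next
    fix f assume "f \<in> U"
    then obtain m where f: "f \<in> proj_space ?I" "evc (lk f) (homc m q) \<noteq> 0" by (auto simp: U_def)
    have "\<not> critical n d s f"
    proof
      assume cr: "critical n d s f"
      have "evc (\<lambda>i. c * lk f i) q = 0" for c
      proof -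
        have "lk (cst c * f) = (\<lambda>i. c * lk f i)" by (rule ext) simp
        thus ?thesis using q(3)[OF forms_cst_mult[OF forms[OF f(1)]] critical_scale[OF cr], of c] by simp
      qed
      hence "evc (lk f) (homc m q) = 0"
        by (intro homc_vanish[OF q(1), of UNIV]) (auto simp: infinite_UNIV_char_0)
      thus False using f(2) by simp
    qed
    thus "f \<in> forms {..n} d \<and> \<not> critical n d s f" using forms f(1) by blast
  next
    have "sg 0 d \<in> ?I" by (auto simp: in_monomials split: if_splits)
    define \<alpha> where "\<alpha> = (sg 0 d :: nat \<Rightarrow>\<^sub>0 nat)"
    \<comment> \<open>The extra variable keeps the point away from the origin even when
      \<open>q\<close> is a constant.\<close>
    have "q * var \<alpha> \<noteq> 0" using q(2) by (simp add: var_def)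
      (metis single_zero inj_single keys_single keys_zero insert_not_empty zero_neq_one)
    then obtain x where x: "evc x q \<noteq> 0" "x \<alpha> \<noteq> 0"
      using poly_nonvanishing_point[of "q * var \<alpha>"] by (auto simp: ev_simps)
    define f where "f = (\<Sum>\<beta>\<in>?I. sg \<beta> (x \<beta>))"
    have lkf: "lk f \<beta> = (if \<beta> \<in> ?I then x \<beta> else 0)" for \<beta>
      by (simp add: f_def lookup_sum lookup_single when_def)
    have fp: "f \<in> proj_space ?I"
    proof -
      have "lk f \<alpha> \<noteq> 0" using x(2) \<open>sg 0 d \<in> ?I\<close> by (simp add: lkf \<alpha>_def)
      moreover have "ks f \<subseteq> ?I" by (auto simp: in_keys_iff lkf simp del: lookup_not_eq_zero_eq_in_keys split: if_splits)
      ultimately show ?thesis by (auto simp: proj_space_def)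
    qed
    have "evc (lk f) q = evc x q" by (rule ev_cong_polys[OF q(1)]) (simp add: lkf)
    hence "evc (lk f) (\<Sum>m\<le>tdeg q. homc m q) \<noteq> 0" using x by (simp add: homc_sum_le)
    hence "\<exists>m. evc (lk f) (homc m q) \<noteq> 0" by (force simp: ev_simps intro: ccontr sum.neutral)
    thus "U \<noteq> {}" using fp by (auto simp: U_def)
  qed
qed

section \<open>Newton identities and norms\<close>

text \<open>The reversed monic polynomial with roots \<open>r i\<close>; its coefficients are the
  signed elementary symmetric functions. As a power series it has a logarithmic derivative, which
  generates the power sums.\<close>

definition rev_prod :: "nat \<Rightarrow> (nat \<Rightarrow> complex) \<Rightarrow> complex fps" where
  "rev_prod s r = (\<Prod>i<s. 1 - fps_const (r i) * fps_X)"

lemma rev_prod_Suc: "rev_prod (Suc s) r = rev_prod s r - fps_const (r s) * (fps_X * rev_prod s r)"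
  by (simp add: rev_prod_def algebra_simps)

lemma rev_prod_0 [simp]: "rev_prod 0 r = 1"
  by (simp add: rev_prod_def)

lemma rev_prod_nth_0 [simp]: "fps_nth (rev_prod s r) 0 = 1"
  by (induction s) (simp_all add: rev_prod_Suc)

lemma rev_prod_Suc_nth:
  "fps_nth (rev_prod (Suc s) r) (Suc k) = fps_nth (rev_prod s r) (Suc k) - r s * fps_nth (rev_prod s r) k"
  by (simp add: rev_prod_Suc)

lemma rev_prod_nth_gt: "s < k \<Longrightarrow> fps_nth (rev_prod s r) k = 0"
proof (induction s arbitrary: k)
  case 0 thus ?case by (simp add: rev_prod_def)
next
  case (Suc s) thus ?case by (cases k) (auto simp: rev_prod_Suc_nth)
qed

lemma rev_prod_nth_top: "fps_nth (rev_prod s r) s = (-1) ^ s * (\<Prod>i<s. r i)"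
  by (induction s) (simp_all add: rev_prod_Suc_nth rev_prod_nth_gt)

lemma coeff_prod_linear:
  "j \<le> s \<Longrightarrow> coeff (\<Prod>i<s. [:- r i, 1:]) (s - j) = fps_nth (rev_prod s r) j"
proof (induction s arbitrary: j)
  case 0 thus ?case by (simp add: rev_prod_def)
next
  case (Suc s)
  have deg: "degree (\<Prod>i<s. [:- r i, 1:]) = s"
    by (subst degree_prod_eq_sum_degree) auto
  let ?P = "\<Prod>i<s. [:- r i, 1:]"
  have "coeff (\<Prod>i<Suc s. [:- r i, 1:]) k = (if k = 0 then 0 else coeff ?P (k - 1)) - r s * coeff ?P k" for k
    by (cases k) (simp_all add: mult.commute)
  hence *: "coeff (\<Prod>i<Suc s. [:- r i, 1:]) (Suc s - j) =
     (if Suc s - j = 0 then 0 else coeff ?P (Suc s - j - 1)) - r s * coeff ?P (Suc s - j)" .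
  show ?case
  proof (cases j)
    case 0
    have "coeff ?P s = 1" using Suc.IH[of 0] by simp
    thus ?thesis unfolding * using 0 deg coeff_eq_0[of ?P "Suc s"] by simp
  next
    case (Suc j')
    show ?thesis
    proof (cases "j = Suc s")
      case True
      thus ?thesis unfolding * using Suc.IH[of s] by (simp add: rev_prod_Suc_nth rev_prod_nth_gt)
    next
      case False
      hence j: "j \<le> s" using Suc.prems by simp
      have "Suc s - j - 1 = s - j" "Suc s - j = s - j'" using j Suc by auto
      thus ?thesis unfolding * using Suc.IH[of j] Suc.IH[of j'] j Suc by (simp add: rev_prod_Suc_nth)
    qed
  qed
qed

text \<open>Comparison of coefficients in \<open>R' = - R P\<close>, where \<open>P\<close>
  generates the power sums and is the sum of the geometric series belonging to the factors of
  \<open>R\<close>.\<close>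

lemma newton_identity:
  "of_nat (Suc k) * fps_nth (rev_prod s r) (Suc k) =
     - (\<Sum>j\<le>k. fps_nth (rev_prod s r) j * (\<Sum>i<s. r i ^ (Suc k - j)))"
proof -
  define P where "P s = Abs_fps (\<lambda>k. \<Sum>i<s. r i ^ Suc k)" for s
  have geo: "(1 - fps_const a * fps_X) * Abs_fps (\<lambda>k. a ^ Suc k) = fps_const a" for a :: complex
  proof (rule fps_ext)
    fix k show "fps_nth ((1 - fps_const a * fps_X) * Abs_fps (\<lambda>k. a ^ Suc k)) k = fps_nth (fps_const a) k"
      by (cases k) (simp_all add: left_diff_distrib mult.assoc)
  qed
  have "fps_deriv (rev_prod s r) = - (rev_prod s r * P s)"
  proof (induction s)
    case 0
    have "P 0 = 0" by (rule fps_ext) (simp add: P_def)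
    thus ?case by (simp add: rev_prod_def)
  next
    case (Suc s)
    let ?L = "1 - fps_const (r s) * fps_X"
    have 1: "rev_prod (Suc s) r = rev_prod s r * ?L" by (simp add: rev_prod_def)
    have 2: "P (Suc s) = P s + Abs_fps (\<lambda>k. r s ^ Suc k)"
      by (rule fps_ext) (simp add: P_def)
    have "rev_prod (Suc s) r * P (Suc s) = rev_prod s r * P s * ?L + rev_prod s r * (?L * Abs_fps (\<lambda>k. r s ^ Suc k))"
      unfolding 1 2 by (simp only: distrib_left mult_ac)
    also have "\<dots> = rev_prod s r * P s * ?L + rev_prod s r * fps_const (r s)" unfolding geo ..
    finally show ?case unfolding 1 using Suc by (simp add: algebra_simps)
  qed
  hence "fps_nth (fps_deriv (rev_prod s r)) k = fps_nth (- (rev_prod s r * P s)) k" by simp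
  thus ?thesis by (simp add: fps_mult_nth P_def Suc_diff_le atLeast0AtMost)
qed

section \<open>Power sums, norms and splitting of monic polynomials\<close>

fun psum_of_coeffs :: "(nat \<Rightarrow> complex) \<Rightarrow> nat \<Rightarrow> complex" where
  "psum_of_coeffs e 0 = 0"
| "psum_of_coeffs e (Suc k) =
     - of_nat (Suc k) * e (Suc k) - (\<Sum>j\<in>{1..k}. e j * psum_of_coeffs e (Suc k - j))"

fun coeffs_of_psum :: "(nat \<Rightarrow> complex) \<Rightarrow> nat \<Rightarrow> complex" where
  "coeffs_of_psum p 0 = 1"
| "coeffs_of_psum p (Suc k) = - (\<Sum>j\<le>k. coeffs_of_psum p j * p (Suc k - j)) / of_nat (Suc k)"

lemma psum_of_coeffs_correct:
  "k > 0 \<Longrightarrow> psum_of_coeffs (fps_nth (rev_prod s r)) k = (\<Sum>i<s. r i ^ k)"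
proof (induction k rule: less_induct)
  case (less k)
  then obtain m where k: "k = Suc m" by (cases k) auto
  have "(\<Sum>j\<le>m. fps_nth (rev_prod s r) j * (\<Sum>i<s. r i ^ (Suc m - j))) =
      (\<Sum>i<s. r i ^ Suc m) + (\<Sum>j\<in>{1..m}. fps_nth (rev_prod s r) j * (\<Sum>i<s. r i ^ (Suc m - j)))"
    by (subst atMost_atLeast0, subst sum.atLeast_Suc_atMost) auto
  moreover have "(\<Sum>j\<in>{1..m}. fps_nth (rev_prod s r) j * (\<Sum>i<s. r i ^ (Suc m - j))) =
      (\<Sum>j\<in>{1..m}. fps_nth (rev_prod s r) j * psum_of_coeffs (fps_nth (rev_prod s r)) (Suc m - j))"
    using less.IH k by (intro sum.cong refl) auto
  ultimately have "of_nat (Suc m) * fps_nth (rev_prod s r) (Suc m) = - ((\<Sum>i<s. r i ^ Suc m) +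
      (\<Sum>j\<in>{1..m}. fps_nth (rev_prod s r) j * psum_of_coeffs (fps_nth (rev_prod s r)) (Suc m - j)))"
    using newton_identity[of m s r] by (simp del: of_nat_Suc power_Suc)
  thus ?case unfolding k psum_of_coeffs.simps by (simp del: of_nat_Suc power_Suc)
qed

lemma coeffs_of_psum_correct:
  "coeffs_of_psum (\<lambda>k. \<Sum>i<s. r i ^ k) k = fps_nth (rev_prod s r) k"
proof (induction k rule: less_induct)
  case (less k)
  show ?case
  proof (cases k)
    case (Suc m)
    have "(\<Sum>j\<le>m. coeffs_of_psum (\<lambda>k. \<Sum>i<s. r i ^ k) j * (\<Sum>i<s. r i ^ (Suc m - j))) =
       (\<Sum>j\<le>m. fps_nth (rev_prod s r) j * (\<Sum>i<s. r i ^ (Suc m - j)))"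
      using less.IH Suc by (intro sum.cong) auto
    thus ?thesis using newton_identity[of m s r] unfolding Suc
      by (simp add: field_simps del: of_nat_Suc)
  qed simp
qed

lemma polyfun_psum_of_coeffs:
  assumes "\<And>j. polyfun I (\<lambda>x. e x j)" shows "polyfun I (\<lambda>x. psum_of_coeffs (e x) k)"
proof (induction k rule: less_induct)
  case (less k)
  show ?case
  proof (cases k)
    case (Suc m)
    show ?thesis unfolding Suc psum_of_coeffs.simps
      using less.IH Suc by (intro polyfun_intros assms) auto
  qed (simp add: polyfun_const)
qed

lemma polyfun_coeffs_of_psum:
  assumes "\<And>j. polyfun I (\<lambda>x. p x j)" shows "polyfun I (\<lambda>x. coeffs_of_psum (p x) k)"
proof (induction k rule: less_induct)
  case (less k)
  show ?case
  proof (cases k)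
    case (Suc m)
    show ?thesis unfolding Suc coeffs_of_psum.simps
      using less.IH Suc by (intro polyfun_intros assms) auto
  qed (simp add: polyfun_const)
qed

lemma poly_eq_sum_bound:
  fixes P :: "complex poly"
  assumes "degree P \<le> m" shows "poly P x = (\<Sum>k\<le>m. coeff P k * x ^ k)"
  unfolding poly_altdef using assms by (intro sum.mono_neutral_left) (auto simp: coeff_eq_0)

text \<open>The product of the values \<open>B(r i)\<close> over the roots of a monic polynomial is
  a resultant, hence polynomial in all coefficients. Here it comes from power sums instead of a
  determinant: those of the \<open>r i\<close> from the coefficients, those of the
  \<open>B(r i)\<close> by expanding powers of \<open>B\<close>, and the product as the last
  elementary symmetric function of the \<open>B(r i)\<close>.\<close>

lemma polyfun_norm:
  assumes a: "\<And>k. k < s \<Longrightarrow> polyfun I (a k)" and b: "\<And>k. polyfun I (b k)"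
  obtains G where "polyfun I G" "\<And>x r. (\<And>T. T ^ s + (\<Sum>k<s. a k x * T ^ k) = (\<Prod>i<s. T - r i)) \<Longrightarrow>
     G x = (\<Prod>i<s. \<Sum>k\<le>m. b k x * r i ^ k)"
proof -
  define e where "e x j = (if j = 0 then 1 else if j \<le> s then a (s - j) x else 0)" for x j
  define B where "B x = (\<Sum>k\<le>m. monom (b k x) k)" for x
  \<comment> \<open>\<open>p x j\<close> is to be the sum of the powers \<open>B(r i)^j\<close>.
    \<open>psum_of_coeffs\<close> is correct for positive exponents only, so \<open>K = 0\<close> is
    given the number \<open>s\<close> of roots.\<close>
  define p where "p x j = (\<Sum>K\<le>m * j. coeff (B x ^ j) K * (if K = 0 then of_nat s else psum_of_coeffs (e x) K))" for x j
  define G where "G x = (-1) ^ s * coeffs_of_psum (p x) s" for x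
  have pe: "polyfun I (\<lambda>x. e x j)" for j
    unfolding e_def using a by (cases "j = 0"; cases "j \<le> s") (auto intro: polyfun_const)
  have pB1: "polyfun I (\<lambda>x. coeff (B x) K)" for K
  proof -
    have "coeff (B x) K = (if K \<le> m then b K x else 0)" for x by (simp add: B_def coeff_sum)
    thus ?thesis using b by (cases "K \<le> m") (auto intro: polyfun_const)
  qed
  have pB: "polyfun I (\<lambda>x. coeff (B x ^ j) K)" for j K
  proof (induction j arbitrary: K)
    case 0
    thus ?case by (cases "K = 0") (auto intro: polyfun_const)
  next
    case (Suc j)
    show ?case unfolding power_Suc coeff_mult by (intro polyfun_intros pB1 Suc)
  qed
  have pp: "polyfun I (\<lambda>x. p x j)" for j
    unfolding p_def
  proof (intro polyfun_sum polyfun_mult pB)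
    fix K show "polyfun I (\<lambda>x. if K = 0 then of_nat s else psum_of_coeffs (e x) K)"
      by (cases "K = 0") (auto intro: polyfun_const polyfun_psum_of_coeffs pe)
  qed
  show ?thesis
  proof
    show "polyfun I G" unfolding G_def by (intro polyfun_intros polyfun_coeffs_of_psum pp)
  next
    fix x r assume T: "\<And>T. T ^ s + (\<Sum>k<s. a k x * T ^ k) = (\<Prod>i<s. T - r i)"
    have "poly (monom 1 s + (\<Sum>k<s. monom (a k x) k)) = poly (\<Prod>i<s. [:- r i, 1:])"
      using T by (intro ext) (simp add: poly_sum poly_prod poly_monom)
    hence eq: "monom 1 s + (\<Sum>k<s. monom (a k x) k) = (\<Prod>i<s. [:- r i, 1:])"
      by (simp add: poly_eq_poly_eq_iff)
    have ex: "e x = fps_nth (rev_prod s r)"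
    proof
      fix j show "e x j = fps_nth (rev_prod s r) j"
      proof (cases "j \<le> s")
        case True
        have "coeff (monom 1 s + (\<Sum>k<s. monom (a k x) k)) (s - j) = e x j"
          using True by (cases "j = 0") (auto simp: coeff_sum e_def)
        thus ?thesis unfolding eq using coeff_prod_linear[OF True, of r] by simp
      next
        case False thus ?thesis by (simp add: e_def rev_prod_nth_gt)
      qed
    qed
    define v where "v i = (\<Sum>k\<le>m. b k x * r i ^ k)" for i
    have v: "v i = poly (B x) (r i)" for i by (simp add: v_def B_def poly_sum poly_monom)
    have "p x = (\<lambda>j. \<Sum>i<s. v i ^ j)"
    proof
      fix j
      have "degree (B x) \<le> m"
        unfolding B_def by (intro degree_sum_le) (auto intro: order.trans[OF degree_monom_le])
      hence deg: "degree (B x ^ j) \<le> m * j"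
        by (meson degree_power_le dual_order.trans mult_le_mono1)
      have "(\<Sum>i<s. v i ^ j) = (\<Sum>i<s. poly (B x ^ j) (r i))" by (simp add: v)
      also have "\<dots> = (\<Sum>i<s. \<Sum>K\<le>m * j. coeff (B x ^ j) K * r i ^ K)"
        by (intro sum.cong refl poly_eq_sum_bound deg)
      also have "\<dots> = (\<Sum>K\<le>m * j. coeff (B x ^ j) K * (\<Sum>i<s. r i ^ K))"
        by (subst sum.swap) (simp add: sum_distrib_left)
      also have "\<dots> = p x j"
        unfolding p_def ex by (intro sum.cong refl) (auto simp: psum_of_coeffs_correct)
      finally show "p x j = (\<Sum>i<s. v i ^ j)" by simp
    qed
    hence "G x = (-1) ^ s * ((-1) ^ s * (\<Prod>i<s. v i))"
      unfolding G_def by (simp add: coeffs_of_psum_correct rev_prod_nth_top)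
    also have "\<dots> = (\<Prod>i<s. v i)" by (simp flip: mult.assoc power_add power_mult_distrib)
    finally show "G x = (\<Prod>i<s. \<Sum>k\<le>m. b k x * r i ^ k)" by (simp add: v_def)
  qed
qed

text \<open>Evaluation over univariate polynomials, with the coordinate \<open>v\<close> sent to the
  indeterminate, isolates the dependence on \<open>v\<close>; the degree bound is uniform in the
  other coordinates.\<close>

lemma polyfun_slice:
  assumes "polyfun I F"
  obtains b m where "\<And>k. polyfun I (b k)" "\<And>x T. F (x(v := T)) = (\<Sum>k\<le>m. b k x * T ^ k)"
proof -
  let ?h = "\<lambda>a. [:a:] :: complex poly" let ?y = "\<lambda>x i. if i = v then [:0, 1:] else [:x i:]"
  have hom: "ring_hom_c ?h" by (simp add: ring_hom_c_def one_pCons)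
  obtain p where p: "p \<in> polys I" "\<And>x. F x = evc x p" using assms by (auto simp: polyfun_def)
  have "(\<exists>m. \<forall>x. degree (ev ?h (?y x) p) \<le> m) \<and> (\<forall>k. polyfun I (\<lambda>x. coeff (ev ?h (?y x) p) k))"
    using p(1)
  proof (induction p rule: polys_induct)
    case (cst c)
    thus ?case by (auto simp: ev_simps hom intro: polyfun_const)
  next
    case (var i)
    have "polyfun I (\<lambda>x. coeff [:x i:] k)" for k
      using var by (cases k) (auto intro: polyfun_intros)
    moreover have "\<exists>m. \<forall>x. degree (?y x i) \<le> m" by (rule exI[of _ 1]) auto
    moreover have "polyfun I (\<lambda>x. coeff (?y x i) k)" for k
      using calculation(1) by (cases "i = v") (auto intro: polyfun_const)
    ultimately show ?case by (auto simp: ev_simps hom)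
  next
    case (add p q)
    then obtain m m' where "\<And>x. degree (ev ?h (?y x) p) \<le> m" "\<And>x. degree (ev ?h (?y x) q) \<le> m'" by blast
    hence "\<forall>x. degree (ev ?h (?y x) p + ev ?h (?y x) q) \<le> max m m'"
      by (meson degree_add_le max.cobounded1 max.cobounded2 order.trans)
    thus ?case using add by (auto simp: ev_simps hom intro: polyfun_add)
  next
    case (mult p q)
    then obtain m m' where "\<And>x. degree (ev ?h (?y x) p) \<le> m" "\<And>x. degree (ev ?h (?y x) q) \<le> m'" by blast
    hence "\<forall>x. degree (ev ?h (?y x) p * ev ?h (?y x) q) \<le> m + m'"
      by (meson add_mono degree_mult_le order.trans)
    thus ?case using mult by (auto simp: ev_simps hom coeff_mult intro!: polyfun_sum polyfun_mult)
  qed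
  then obtain m where m: "\<And>x. degree (ev ?h (?y x) p) \<le> m" "\<And>k. polyfun I (\<lambda>x. coeff (ev ?h (?y x) p) k)"
    by blast
  have "F (x(v := T)) = (\<Sum>k\<le>m. coeff (ev ?h (?y x) p) k * T ^ k)" for x T
  proof -
    have "poly (ev ?h (?y x) p) T = evc (\<lambda>i. poly (?y x i) T) p"
      by (rule ev_ev[where g = "\<lambda>a. a"]) (auto simp: hom)
    also have "(\<lambda>i. poly (?y x i) T) = x(v := T)" by auto
    finally have "poly (ev ?h (?y x) p) T = evc (x(v := T)) p" .
    thus ?thesis unfolding p(2) poly_eq_sum_bound[OF m(1)] by (rule sym)
  qed
  thus ?thesis by (intro that[OF m(2)])
qed

lemma monic_splits:
  fixes P :: "complex poly"
  assumes "degree P = s" "lead_coeff P = 1"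
  shows "\<exists>r. P = (\<Prod>i<s. [:- r i, 1:])"
  using assms
proof (induction s arbitrary: P)
  case 0
  then obtain c where "P = [:c:]" by (auto elim: degree_eq_zeroE)
  thus ?case using 0 by (simp add: one_pCons)
next
  case (Suc s)
  then obtain t where "poly P t = 0"
    using fundamental_theorem_of_algebra[of P] constant_degree[of P] by auto
  then obtain Q where Q: "P = [:- t, 1:] * Q" unfolding poly_eq_0_iff_dvd by (auto elim: dvdE)
  have "Q \<noteq> 0" using Suc.prems(2) Q by auto
  have "degree P = degree [:- t, 1:] + degree Q" unfolding Q by (rule degree_mult_eq) (use \<open>Q \<noteq> 0\<close> in auto)
  hence "degree Q = s" using Suc.prems by simp
  moreover have "lead_coeff Q = 1" using Suc.prems(2) unfolding Q lead_coeff_mult by simp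
  ultimately obtain r where r: "Q = (\<Prod>i<s. [:- r i, 1:])" using Suc.IH by blast
  have "(\<Prod>i<s. [:- (r(s := t)) i, 1:]) = (\<Prod>i<s. [:- r i, 1:])"
    by (intro prod.cong) auto
  hence "P = (\<Prod>i<Suc s. [:- (r(s := t)) i, 1:])"
    unfolding Q r by (simp add: mult.commute del: mult_pCons_left mult_pCons_right)
  thus ?case by blast
qed

section \<open>Restriction to lines\<close>

text \<open>Coefficient of order \<open>k\<close> in \<open>T\<close> of the monomial \<alpha> on
  the line \<open>T p - q\<close>. The restriction of a form to the line has coefficients linear in
  the form, with these weights.\<close>

definition line_coeff :: "('w \<Rightarrow> complex) \<Rightarrow> ('w \<Rightarrow> complex) \<Rightarrow> ('w \<Rightarrow>\<^sub>0 nat) \<Rightarrow> nat \<Rightarrow> complex" where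
  "line_coeff p q \<alpha> k = coeff (mev (\<lambda>i. [:- q i, p i:]) \<alpha>) k"

lemma coeff_mult_top:
  assumes "degree p \<le> a" "degree q \<le> b"
  shows "coeff (p * q) (a + b) = coeff p a * coeff q b"
proof -
  have "coeff (p * q) (a + b) = (\<Sum>i\<le>a + b. if i = a then coeff p a * coeff q b else 0)"
    unfolding coeff_mult
  proof (intro sum.cong refl)
    fix i assume "i \<in> {..a + b}"
    consider "i = a" | "i < a" | "i > a" by linarith
    thus "coeff p i * coeff q (a + b - i) = (if i = a then coeff p a * coeff q b else 0)"
      using assms by cases (auto simp: coeff_eq_0)
  qed
  thus ?thesis by simp
qed

lemma mev_line:
  fixes p q :: "'w \<Rightarrow> complex"
  shows "degree (mev (\<lambda>i. [:- q i, p i:]) \<alpha>) \<le> mdeg \<alpha>" (is ?A)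
    and "coeff (mev (\<lambda>i. [:- q i, p i:]) \<alpha>) (mdeg \<alpha>) = mev p \<alpha>" (is ?B)
    and "poly (mev (\<lambda>i. [:- q i, p i:]) \<alpha>) T = mev (\<lambda>i. T * p i - q i) \<alpha>" (is ?C)
proof -
  let ?f = "\<lambda>i. [:- q i, p i:]"
  have pw: "degree (?f i ^ k) \<le> k \<and> coeff (?f i ^ k) k = p i ^ k" for i k
  proof (induction k)
    case (Suc k)
    have "degree (?f i ^ Suc k) \<le> 1 + k"
      unfolding power_Suc using Suc by (intro order.trans[OF degree_mult_le add_mono]) auto
    moreover have "coeff (?f i * ?f i ^ k) (1 + k) = coeff (?f i) 1 * coeff (?f i ^ k) k"
      by (rule coeff_mult_top) (use Suc in auto)
    ultimately show ?case using Suc by simp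
  qed simp
  have pr: "degree (\<Prod>i\<in>A. ?f i ^ g i) \<le> sum g A \<and> coeff (\<Prod>i\<in>A. ?f i ^ g i) (sum g A) = (\<Prod>i\<in>A. p i ^ g i)"
    if "finite A" for A and g :: "'w \<Rightarrow> nat"
    using that
  proof (induction A rule: finite_induct)
    case (insert a A)
    have "degree (?f a ^ g a * (\<Prod>i\<in>A. ?f i ^ g i)) \<le> g a + sum g A"
      using insert pw by (intro order.trans[OF degree_mult_le add_mono]) auto
    moreover have "coeff (?f a ^ g a * (\<Prod>i\<in>A. ?f i ^ g i)) (g a + sum g A) =
        coeff (?f a ^ g a) (g a) * coeff (\<Prod>i\<in>A. ?f i ^ g i) (sum g A)"
      by (rule coeff_mult_top) (use insert pw in auto)
    ultimately show ?case using insert pw by simp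
  qed simp
  show ?A ?B using pr[of "ks \<alpha>" "lk \<alpha>"] by (auto simp: mev_def mdeg_def)
  show ?C by (simp add: mev_def poly_prod poly_power mult.commute)
qed

section \<open>The variety of decomposable forms is closed\<close>

lemma cst_eq_0_iff [simp]: "cst c = 0 \<longleftrightarrow> c = 0"
  by (metis cst_0 cst_def lookup_single_eq lookup_zero)

text \<open>Substitutes \<open>y / l(y)\<close> and clears denominators. Used with
  \<open>l(D) = D(p)\<close>, this transfers equations known for \<open>D(p) = 1\<close> to all
  \<open>D\<close>; one surplus factor \<open>l\<close> in every summand takes care of
  \<open>D(p) = 0\<close>.\<close>

lemma homogenize_at:
  assumes g: "g \<in> polys I" and l: "l \<in> polys I"
  obtains g' K where "g' \<in> polys I" "\<And>y. evc y l = 0 \<Longrightarrow> evc y g' = 0"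
    "\<And>y. evc y l \<noteq> 0 \<Longrightarrow> evc y g' = evc y l ^ K * evc (\<lambda>i. y i / evc y l) g"
proof -
  define K where "K = tdeg g"
  define g' where "g' = (\<Sum>m\<le>K. l ^ (K + 1 - m) * homc m g)"
  show ?thesis
  proof (rule that[of g' "K + 1"])
    show "g' \<in> polys I" unfolding g'_def
      by (intro polys_intros l forms_polys[OF homc_forms[OF g]])
    show "evc y g' = 0" if "evc y l = 0" for y
      unfolding g'_def using that by (auto simp: ev_simps Suc_diff_le intro!: sum.neutral)
    show "evc y g' = evc y l ^ (K + 1) * evc (\<lambda>i. y i / evc y l) g" if ne: "evc y l \<noteq> 0" for y
    proof -
      have "evc (\<lambda>i. y i / evc y l) g = evc (\<lambda>i. (1 / evc y l) * y i) (\<Sum>m\<le>K. homc m g)"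
        by (simp add: homc_sum_le K_def)
      also have "\<dots> = (\<Sum>m\<le>K. (1 / evc y l) ^ m * evc y (homc m g))"
        by (simp only: ev_sum[OF ring_hom_c_id(1)] ev_scale_form[OF ring_hom_c_id(1) homc_forms[OF g]])
      finally have "evc y l ^ (K + 1) * evc (\<lambda>i. y i / evc y l) g =
          (\<Sum>m\<le>K. evc y l ^ (K + 1) * (1 / evc y l) ^ m * evc y (homc m g))"
        by (simp add: sum_distrib_left mult_ac)
      also have "\<dots> = (\<Sum>m\<le>K. evc y l ^ (K + 1 - m) * evc y (homc m g))"
        using ne by (intro sum.cong) (auto simp: power_diff power_divide divide_simps simp del: power_Suc)
      finally show ?thesis by (simp add: g'_def ev_simps)
    qed
  qed
qed

lemma evc_form_expand:
  assumes "finite I" "D \<in> forms I s"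
  shows "evc y D = (\<Sum>\<alpha>\<in>monomials I s. lk D \<alpha> * mev y \<alpha>)"
  using assms by (intro ev_superset) (auto simp: forms_def)

lemma linear_form_evc:
  assumes "l \<in> forms I 1"
  shows "evc (\<lambda>i. a * x i + b * y i) l = a * evc x l + b * evc y l"
proof -
  have "mev (\<lambda>i. a * x i + b * y i) \<alpha> = a * mev x \<alpha> + b * mev y \<alpha>" if "\<alpha> \<in> ks l" for \<alpha>
  proof -
    have "mdeg \<alpha> = 1" using that assms by (auto simp: forms_def in_monomials)
    hence s: "sum (lk \<alpha>) (ks \<alpha>) = 1" by (simp add: mdeg_def)
    then obtain j where j: "j \<in> ks \<alpha>" by (metis sum.empty ex_in_conv zero_neq_one)
    have "sum (lk \<alpha>) (ks \<alpha>) = lk \<alpha> j + sum (lk \<alpha>) (ks \<alpha> - {j})" using j by (simp add: sum.remove)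
    moreover have "lk \<alpha> j \<noteq> 0" using j by (simp add: in_keys_iff)
    ultimately have 1: "lk \<alpha> j = 1" "sum (lk \<alpha>) (ks \<alpha> - {j}) = 0" using s by linarith+
    hence "\<forall>i\<in>ks \<alpha> - {j}. lk \<alpha> i = 0" by simp
    hence "ks \<alpha> = {j}" using j by (auto simp: in_keys_iff simp del: lookup_not_eq_zero_eq_in_keys)
    thus ?thesis using 1 by (simp add: mev_def)
  qed
  thus ?thesis by (simp add: ev_def sum_distrib_left algebra_simps flip: sum.distrib cong: sum.cong)
qed

lemma linear_form_evc_diff:
  "l \<in> forms I 1 \<Longrightarrow> evc (\<lambda>i. a * x i - y i) l = a * evc x l - evc y l"
  using linear_form_evc[of l I a x "-1" y] by simp

lemma linear_form_evc_unit:
  assumes "finite I" "l \<in> forms I 1" "j \<in> I"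
  shows "evc (\<lambda>i. if i = j then 1 else 0) l = lk l (sg j 1)"
proof -
  have "evc (\<lambda>i. if i = j then 1 else 0) l =
      evc (\<lambda>i. if i = j then 1 else 0) (\<Sum>j\<in>I. cst (lk l (sg j 1)) * var j)"
    using linear_form_expand[OF assms(1,2)] by simp
  thus ?thesis using assms(1,3) by (simp add: ev_simps if_distrib cong: if_cong)
qed

text \<open>In the unknown \<open>c\<close> the conditions are nonvanishing of finitely many nonzero
  linear forms, whose product is a nonzero polynomial.\<close>

lemma nonzero_functional:
  fixes W :: "(('k::linorder) \<Rightarrow> complex) set"
  assumes "finite W" "finite A" "\<And>w. w \<in> W \<Longrightarrow> \<exists>\<alpha>\<in>A. w \<alpha> \<noteq> 0"
  obtains c where "\<And>w. w \<in> W \<Longrightarrow> (\<Sum>\<alpha>\<in>A. c \<alpha> * w \<alpha>) \<noteq> 0"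
proof -
  define P where "P = (\<Prod>w\<in>W. \<Sum>\<alpha>\<in>A. cst (w \<alpha>) * var \<alpha>)"
  have "(\<Sum>\<alpha>\<in>A. cst (w \<alpha>) * var \<alpha>) \<noteq> 0" if w: "w \<in> W" for w
  proof -
    obtain \<beta> where b: "\<beta> \<in> A" "w \<beta> \<noteq> 0" using assms(3)[OF w] by blast
    have "lk (\<Sum>\<alpha>\<in>A. cst (w \<alpha>) * var \<alpha>) (sg \<beta> 1) = (\<Sum>\<alpha>\<in>A. if \<alpha> = \<beta> then w \<beta> else 0)"
      unfolding lookup_sum by (intro sum.cong) (auto simp: var_def lookup_single when_def)
    also have "\<dots> = w \<beta>" using b(1) assms(2) by simp
    finally show ?thesis using b(2) by auto
  qed
  hence "P \<noteq> 0" using assms(1) by (simp add: P_def)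
  then obtain c where "evc c P \<noteq> 0" using poly_nonvanishing_point by blast
  hence "\<And>w. w \<in> W \<Longrightarrow> (\<Sum>\<alpha>\<in>A. c \<alpha> * w \<alpha>) \<noteq> 0"
    using assms(1) by (auto simp: P_def ev_simps mult.commute)
  thus ?thesis using that by blast
qed

text \<open>Evaluation with the coefficients given as a plain function, so that \<open>D\<close> can
  be the argument of a polynomial function.\<close>

definition val_at :: "nat \<Rightarrow> nat \<Rightarrow> (nat \<Rightarrow> complex) \<Rightarrow> ((nat \<Rightarrow>\<^sub>0 nat) \<Rightarrow> complex) \<Rightarrow> complex" where
  "val_at n s y D = (\<Sum>\<alpha>\<in>monomials {..n} s. D \<alpha> * mev y \<alpha>)"

lemma val_at_form: "D \<in> forms {..n} s \<Longrightarrow> val_at n s y (lk D) = evc y D"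
  using evc_form_expand[of "{..n}" D s y] by (simp add: val_at_def)

text \<open>The leading coefficient on the line is \<open>D(p)\<close>, so the normalisation makes
  the restriction monic.\<close>

lemma val_at_line:
  assumes "val_at n s p D = 1"
  shows "val_at n s (\<lambda>i. T * p i - q i) D =
    T ^ s + (\<Sum>k<s. (\<Sum>\<alpha>\<in>monomials {..n} s. D \<alpha> * line_coeff p q \<alpha> k) * T ^ k)"
proof -
  have "val_at n s (\<lambda>i. T * p i - q i) D = (\<Sum>\<alpha>\<in>monomials {..n} s. \<Sum>k\<le>s. D \<alpha> * line_coeff p q \<alpha> k * T ^ k)"
    unfolding val_at_def
  proof (intro sum.cong refl)
    fix \<alpha> assume "\<alpha> \<in> monomials {..n} s"
    hence "degree (mev (\<lambda>i. [:- q i, p i:]) \<alpha>) \<le> s" using mev_line(1)[of q p \<alpha>] by (simp add: in_monomials)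
    from poly_eq_sum_bound[OF this, of T]
    show "D \<alpha> * mev (\<lambda>i. T * p i - q i) \<alpha> = (\<Sum>k\<le>s. D \<alpha> * line_coeff p q \<alpha> k * T ^ k)"
      by (simp add: mev_line(3) line_coeff_def sum_distrib_left mult_ac)
  qed
  also have "\<dots> = (\<Sum>k\<le>s. (\<Sum>\<alpha>\<in>monomials {..n} s. D \<alpha> * line_coeff p q \<alpha> k) * T ^ k)"
    by (subst sum.swap) (simp add: sum_distrib_right)
  also have "\<dots> = (\<Sum>k<s. (\<Sum>\<alpha>\<in>monomials {..n} s. D \<alpha> * line_coeff p q \<alpha> k) * T ^ k)
      + (\<Sum>\<alpha>\<in>monomials {..n} s. D \<alpha> * line_coeff p q \<alpha> s) * T ^ s"
    by (simp flip: lessThan_Suc_atMost)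
  also have "(\<Sum>\<alpha>\<in>monomials {..n} s. D \<alpha> * line_coeff p q \<alpha> s) = val_at n s p D"
    unfolding val_at_def
  proof (intro sum.cong refl)
    fix \<alpha> assume "\<alpha> \<in> monomials {..n} s"
    thus "D \<alpha> * line_coeff p q \<alpha> s = D \<alpha> * mev p \<alpha>"
      using mev_line(2)[of q p \<alpha>] by (auto simp: line_coeff_def in_monomials)
  qed
  finally show ?thesis using assms by simp
qed

lemma val_at_line_splits:
  assumes "val_at n s p D = 1"
  shows "\<exists>r. \<forall>T. val_at n s (\<lambda>i. T * p i - q i) D = (\<Prod>i<s. T - r i)"
proof -
  define a where "a k = (\<Sum>\<alpha>\<in>monomials {..n} s. D \<alpha> * line_coeff p q \<alpha> k)" for k
  define P where "P = monom 1 s + (\<Sum>k<s. monom (a k) k)"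
  have co: "coeff P k = (if k = s then 1 else if k < s then a k else 0)" for k
    by (auto simp: P_def coeff_sum)
  have deg: "degree P = s"
    by (intro antisym degree_le le_degree) (auto simp: co)
  obtain r where r: "P = (\<Prod>i<s. [:- r i, 1:])"
    using monic_splits[OF deg] by (auto simp: co deg)
  have "val_at n s (\<lambda>i. T * p i - q i) D = poly P T" for T
    unfolding val_at_line[OF assms] by (simp add: P_def poly_sum poly_monom a_def)
  thus ?thesis unfolding r by (intro exI[of _ r]) (simp add: poly_prod)
qed

lemma decomposable_scale:
  assumes "D \<in> decomposable_variety n s" "c \<noteq> 0" "s > 0"
  shows "cst c * D \<in> decomposable_variety n s"
proof -
  obtain L where L: "D \<noteq> 0" "\<And>i. i < s \<Longrightarrow> L i \<in> forms {..n} 1" "D = (\<Prod>i<s. L i)"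
    using assms(1) by (auto simp: decomposable_variety_def)
  define L' where "L' = L(0 := cst c * L 0)"
  have "(\<Prod>i<s. L' i) = L' 0 * (\<Prod>i\<in>{..<s} - {0}. L' i)"
    using assms(3) by (intro prod.remove) auto
  also have "(\<Prod>i\<in>{..<s} - {0}. L' i) = (\<Prod>i\<in>{..<s} - {0}. L i)" by (intro prod.cong) (auto simp: L'_def)
  also have "L' 0 * \<dots> = cst c * (\<Prod>i<s. L i)"
    using assms(3) prod.remove[of "{..<s}" 0 L] by (simp add: L'_def mult.assoc)
  finally have "cst c * D = (\<Prod>i<s. L' i)" using L(3) by simp
  moreover have "\<forall>i<s. L' i \<in> forms {..n} 1" using L(2) assms(3) by (auto simp: L'_def intro: forms_cst_mult)
  moreover have "cst c * D \<noteq> 0" using L(1) assms(2) by simp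
  ultimately show ?thesis unfolding decomposable_variety_def by blast
qed

lemma decomposable_forms: "D \<in> decomposable_variety n s \<Longrightarrow> D \<in> forms {..n} s"
  using forms_prod[of "{..<s}" _ "{..n}"] by (force simp: decomposable_variety_def)

text \<open>Dividing each factor by its value at \<open>p\<close> does not change the product, since
  these values multiply to 1.\<close>

lemma decomposable_normalized:
  assumes "D \<in> decomposable_variety n s" "evc p D = 1"
  obtains M where "\<And>i. i < s \<Longrightarrow> M i \<in> forms {..n} 1" "\<And>i. i < s \<Longrightarrow> evc p (M i) = 1" "D = (\<Prod>i<s. M i)"
proof -
  obtain L where L: "D \<noteq> 0" "\<And>i. i < s \<Longrightarrow> L i \<in> forms {..n} 1" "D = (\<Prod>i<s. L i)"
    using assms(1) by (auto simp: decomposable_variety_def)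
  have e: "(\<Prod>i<s. evc p (L i)) = 1" using assms(2) L(3) by (simp add: ev_simps)
  hence ne: "evc p (L i) \<noteq> 0" if "i < s" for i using that by (metis finite_lessThan lessThan_iff prod_zero_iff zero_neq_one)
  define M where "M i = cst (1 / evc p (L i)) * L i" for i
  have "(\<Prod>i<s. M i) = cst (\<Prod>i<s. 1 / evc p (L i)) * D"
  proof -
    have pc: "(\<Prod>i\<in>A. cst (f i)) = cst (\<Prod>i\<in>A. f i)" for A :: "nat set" and f :: "nat \<Rightarrow> complex"
      by (induction A rule: infinite_finite_induct) (simp_all add: cst_mult)
    show ?thesis unfolding M_def prod.distrib pc L(3) ..
  qed
  hence "D = (\<Prod>i<s. M i)" using e by (simp add: prod_dividef)
  thus ?thesis using L(2) ne by (intro that[of M]) (auto simp: M_def ev_simps intro: forms_cst_mult)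
qed

text \<open>If \<open>D(p) = 1\<close> and the factors of \<open>D\<close> take the value \<open>1\<close> at \<open>p\<close>, their \<open>j\<close>-th coefficients are roots
  of the monic polynomial \<open>D(T p - e\<^sub>j)\<close>. This leaves finitely many candidates for the factors, and taking
  norms eliminates their coefficients one at a time.\<close>

theorem decomposable_closed:
  assumes s: "s > 0" and D0: "D0 \<in> forms {..n} s" "D0 \<noteq> 0"
    and van: "\<And>g. g \<in> vanishing_ideal (monomials {..n} s) (decomposable_variety n s) \<Longrightarrow> evc (lk D0) g = 0"
  shows "D0 \<in> decomposable_variety n s"
proof (rule ccontr)
  assume nd: "D0 \<notin> decomposable_variety n s"
  let ?mon = "monomials {..n} s"
  obtain p where p: "evc p D0 \<noteq> 0" using poly_nonvanishing_point[OF D0(2)] by blast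
  define D1 where "D1 = cst (1 / evc p D0) * D0"
  have D1: "D1 \<in> forms {..n} s" "evc p D1 = 1"
    using D0 p by (auto simp: D1_def ev_simps intro: forms_cst_mult)
  have nd1: "D1 \<notin> decomposable_variety n s"
  proof
    assume "D1 \<in> decomposable_variety n s"
    from decomposable_scale[OF this p s] have "cst (evc p D0) * D1 \<in> decomposable_variety n s" .
    moreover have "cst (evc p D0) * D1 = D0"
      using p by (simp add: D1_def flip: mult.assoc cst_mult)
    ultimately show False using nd by simp
  qed
  define U :: "(nat \<times> nat) set" where "U = {..<s} \<times> {..n}"
  \<comment> \<open>\<open>Inl\<close> coordinates are the coefficients of \<open>D\<close>;
    \<open>Inr (i, j)\<close> is the unknown coefficient of \<open>var j\<close> in the factor of
    index \<open>i\<close>.\<close>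
  define I :: "((nat \<Rightarrow>\<^sub>0 nat) + nat \<times> nat) set" where "I = Inl ` ?mon \<union> Inr ` U"
  define Dv where "Dv x y = val_at n s y (x \<circ> Inl)" for x :: "(nat \<Rightarrow>\<^sub>0 nat) + nat \<times> nat \<Rightarrow> complex" and y
  define e :: "nat \<Rightarrow> nat \<Rightarrow> complex" where "e j i = (if i = j then 1 else 0)" for i j
  define root where "root x v \<longleftrightarrow> Dv x (\<lambda>i. x (Inr v) * p i - e (snd v) i) = 0" for x v
  \<comment> \<open>Elimination of the unknowns in \<open>S\<close>: a zero of \<open>Q\<close>
    means a zero of \<open>P\<close> for some choice of roots. To remove one more unknown, the
    previous \<open>Q\<close> is multiplied over all candidates for it, which is a norm.\<close>
  have elim: "\<exists>Q. polyfun I Q \<and> (\<forall>x. Dv x p = 1 \<longrightarrow>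
      (Q x = 0 \<longleftrightarrow> (\<exists>u. (\<forall>v. v \<notin> Inr ` S \<longrightarrow> u v = x v) \<and> (\<forall>v\<in>S. root u v) \<and> P u = 0)))"
    if "finite S" "S \<subseteq> U" "polyfun I P" for S P
    using that
  proof (induction S rule: finite_induct)
    case empty
    have "(\<exists>u. (\<forall>v. u v = x v) \<and> P u = 0) \<longleftrightarrow> P x = 0" for x
    proof
      assume "\<exists>u. (\<forall>v. u v = x v) \<and> P u = 0"
      then obtain u where "\<forall>v. u v = x v" "P u = 0" by blast
      hence "u = x" by auto
      thus "P x = 0" using \<open>P u = 0\<close> by simp
    qed auto
    thus ?case using empty by auto
  next
    case (insert w S)
    then obtain Q where Q: "polyfun I Q" "\<And>x. Dv x p = 1 \<Longrightarrow>
      Q x = 0 \<longleftrightarrow> (\<exists>u. (\<forall>v. v \<notin> Inr ` S \<longrightarrow> u v = x v) \<and> (\<forall>v\<in>S. root u v) \<and> P u = 0)"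
      by auto
    have wU: "Inr w \<in> I" using insert.prems by (auto simp: I_def)
    obtain b m where b: "\<And>k. polyfun I (b k)" "\<And>x T. Q (x(Inr w := T)) = (\<Sum>k\<le>m. b k x * T ^ k)"
      using polyfun_slice[OF Q(1)] by blast
    define a where "a k x = (\<Sum>\<alpha>\<in>?mon. (x \<circ> Inl) \<alpha> * line_coeff p (e (snd w)) \<alpha> k)"
      for k and x :: "(nat \<Rightarrow>\<^sub>0 nat) + nat \<times> nat \<Rightarrow> complex"
    have a: "polyfun I (a k)" for k
      unfolding a_def o_def by (intro polyfun_intros) (auto simp: I_def)
    obtain G where G: "polyfun I G" "\<And>x r. (\<And>T. T ^ s + (\<Sum>k<s. a k x * T ^ k) = (\<Prod>i<s. T - r i)) \<Longrightarrow>
       G x = (\<Prod>i<s. \<Sum>k\<le>m. b k x * r i ^ k)"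
      using polyfun_norm[of s I a b m, OF a b(1)] by blast
    have "G x = 0 \<longleftrightarrow> (\<exists>u. (\<forall>v. v \<notin> Inr ` insert w S \<longrightarrow> u v = x v) \<and> (\<forall>v\<in>insert w S. root u v) \<and> P u = 0)"
      if x: "Dv x p = 1" for x
    proof -
      have x1: "val_at n s p (x \<circ> Inl) = 1" using x by (simp add: Dv_def)
      obtain r where r: "\<And>T. val_at n s (\<lambda>i. T * p i - e (snd w) i) (x \<circ> Inl) = (\<Prod>i<s. T - r i)"
        using val_at_line_splits[OF x1] by blast
      have "G x = (\<Prod>i<s. \<Sum>k\<le>m. b k x * r i ^ k)"
        by (rule G(2)) (use r val_at_line[OF x1] in \<open>simp add: a_def\<close>)
      also have "\<dots> = (\<Prod>i<s. Q (x(Inr w := r i)))" by (simp add: b(2))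
      finally have "G x = 0 \<longleftrightarrow> (\<exists>i<s. Q (x(Inr w := r i)) = 0)" by auto
      also have "\<dots> \<longleftrightarrow> (\<exists>T. val_at n s (\<lambda>i. T * p i - e (snd w) i) (x \<circ> Inl) = 0 \<and> Q (x(Inr w := T)) = 0)"
        unfolding r by auto
      also have "\<dots> \<longleftrightarrow> (\<exists>T. val_at n s (\<lambda>i. T * p i - e (snd w) i) (x \<circ> Inl) = 0 \<and>
         (\<exists>u. (\<forall>v. v \<notin> Inr ` S \<longrightarrow> u v = (x(Inr w := T)) v) \<and> (\<forall>v\<in>S. root u v) \<and> P u = 0))"
      proof -
        have "Dv (x(Inr w := T)) p = 1" for T using x by (simp add: Dv_def val_at_def)
        thus ?thesis using Q(2) by simp
      qed
      also have "\<dots> \<longleftrightarrow> (\<exists>u. (\<forall>v. v \<notin> Inr ` insert w S \<longrightarrow> u v = x v) \<and> (\<forall>v\<in>insert w S. root u v) \<and> P u = 0)"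
        (is "?L \<longleftrightarrow> ?R")
      proof
        assume ?L
        then obtain T u where Tu: "val_at n s (\<lambda>i. T * p i - e (snd w) i) (x \<circ> Inl) = 0"
          "\<And>v. v \<notin> Inr ` S \<Longrightarrow> u v = (x(Inr w := T)) v" "\<forall>v\<in>S. root u v" "P u = 0" by blast
        have "u (Inl a) = x (Inl a)" for a using Tu(2)[of "Inl a"] by auto
        hence "u \<circ> Inl = x \<circ> Inl" by auto
        moreover have "u (Inr w) = T" using Tu(2)[of "Inr w"] insert.hyps(2) by auto
        ultimately have "root u w" using Tu(1) by (simp add: root_def Dv_def)
        thus ?R using Tu by (intro exI[of _ u]) auto
      next
        assume ?R
        then obtain u where u: "\<And>v. v \<notin> Inr ` insert w S \<Longrightarrow> u v = x v" "\<forall>v\<in>insert w S. root u v" "P u = 0"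
          by blast
        have "u \<circ> Inl = x \<circ> Inl" using u(1) by (auto simp: fun_eq_iff)
        hence "val_at n s (\<lambda>i. u (Inr w) * p i - e (snd w) i) (x \<circ> Inl) = 0"
          using u(2) by (simp add: root_def Dv_def)
        moreover have "\<forall>v. v \<notin> Inr ` S \<longrightarrow> u v = (x(Inr w := u (Inr w))) v" using u(1) by auto
        ultimately show ?L using u by blast
      qed
      finally show ?thesis .
    qed
    thus ?case using G(1) by blast
  qed
  define LL where "LL x i = (\<Sum>j\<le>n. cst (x (Inr (i, j))) * var j)"
    for x :: "(nat \<Rightarrow>\<^sub>0 nat) + nat \<times> nat \<Rightarrow> complex" and i
  define \<Phi> where "\<Phi> x = (\<Prod>i<s. LL x i)" for x
  have LLf: "LL x i \<in> forms {..n} 1" for x i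
    unfolding LL_def by (intro forms_sum forms_cst_mult forms_var) auto
  have \<Phi>f: "\<Phi> x \<in> forms {..n} s" for x using forms_prod[of "{..<s}" "LL x" "{..n}"] LLf by (simp add: \<Phi>_def)
  have fam: "polyfam I \<Phi>"
    unfolding \<Phi>_def LL_def by (intro polyfam_prod polyfam_sum polyfam_scale polyfun_var) (auto simp: I_def U_def)
  define x0 :: "(nat \<Rightarrow>\<^sub>0 nat) + nat \<times> nat \<Rightarrow> complex" where "x0 = case_sum (lk D1) (\<lambda>_. 0)"
  have x0D: "x0 \<circ> Inl = lk D1" by (auto simp: x0_def)
  have x0p: "Dv x0 p = 1" by (simp add: Dv_def x0D val_at_form D1)
  \<comment> \<open>The candidate tuples over \<open>D1\<close>: finitely many, as each unknown is a
    root of a monic polynomial determined by \<open>D1\<close>.\<close>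
  define C where "C = {u. (\<forall>v. v \<notin> Inr ` U \<longrightarrow> u v = x0 v) \<and> (\<forall>v\<in>U. root u v)}"
  have CD: "u \<circ> Inl = lk D1" if "u \<in> C" for u using that by (auto simp: C_def x0_def fun_eq_iff)
  have finC: "finite C"
  proof -
    define R where "R v = {T. val_at n s (\<lambda>i. T * p i - e (snd v) i) (lk D1) = 0}" for v :: "nat \<times> nat"
    have "finite (R v)" for v
    proof -
      obtain r where r: "\<And>T. val_at n s (\<lambda>i. T * p i - e (snd v) i) (lk D1) = (\<Prod>i<s. T - r i)"
        using val_at_line_splits[of n s p "lk D1" "e (snd v)"] by (auto simp: val_at_form D1)
      have "R v \<subseteq> r ` {..<s}" by (auto simp: R_def r)
      thus ?thesis by (rule finite_subset) simp
    qed
    hence "finite (PiE U R)" by (intro finite_PiE) (auto simp: U_def)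
    moreover have "C \<subseteq> (\<lambda>g v. case v of Inl \<alpha> \<Rightarrow> x0 v | Inr w \<Rightarrow> if w \<in> U then g w else x0 v) ` PiE U R"
    proof
      fix u assume u: "u \<in> C"
      show "u \<in> (\<lambda>g v. case v of Inl \<alpha> \<Rightarrow> x0 v | Inr w \<Rightarrow> if w \<in> U then g w else x0 v) ` PiE U R"
      proof (rule image_eqI)
        show "restrict (u \<circ> Inr) U \<in> PiE U R"
          using u CD[OF u] by (auto simp: C_def root_def Dv_def R_def)
        show "u = (\<lambda>v. case v of Inl \<alpha> \<Rightarrow> x0 v | Inr w \<Rightarrow> if w \<in> U then restrict (u \<circ> Inr) U w else x0 v)"
        proof
          fix v show "u v = (case v of Inl \<alpha> \<Rightarrow> x0 v | Inr w \<Rightarrow> if w \<in> U then restrict (u \<circ> Inr) U w else x0 v)"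
            using u by (cases v) (auto simp: C_def)
        qed
      qed
    qed
    ultimately show ?thesis by (meson finite_imageI finite_subset)
  qed
  define W where "W = (\<lambda>u \<alpha>. lk (\<Phi> u) \<alpha> - lk D1 \<alpha>) ` C"
  have "\<exists>\<alpha>\<in>?mon. w \<alpha> \<noteq> 0" if "w \<in> W" for w
  proof (rule ccontr)
    assume neg: "\<not> ?thesis"
    obtain u where u: "w = (\<lambda>\<alpha>. lk (\<Phi> u) \<alpha> - lk D1 \<alpha>)" using \<open>w \<in> W\<close> by (auto simp: W_def)
    have "lk (\<Phi> u) \<alpha> = lk D1 \<alpha>" for \<alpha>
    proof (cases "\<alpha> \<in> ?mon")
      case True thus ?thesis using neg u by auto
    next
      case False
      hence "\<alpha> \<notin> ks (\<Phi> u)" "\<alpha> \<notin> ks D1" using \<Phi>f[of u] D1(1) unfolding forms_def by blast+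
      thus ?thesis by (simp add: in_keys_iff)
    qed
    hence "D1 = (\<Prod>i<s. LL u i)" unfolding \<Phi>_def[symmetric] by (intro poly_mapping_eqI) simp
    moreover have "D1 \<noteq> 0" using D1(2) by auto
    ultimately have "D1 \<in> decomposable_variety n s" using LLf unfolding decomposable_variety_def by blast
    thus False using nd1 by blast
  qed
  then obtain c where c: "\<And>w. w \<in> W \<Longrightarrow> (\<Sum>\<alpha>\<in>?mon. c \<alpha> * w \<alpha>) \<noteq> 0"
    using nonzero_functional[of W ?mon] finC by (auto simp: W_def)
  \<comment> \<open>No candidate multiplies out to \<open>D1\<close>, and \<open>c\<close> detects
    this for all candidates by a single scalar. For a normalised decomposable \<open>D\<close> the
    true factors form a candidate with \<open>P = 0\<close>. So eliminating the unknowns from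
    \<open>P\<close> separates \<open>D1\<close> from the decomposable forms.\<close>
  define P where "P x = (\<Sum>\<alpha>\<in>?mon. c \<alpha> * (lk (\<Phi> x) \<alpha> - x (Inl \<alpha>)))" for x
  have "polyfun I P"
    unfolding P_def using fam by (intro polyfun_sum polyfun_mult polyfun_diff polyfun_const polyfun_var)
      (auto simp: I_def polyfam_def)
  then obtain Q where Q: "polyfun I Q" "\<And>x. Dv x p = 1 \<Longrightarrow>
      Q x = 0 \<longleftrightarrow> (\<exists>u. (\<forall>v. v \<notin> Inr ` U \<longrightarrow> u v = x v) \<and> (\<forall>v\<in>U. root u v) \<and> P u = 0)"
    using elim[of U P] by (auto simp: U_def)
  have Q0: "Q x0 \<noteq> 0"
  proof
    assume "Q x0 = 0"
    then obtain u where u: "u \<in> C" "P u = 0" using Q(2)[OF x0p] by (auto simp: C_def)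
    have "(\<lambda>\<alpha>. lk (\<Phi> u) \<alpha> - lk D1 \<alpha>) \<in> W" using u(1) by (auto simp: W_def)
    from c[OF this] show False using u(2) fun_cong[OF CD[OF u(1)]] by (simp add: P_def)
  qed
  define G where "G D = Q (case_sum D (\<lambda>_. 0))" for D
  have "polyfun ?mon G"
    unfolding G_def
  proof (rule polyfun_compose[OF Q(1)])
    fix k assume "k \<in> I"
    thus "polyfun ?mon (\<lambda>x. case k of Inl a \<Rightarrow> x a | Inr xa \<Rightarrow> 0)"
      by (auto simp: I_def intro: polyfun_intros)
  qed
  then obtain g where g: "g \<in> polys ?mon" "\<And>D. G D = evc D g" by (auto simp: polyfun_def)
  define l where "l = (\<Sum>\<alpha>\<in>?mon. cst (mev p \<alpha>) * var \<alpha>)"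
  have l: "l \<in> polys ?mon" "\<And>y. evc y l = val_at n s p y"
    by (auto simp: l_def ev_simps val_at_def mult.commute intro!: polys_intros)
  obtain g' K where g': "g' \<in> polys ?mon" "\<And>y. evc y l = 0 \<Longrightarrow> evc y g' = 0"
    "\<And>y. evc y l \<noteq> 0 \<Longrightarrow> evc y g' = evc y l ^ K * evc (\<lambda>i. y i / evc y l) g"
    using homogenize_at[OF g(1) l(1)] by blast
  have GD: "G (lk D) = 0" if D: "D \<in> decomposable_variety n s" "evc p D = 1" for D
  proof -
    obtain M where M: "\<And>i. i < s \<Longrightarrow> M i \<in> forms {..n} 1" "\<And>i. i < s \<Longrightarrow> evc p (M i) = 1" "D = (\<Prod>i<s. M i)"
      using decomposable_normalized[OF D] by blast
    define x where "x = case_sum (lk D) (\<lambda>_::nat \<times> nat. 0 :: complex)"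
    have Df: "D \<in> forms {..n} s" using D(1) by (rule decomposable_forms)
    have "x \<circ> Inl = lk D" by (auto simp: x_def)
    hence xp: "Dv x p = 1" by (simp add: Dv_def val_at_form Df D(2))
    define u where "u v = (case v of Inl \<alpha> \<Rightarrow> lk D \<alpha> | Inr w \<Rightarrow> if w \<in> U then lk (M (fst w)) (sg (snd w) 1) else 0)" for v
    have uD: "u \<circ> Inl = lk D" by (auto simp: u_def)
    have LLu: "LL u i = M i" if "i < s" for i
      using linear_form_expand[OF _ M(1)[OF that]] that by (simp add: LL_def u_def U_def)
    hence "\<Phi> u = D" by (simp add: \<Phi>_def M(3))
    hence "P u = 0" by (simp add: P_def u_def)
    moreover have "\<forall>v. v \<notin> Inr ` U \<longrightarrow> u v = x v"
      by (auto simp: u_def x_def split: sum.splits)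
    moreover have "root u v" if v: "v \<in> U" for v
    proof -
      obtain i j where ij: "v = (i, j)" "i < s" "j \<le> n" using v by (auto simp: U_def)
      have "evc (\<lambda>k. u (Inr v) * p k - e j k) (M i) = u (Inr v) * evc p (M i) - evc (e j) (M i)"
        using M(1)[OF ij(2)] by (rule linear_form_evc_diff)
      also have "evc (e j) (M i) = lk (M i) (sg j 1)"
        unfolding e_def using linear_form_evc_unit[OF _ M(1)[OF ij(2)], of j] ij by simp
      finally have "evc (\<lambda>k. u (Inr v) * p k - e j k) (M i) = 0" using M(2) ij v by (simp add: u_def)
      hence "evc (\<lambda>k. u (Inr v) * p k - e j k) D = 0" using ij unfolding M(3) by (auto simp: ev_simps)
      thus ?thesis unfolding root_def Dv_def uD val_at_form[OF Df] by (simp add: ij)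
    qed
    ultimately have "Q x = 0" using Q(2)[OF xp] by blast
    thus ?thesis by (simp add: G_def x_def)
  qed
  have "g' \<in> vanishing_ideal ?mon (decomposable_variety n s)"
    unfolding vanishing_ideal_def
  proof (intro CollectI conjI ballI g'(1))
    fix D assume D: "D \<in> decomposable_variety n s"
    note Df = decomposable_forms[OF D]
    show "peval g' D = 0"
    proof (cases "evc p D = 0")
      case True thus ?thesis using g'(2)[of "lk D"] l(2) val_at_form[OF Df] by (simp add: peval_evc)
    next
      case False
      have "cst (1 / evc p D) * D \<in> decomposable_variety n s"
        using False by (intro decomposable_scale D s) auto
      hence "G (lk (cst (1 / evc p D) * D)) = 0" using False by (intro GD) (auto simp: ev_simps)
      moreover have "lk (cst (1 / evc p D) * D) = (\<lambda>\<alpha>. lk D \<alpha> / evc p D)" by (auto simp: fun_eq_iff)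
      ultimately show ?thesis using False g'(3)[of "lk D"] l(2) val_at_form[OF Df] g(2) by (simp add: peval_evc)
    qed
  qed
  hence "evc (lk D0) g' = 0" by (rule van)
  moreover have "lk D1 = (\<lambda>\<alpha>. lk D0 \<alpha> / evc p D0)" by (auto simp: fun_eq_iff D1_def)
  ultimately have "G (lk D1) = 0"
    using g'(3)[of "lk D0"] l(2) val_at_form[OF D0(1)] p g(2) by simp
  thus False using Q0 by (simp add: G_def x0_def)
qed

section \<open>Tangent spaces of the variety of decomposable forms\<close>

text \<open>Derivative at \<open>c = 1\<close> of \<open>g\<close> along the ray through
  \<open>y\<close>, on which \<open>g\<close> vanishes.\<close>

lemma tangent_self:
  assumes "g \<in> polys I" "finite I" "\<And>c. c \<noteq> 0 \<Longrightarrow> evc (\<lambda>i. c * y i) g = 0"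
  shows "(\<Sum>i\<in>I. evc y (partial i g) * y i) = 0"
proof -
  have "((\<lambda>c. evc (\<lambda>i. c * y i) g) has_field_derivative
      (\<Sum>i\<in>I. evc (\<lambda>i. 1 * y i) (partial i g) * y i)) (at 1)"
    by (rule DERIV_evc[OF assms(1,2)]) (auto intro!: derivative_eq_intros)
  hence "((\<lambda>_. 0) has_field_derivative (\<Sum>i\<in>I. evc (\<lambda>i. 1 * y i) (partial i g) * y i)) (at 1)"
    by (rule has_field_derivative_transform_within[of _ _ _ _ 1]) (auto intro!: assms(3) simp: dist_norm)
  from DERIV_unique[OF this DERIV_const] show ?thesis by simp
qed

definition line_poly :: "('w \<Rightarrow> complex) \<Rightarrow> ('w \<Rightarrow> complex) \<Rightarrow> 'w mpoly \<Rightarrow> complex poly" where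
  "line_poly p q D = ev (\<lambda>a. [:a:]) (\<lambda>i. [:- q i, p i:]) D"

lemma ring_hom_c_pCons [simp]: "ring_hom_c (\<lambda>a. [:a:] :: complex poly)"
  by (simp add: ring_hom_c_def one_pCons)

lemma line_poly_simps:
  "line_poly p q (D + E) = line_poly p q D + line_poly p q E"
  "line_poly p q (D * E) = line_poly p q D * line_poly p q E"
  "line_poly p q (cst c * D) = smult c (line_poly p q D)"
  "line_poly p q (sum f A) = (\<Sum>a\<in>A. line_poly p q (f a))"
  "line_poly p q (prod f A) = (\<Prod>a\<in>A. line_poly p q (f a))"
  "line_poly p q (D ^ k) = line_poly p q D ^ k"
  by (simp_all add: line_poly_def ev_simps)

lemma poly_line_poly: "poly (line_poly p q D) T = evc (\<lambda>i. T * p i - q i) D"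
  unfolding line_poly_def by (subst ev_ev[where g = "\<lambda>a. a" and k = "\<lambda>a. a"]) (auto simp: mult.commute)

lemma line_poly_form:
  assumes "finite I" "D \<in> forms I s"
  shows "degree (line_poly p q D) \<le> s" "coeff (line_poly p q D) s = evc p D"
    "coeff (line_poly p q D) k = (\<Sum>\<alpha>\<in>monomials I s. lk D \<alpha> * line_coeff p q \<alpha> k)"
proof -
  have lp: "line_poly p q D = (\<Sum>\<alpha>\<in>monomials I s. [:lk D \<alpha>:] * mev (\<lambda>i. [:- q i, p i:]) \<alpha>)"
    unfolding line_poly_def using assms by (intro ev_superset) (auto simp: forms_def)
  show c: "coeff (line_poly p q D) k = (\<Sum>\<alpha>\<in>monomials I s. lk D \<alpha> * line_coeff p q \<alpha> k)" for k
    unfolding lp coeff_sum line_coeff_def by simp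
  have "line_coeff p q \<alpha> s = mev p \<alpha>" if "\<alpha> \<in> monomials I s" for \<alpha>
    using that mev_line(2)[of q p \<alpha>] by (auto simp: line_coeff_def in_monomials)
  thus "coeff (line_poly p q D) s = evc p D"
    unfolding c evc_form_expand[OF assms] by (intro sum.cong) auto
  show "degree (line_poly p q D) \<le> s"
  proof (rule degree_le, intro allI impI)
    fix k assume k: "s < k"
    have "line_coeff p q \<alpha> k = 0" if "\<alpha> \<in> monomials I s" for \<alpha>
      using that mev_line(1)[of q p \<alpha>] k by (auto simp: line_coeff_def in_monomials intro!: coeff_eq_0)
    thus "coeff (line_poly p q D) k = 0" unfolding c by (intro sum.neutral) auto
  qed
qed

lemma line_poly_linear:
  assumes "l \<in> forms I 1"
  shows "line_poly p q l = [:- evc q l, evc p l:]"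
proof -
  have "poly (line_poly p q l) = poly [:- evc q l, evc p l:]"
    unfolding fun_eq_iff poly_line_poly linear_form_evc_diff[OF assms] by simp
  thus ?thesis by (simp only: poly_eq_poly_eq_iff)
qed

lemma cst_sum: "cst (sum f A) = (\<Sum>a\<in>A. cst (f a))"
  by (induction A rule: infinite_finite_induct) (simp_all add: cst_add)

section \<open>Directional derivatives on a line\<close>

definition dir_deriv :: "nat \<Rightarrow> (nat \<Rightarrow> complex) \<Rightarrow> nat mpoly \<Rightarrow> nat mpoly" where
  "dir_deriv n x D = (\<Sum>j\<le>n. cst (x j) * partial j D)"

lemma dir_deriv_add: "dir_deriv n x (D + E) = dir_deriv n x D + dir_deriv n x E"
  by (simp add: dir_deriv_def partial_add distrib_left sum.distrib)

lemma dir_deriv_cst_mult: "dir_deriv n x (cst c * D) = cst c * dir_deriv n x D"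
  by (simp add: dir_deriv_def partial_mult sum_distrib_left mult_ac)

lemma dir_deriv_sum: "dir_deriv n x (sum f A) = (\<Sum>a\<in>A. dir_deriv n x (f a))"
proof (induction A rule: infinite_finite_induct)
  case (insert a A) thus ?case by (simp add: dir_deriv_add)
qed (simp_all add: dir_deriv_def)

lemma dir_deriv_linear:
  assumes "l \<in> forms {..n} 1" shows "dir_deriv n x l = cst (evc x l)"
proof -
  define c where "c j = lk l (sg j 1)" for j
  have l: "l = (\<Sum>j\<le>n. cst (c j) * var j)" unfolding c_def using assms by (intro linear_form_expand) auto
  have "partial k l = cst (c k)" if "k \<le> n" for k
    using that by (simp add: l partial_sum partial_mult partial_var if_distrib cong: if_cong)
  hence "dir_deriv n x l = (\<Sum>j\<le>n. cst (x j) * cst (c j))"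
    unfolding dir_deriv_def by (intro sum.cong) auto
  also have "\<dots> = cst (evc x l)"
    by (simp add: l ev_simps cst_sum cst_mult mult.commute)
  finally show ?thesis .
qed

text \<open>At a zero of \<open>M i\<close> only the term of the product rule differentiating
  \<open>M i\<close> survives, and the derivative of a linear form in direction \<open>x\<close> is
  its value at \<open>x\<close>.\<close>

lemma evc_dir_deriv_prod:
  fixes s :: nat
  assumes "\<And>i. i < s \<Longrightarrow> M i \<in> forms {..n} 1" "i < s" "evc y (M i) = 0"
  shows "evc y (dir_deriv n x (\<Prod>i<s. M i)) = evc x (M i) * (\<Prod>k\<in>{..<s} - {i}. evc y (M k))"
proof -
  have "dir_deriv n x (\<Prod>i<s. M i) = (\<Sum>k<s. dir_deriv n x (M k) * others s k M)"
    unfolding dir_deriv_def sum_distrib_right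
    by (subst sum.swap) (simp add: partial_prod sum_distrib_left mult.assoc)
  also have "\<dots> = (\<Sum>k<s. cst (evc x (M k)) * others s k M)"
    using assms(1) by (intro sum.cong) (auto simp: dir_deriv_linear)
  finally have "evc y (dir_deriv n x (\<Prod>i<s. M i)) =
      (\<Sum>k<s. evc x (M k) * (\<Prod>j\<in>{..<s} - {k}. evc y (M j)))" by (simp add: ev_simps)
  also have "\<dots> = (\<Sum>k<s. if k = i then evc x (M i) * (\<Prod>k\<in>{..<s} - {i}. evc y (M k)) else 0)"
  proof (intro sum.cong refl)
    fix k assume "k \<in> {..<s}"
    show "evc x (M k) * (\<Prod>j\<in>{..<s} - {k}. evc y (M j)) =
        (if k = i then evc x (M i) * (\<Prod>k\<in>{..<s} - {i}. evc y (M k)) else 0)"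
    proof (cases "k = i")
      case False
      hence "(\<Prod>j\<in>{..<s} - {k}. evc y (M j)) = 0" using assms(2,3) by (intro prod_zero) auto
      thus ?thesis using False by simp
    qed simp
  qed
  finally show ?thesis using assms(2) by simp
qed

text \<open>A norm over the zeros of \<open>D\<close> on the line: the roots \<open>r\<close> enter
  only the description of the value, while \<open>G\<close> is polynomial in the coefficients of
  \<open>D\<close>.\<close>

lemma norm_dir_deriv:
  obtains G where "polyfun (monomials {..n} s) G"
    "\<And>D r. D \<in> forms {..n} s \<Longrightarrow> evc p D = 1 \<Longrightarrow> line_poly p q D = (\<Prod>i<s. [:- r i, 1:]) \<Longrightarrow>
      G (lk D) = (\<Prod>i<s. evc (\<lambda>j. r i * p j - q j) (dir_deriv n x D))"
proof -
  let ?mon = "monomials {..n} s"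
  define a where "a k D = (\<Sum>\<alpha>\<in>?mon. D \<alpha> * line_coeff p q \<alpha> k)" for k and D :: "(nat \<Rightarrow>\<^sub>0 nat) \<Rightarrow> complex"
  define B where "B \<alpha> = line_poly p q (dir_deriv n x (xpow \<alpha>))" for \<alpha>
  define m where "m = (\<Sum>\<alpha>\<in>?mon. degree (B \<alpha>))"
  define b where "b k D = (\<Sum>\<alpha>\<in>?mon. D \<alpha> * coeff (B \<alpha>) k)" for k and D :: "(nat \<Rightarrow>\<^sub>0 nat) \<Rightarrow> complex"
  have pa: "polyfun ?mon (a k)" and pb: "polyfun ?mon (b k)" for k
    unfolding a_def b_def by (intro polyfun_intros; simp)+
  obtain G where G: "polyfun ?mon G" "\<And>D r. (\<And>T. T ^ s + (\<Sum>k<s. a k D * T ^ k) = (\<Prod>i<s. T - r i)) \<Longrightarrow>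
     G D = (\<Prod>i<s. \<Sum>k\<le>m. b k D * r i ^ k)"
    using polyfun_norm[of s ?mon a b m, OF pa pb] by blast
  have "G (lk D) = (\<Prod>i<s. evc (\<lambda>j. r i * p j - q j) (dir_deriv n x D))"
    if D: "D \<in> forms {..n} s" "evc p D = 1" "line_poly p q D = (\<Prod>i<s. [:- r i, 1:])" for D r
  proof -
    have v1: "val_at n s p (lk D) = 1" using D by (simp add: val_at_form)
    have "T ^ s + (\<Sum>k<s. a k (lk D) * T ^ k) = (\<Prod>i<s. T - r i)" for T
    proof -
      have "T ^ s + (\<Sum>k<s. a k (lk D) * T ^ k) = evc (\<lambda>i. T * p i - q i) D"
        using val_at_line[OF v1, of T q] by (simp add: a_def val_at_form[OF D(1)])
      also have "\<dots> = (\<Prod>i<s. T - r i)" unfolding poly_line_poly[symmetric] D(3) by (simp add: poly_prod)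
      finally show ?thesis .
    qed
    from G(2)[OF this] have "G (lk D) = (\<Prod>i<s. \<Sum>k\<le>m. b k (lk D) * r i ^ k)" .
    moreover have "(\<Sum>k\<le>m. b k (lk D) * T ^ k) = evc (\<lambda>j. T * p j - q j) (dir_deriv n x D)" for T
    proof -
      have "dir_deriv n x D = (\<Sum>\<alpha>\<in>?mon. cst (lk D \<alpha>) * dir_deriv n x (xpow \<alpha>))"
      proof -
        have "D = (\<Sum>\<alpha>\<in>?mon. cst (lk D \<alpha>) * xpow \<alpha>)"
          using D(1) by (intro sum_xpow_superset) (auto simp: forms_def)
        hence "dir_deriv n x D = dir_deriv n x (\<Sum>\<alpha>\<in>?mon. cst (lk D \<alpha>) * xpow \<alpha>)" by simp
        thus ?thesis by (simp only: dir_deriv_sum dir_deriv_cst_mult)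
      qed
      hence "evc (\<lambda>j. T * p j - q j) (dir_deriv n x D) = (\<Sum>\<alpha>\<in>?mon. lk D \<alpha> * poly (B \<alpha>) T)"
        by (simp add: ev_simps B_def poly_line_poly)
      also have "\<dots> = (\<Sum>\<alpha>\<in>?mon. \<Sum>k\<le>m. lk D \<alpha> * coeff (B \<alpha>) k * T ^ k)"
      proof (intro sum.cong refl)
        fix \<alpha> assume "\<alpha> \<in> ?mon"
        hence "degree (B \<alpha>) \<le> m" unfolding m_def by (intro member_le_sum) auto
        from poly_eq_sum_bound[OF this] show "lk D \<alpha> * poly (B \<alpha>) T = (\<Sum>k\<le>m. lk D \<alpha> * coeff (B \<alpha>) k * T ^ k)"
          by (simp add: sum_distrib_left mult_ac)
      qed
      finally show ?thesis by (subst (asm) sum.swap) (simp add: b_def sum_distrib_right)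
    qed
    ultimately show ?thesis by simp
  qed
  thus ?thesis using G(1) that by blast
qed

text \<open>A linear factor of \<open>D\<close> vanishing at a point \<open>y\<close> is proportional to \<open>x \<mapsto> \<partial>\<^sub>x D(y)\<close>. So the values
  at \<open>x\<close> of the linear factors can be read off at the points where the line \<open>T p - q\<close> meets \<open>D = 0\<close>, and
  the equation says that their product is \<open>D(x)\<close>.\<close>

lemma decomposable_equation:
  obtains g where "g \<in> vanishing_ideal (monomials {..n} s) (decomposable_variety n s)"
    "\<And>D r. D \<in> forms {..n} s \<Longrightarrow> evc p D = 1 \<Longrightarrow> line_poly p q D = (\<Prod>i<s. [:- r i, 1:]) \<Longrightarrow>
      evc (lk D) g = (\<Prod>i<s. evc (\<lambda>j. r i * p j - q j) (dir_deriv n x D)) -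
         evc x D * (\<Prod>i<s. evc (\<lambda>j. r i * p j - q j) (dir_deriv n p D))"
proof -
  let ?mon = "monomials {..n} s"
  obtain G where G: "polyfun ?mon G"
    "\<And>D r. D \<in> forms {..n} s \<Longrightarrow> evc p D = 1 \<Longrightarrow> line_poly p q D = (\<Prod>i<s. [:- r i, 1:]) \<Longrightarrow>
      G (lk D) = (\<Prod>i<s. evc (\<lambda>j. r i * p j - q j) (dir_deriv n x D))"
    using norm_dir_deriv[of n s p q x] by blast
  obtain H where H: "polyfun ?mon H"
    "\<And>D r. D \<in> forms {..n} s \<Longrightarrow> evc p D = 1 \<Longrightarrow> line_poly p q D = (\<Prod>i<s. [:- r i, 1:]) \<Longrightarrow>
      H (lk D) = (\<Prod>i<s. evc (\<lambda>j. r i * p j - q j) (dir_deriv n p D))"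
    using norm_dir_deriv[of n s p q p] by blast
  have "polyfun ?mon (\<lambda>D. G D - val_at n s x D * H D)"
    unfolding val_at_def using G(1) H(1) by (intro polyfun_diff polyfun_mult polyfun_sum polyfun_var polyfun_const)
  then obtain g0 where g0: "g0 \<in> polys ?mon" "\<And>D. G D - val_at n s x D * H D = evc D g0"
    by (auto simp: polyfun_def)
  define l where "l = (\<Sum>\<alpha>\<in>?mon. cst (mev p \<alpha>) * var \<alpha>)"
  have l: "l \<in> polys ?mon" "\<And>y. evc y l = val_at n s p y"
    by (auto simp: l_def ev_simps val_at_def mult.commute intro!: polys_intros)
  obtain g K where g: "g \<in> polys ?mon" "\<And>y. evc y l = 0 \<Longrightarrow> evc y g = 0"
    "\<And>y. evc y l \<noteq> 0 \<Longrightarrow> evc y g = evc y l ^ K * evc (\<lambda>i. y i / evc y l) g0"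
    using homogenize_at[OF g0(1) l(1)] by blast
  have val: "evc (lk D) g0 = (\<Prod>i<s. evc (\<lambda>j. r i * p j - q j) (dir_deriv n x D)) -
         evc x D * (\<Prod>i<s. evc (\<lambda>j. r i * p j - q j) (dir_deriv n p D))"
    if "D \<in> forms {..n} s" "evc p D = 1" "line_poly p q D = (\<Prod>i<s. [:- r i, 1:])" for D r
    using G(2)[OF that] H(2)[OF that] g0(2)[of "lk D"] val_at_form[OF that(1)] by simp
  have van: "evc (lk D) g0 = 0" if D: "D \<in> decomposable_variety n s" "evc p D = 1" for D
  proof -
    obtain M where M: "\<And>i. i < s \<Longrightarrow> M i \<in> forms {..n} 1" "\<And>i. i < s \<Longrightarrow> evc p (M i) = 1" "D = (\<Prod>i<s. M i)"
      using decomposable_normalized[OF D] by blast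
    define r where "r i = evc q (M i)" for i
    have "line_poly p q D = (\<Prod>i<s. [:- r i, 1:])"
      unfolding M(3) line_poly_simps
      by (intro prod.cong refl) (auto simp: line_poly_linear[OF M(1)] M(2) r_def)
    note * = val[OF decomposable_forms[OF D(1)] D(2) this]
    have z: "evc (\<lambda>j. r i * p j - q j) (M i) = 0" if "i < s" for i
      unfolding linear_form_evc_diff[OF M(1)[OF that]] using M(2)[OF that] by (simp add: r_def)
    \<comment> \<open>For direction \<open>p\<close> the first factor is 1. So the products for
      \<open>x\<close> and for \<open>p\<close> differ by the product of all \<open>M i\<close> at
      \<open>x\<close>, which is \<open>D(x)\<close>.\<close>
    have dd: "evc (\<lambda>j. r i * p j - q j) (dir_deriv n y D) =
        evc y (M i) * (\<Prod>k\<in>{..<s} - {i}. evc (\<lambda>j. r i * p j - q j) (M k))" if "i < s" for i y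
      unfolding M(3) using M(1) that z[OF that] by (intro evc_dir_deriv_prod)
    have "(\<Prod>i<s. evc (\<lambda>j. r i * p j - q j) (dir_deriv n x D)) =
       evc x D * (\<Prod>i<s. evc (\<lambda>j. r i * p j - q j) (dir_deriv n p D))"
    proof -
      have "(\<Prod>i<s. evc (\<lambda>j. r i * p j - q j) (dir_deriv n x D)) =
        (\<Prod>i<s. evc x (M i)) * (\<Prod>i<s. \<Prod>k\<in>{..<s} - {i}. evc (\<lambda>j. r i * p j - q j) (M k))"
        by (simp add: dd prod.distrib)
      also have "(\<Prod>i<s. evc x (M i)) = evc x D" by (simp add: M(3) ev_simps)
      also have "(\<Prod>i<s. \<Prod>k\<in>{..<s} - {i}. evc (\<lambda>j. r i * p j - q j) (M k)) =
          (\<Prod>i<s. evc (\<lambda>j. r i * p j - q j) (dir_deriv n p D))"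
        using M(2) by (simp add: dd)
      finally show ?thesis .
    qed
    thus ?thesis using * by simp
  qed
  show ?thesis
  proof (rule that[of g])
    show "g \<in> vanishing_ideal ?mon (decomposable_variety n s)"
      unfolding vanishing_ideal_def
    proof (intro CollectI conjI ballI g(1))
      fix D assume D: "D \<in> decomposable_variety n s"
      note Df = decomposable_forms[OF D]
      show "peval g D = 0"
      proof (cases "evc p D = 0")
        case True thus ?thesis using g(2)[of "lk D"] l(2) val_at_form[OF Df] by (simp add: peval_evc)
      next
        case False
        have "evc (lk (cst (1 / evc p D) * D)) g0 = 0"
        proof (cases "s = 0")
          case True
          hence "D = 1" using D by (auto simp: decomposable_variety_def)
          thus ?thesis using van[OF D] by (simp add: ev_simps)
        next
          case s: False
          show ?thesis
            using False s by (intro van decomposable_scale D) (auto simp: ev_simps)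
        qed
        moreover have "lk (cst (1 / evc p D) * D) = (\<lambda>\<alpha>. lk D \<alpha> / evc p D)" by (auto simp: fun_eq_iff)
        ultimately show ?thesis using False g(3)[of "lk D"] l(2) val_at_form[OF Df] by (simp add: peval_evc)
      qed
    qed
  next
    fix D r assume D: "D \<in> forms {..n} s" "evc p D = 1" "line_poly p q D = (\<Prod>i<s. [:- r i, 1:])"
    have "evc (lk D) l = 1" using D by (simp add: l(2) val_at_form)
    hence "evc (lk D) g = evc (lk D) g0" using g(3)[of "lk D"] by simp
    thus "evc (lk D) g = (\<Prod>i<s. evc (\<lambda>j. r i * p j - q j) (dir_deriv n x D)) -
         evc x D * (\<Prod>i<s. evc (\<lambda>j. r i * p j - q j) (dir_deriv n p D))"
      using val[OF D] by simp
  qed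
qed

lemma DERIV_coeff_prod_linear:
  fixes \<rho> \<rho>' :: "'i \<Rightarrow> complex"
  assumes "finite A"
  shows "((\<lambda>t. coeff (\<Prod>i\<in>A. [:- (\<rho> i + t * \<rho>' i), 1:]) k) has_field_derivative
    coeff (\<Sum>i\<in>A. smult (- \<rho>' i) (\<Prod>j\<in>A - {i}. [:- \<rho> j, 1:])) k) (at 0)"
  using assms
proof (induction A arbitrary: k rule: finite_induct)
  case (insert a A)
  let ?P = "\<lambda>t. \<Prod>i\<in>A. [:- (\<rho> i + t * \<rho>' i), 1:]" and ?Q = "\<Sum>i\<in>A. smult (- \<rho>' i) (\<Prod>j\<in>A - {i}. [:- \<rho> j, 1:])"
  have co: "coeff ([:c, 1:] * P) k = c * coeff P k + (if k = 0 then 0 else coeff P (k - 1))" for c :: complex and P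
    by (cases k) (simp_all add: algebra_simps)
  have lin: "((\<lambda>t. - (\<rho> a + t * \<rho>' a)) has_field_derivative - \<rho>' a) (at 0)"
    by (auto intro!: derivative_eq_intros)
  have "((\<lambda>t. if k = 0 then 0 else coeff (?P t) (k - 1)) has_field_derivative
      (if k = 0 then 0 else coeff ?Q (k - 1))) (at 0)"
    using insert.IH by (cases "k = 0") auto
  from DERIV_add[OF DERIV_mult[OF lin insert.IH[of k]] this]
  have "((\<lambda>t. - (\<rho> a + t * \<rho>' a) * coeff (?P t) k + (if k = 0 then 0 else coeff (?P t) (k - 1)))
    has_field_derivative (- \<rho>' a * coeff (?P 0) k + - \<rho> a * coeff ?Q k + (if k = 0 then 0 else coeff ?Q (k - 1)))) (at 0)"
    by (simp only: mult_zero_left add_0_right mult.commute)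
  moreover have "(\<Sum>i\<in>insert a A. smult (- \<rho>' i) (\<Prod>j\<in>insert a A - {i}. [:- \<rho> j, 1:])) =
      smult (- \<rho>' a) (?P 0) + [:- \<rho> a, 1:] * ?Q"
  proof -
    have "(\<Sum>i\<in>A. smult (- \<rho>' i) (\<Prod>j\<in>insert a A - {i}. [:- \<rho> j, 1:])) =
       (\<Sum>i\<in>A. [:- \<rho> a, 1:] * smult (- \<rho>' i) (\<Prod>j\<in>A - {i}. [:- \<rho> j, 1:]))"
    proof (intro sum.cong refl)
      fix i assume "i \<in> A"
      hence "insert a A - {i} = insert a (A - {i})" using insert.hyps by auto
      thus "smult (- \<rho>' i) (\<Prod>j\<in>insert a A - {i}. [:- \<rho> j, 1:]) =
          [:- \<rho> a, 1:] * smult (- \<rho>' i) (\<Prod>j\<in>A - {i}. [:- \<rho> j, 1:])"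
        using insert.hyps by (simp only: finite_Diff prod.insert Diff_iff mult_smult_right) simp
    qed
    thus ?thesis using insert.hyps by (simp add: sum_distrib_left)
  qed
  moreover have "coeff (\<Prod>i\<in>insert a A. [:- (\<rho> i + t * \<rho>' i), 1:]) k =
      - (\<rho> a + t * \<rho>' a) * coeff (?P t) k + (if k = 0 then 0 else coeff (?P t) (k - 1))" for t
    unfolding prod.insert[OF insert.hyps] co ..
  ultimately show ?case by (simp only: co coeff_add coeff_smult add.assoc)
qed auto

text \<open>As all factors have value 1 at \<open>p\<close>, injectivity of \<open>L\<close> means
  that they are pairwise not proportional, so some line meets them in distinct points.
  Differentiating the explicit equation along a curve through the product, with tangent
  \<open>v\<close> minus its radial part, writes this tangent as a combination of the cofactors and
  the product. The multipliers are derivatives of \<open>dir_deriv n x\<close> at the intersection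
  points, hence linear in \<open>x\<close>.\<close>

theorem tangent_decomposable:
  assumes n: "n \<ge> 1" and s: "s > 0"
    and L: "\<And>i. i < s \<Longrightarrow> L i \<in> forms {..n} 1" "\<And>i. i < s \<Longrightarrow> evc p (L i) = 1" "inj_on L {..<s}"
    and v: "v \<in> forms {..n} s" "\<And>g. g \<in> vanishing_ideal (monomials {..n} s) (decomposable_variety n s) \<Longrightarrow>
      (\<Sum>\<alpha>\<in>monomials {..n} s. evc (lk (\<Prod>i<s. L i)) (partial \<alpha> g) * lk v \<alpha>) = 0"
  obtains l where "\<And>i. i < s \<Longrightarrow> l i \<in> forms {..n} 1" "v = (\<Sum>i<s. l i * others s i L)"
proof -
  let ?mon = "monomials {..n} s"
  define D0 where "D0 = (\<Prod>i<s. L i)"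
  have L0: "L i \<noteq> 0" if "i < s" for i using L(2)[OF that] by auto
  have D0f: "D0 \<in> forms {..n} s" using forms_prod[of "{..<s}" L "{..n}"] L(1) by (simp add: D0_def)
  have D0p: "evc p D0 = 1" using L(2) by (simp add: D0_def ev_simps)
  have "D0 \<noteq> 0" using D0p by auto
  hence D0d: "D0 \<in> decomposable_variety n s"
    using L(1) unfolding decomposable_variety_def D0_def by blast
  define w where "w = v - cst (evc p v) * D0"
  have wf: "w \<in> forms {..n} s" unfolding w_def by (intro forms_diff forms_cst_mult v D0f)
  have wp: "evc p w = 0" by (simp add: w_def ev_simps D0p)
  have wt: "(\<Sum>\<alpha>\<in>?mon. evc (lk D0) (partial \<alpha> g) * lk w \<alpha>) = 0"
    if g: "g \<in> vanishing_ideal ?mon (decomposable_variety n s)" for g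
  proof -
    have "(\<Sum>\<alpha>\<in>?mon. evc (lk D0) (partial \<alpha> g) * lk D0 \<alpha>) = 0"
    proof (rule tangent_self)
      show "g \<in> polys ?mon" using g by (simp add: vanishing_ideal_def)
      fix c :: complex assume "c \<noteq> 0"
      hence "peval g (cst c * D0) = 0"
        using g decomposable_scale[OF D0d _ s] by (auto simp: vanishing_ideal_def)
      moreover have "lk (cst c * D0) = (\<lambda>i. c * lk D0 i)" by (auto simp: fun_eq_iff)
      ultimately show "evc (\<lambda>i. c * lk D0 i) g = 0" by (simp add: peval_evc)
    qed simp
    hence "(\<Sum>\<alpha>\<in>?mon. evc (lk D0) (partial \<alpha> g) * (evc p v * lk D0 \<alpha>)) = 0"
      by (simp add: mult.left_commute flip: sum_distrib_left)
    thus ?thesis using v(2)[OF g]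
      by (simp add: w_def lookup_minus right_diff_distrib sum_subtractf D0_def)
  qed
  obtain a where a: "a \<le> n" "p a \<noteq> 0"
  proof (rule ccontr)
    assume neg: "\<not> thesis"
    hence "p i = 0" if "i \<in> {..n}" for i using that \<open>\<And>a. a \<le> n \<Longrightarrow> p a \<noteq> 0 \<Longrightarrow> thesis\<close> by auto
    hence "evc p (L 0) = evc (\<lambda>i. 0 * p i) (L 0)"
      by (intro ev_cong_polys[OF forms_polys[OF L(1)[OF s]]]) auto
    also have "\<dots> = 0" using linear_form_evc[OF L(1)[OF s], of 0 p 0 p] by simp
    finally show False using L(2)[OF s] by simp
  qed
  \<comment> \<open>A second coordinate, available for \<open>n \<ge> 1\<close>, gives a nonzero
    linear form \<open>B0\<close> vanishing at \<open>p\<close>.\<close>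
  define b where "b = (if a = 0 then 1 else 0 :: nat)"
  have b: "b \<le> n" "b \<noteq> a" using n by (auto simp: b_def)
  define B0 where "B0 = cst (p a) * var b - cst (p b) * var a"
  have B0f: "B0 \<in> forms {..n} 1" unfolding B0_def using a b by (intro forms_diff forms_cst_mult forms_var) auto
  have B0p: "evc p B0 = 0" by (simp add: B0_def ev_simps)
  have "evc (\<lambda>i. if i = b then 1 else 0) B0 = p a" using b by (simp add: B0_def ev_simps)
  hence B00: "B0 \<noteq> 0" using a by auto
  define pairs where "pairs = {(i, j). i < s \<and> j < s \<and> i \<noteq> j}"
  have finp: "finite pairs" by (rule finite_subset[of _ "{..<s} \<times> {..<s}"]) (auto simp: pairs_def)
  \<comment> \<open>At a point \<open>q\<close> where this product is nonzero, \<open>B0\<close>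
    restricts to a nonzero constant on the line and the factors have distinct roots.\<close>
  have "B0 * (\<Prod>(i, j)\<in>pairs. L i - L j) \<noteq> 0"
    using B00 finp L(3) by (auto simp: pairs_def inj_on_def)
  then obtain q where "evc q (B0 * (\<Prod>(i, j)\<in>pairs. L i - L j)) \<noteq> 0"
    using poly_nonvanishing_point by blast
  hence q: "evc q B0 \<noteq> 0" "\<And>i j. i < s \<Longrightarrow> j < s \<Longrightarrow> i \<noteq> j \<Longrightarrow> evc q (L i) \<noteq> evc q (L j)"
    using finp by (auto simp: ev_simps pairs_def case_prod_beta)
  define \<rho> where "\<rho> i = evc q (L i)" for i
  have \<rho>: "\<rho> i \<noteq> \<rho> j" if "i < s" "j < s" "i \<noteq> j" for i j using q(2)[OF that] by (simp add: \<rho>_def)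
  \<comment> \<open>Scaled so that \<open>A\<close> restricts to \<open>T\<close> and
    \<open>B\<close> to 1; then \<open>F k\<close> restricts to \<open>T^k\<close>, and every
    polynomial of degree at most \<open>s\<close> in \<open>T\<close> is the restriction of a
    form.\<close>
  define B where "B = cst (- 1 / evc q B0) * B0"
  define A where "A = L 0 + cst (\<rho> 0) * B"
  have Bf: "B \<in> forms {..n} 1" unfolding B_def by (intro forms_cst_mult B0f)
  have Af: "A \<in> forms {..n} 1" unfolding A_def by (intro forms_add forms_cst_mult Bf L(1) s)
  have lpA: "line_poly p q A = monom 1 1" and lpB: "line_poly p q B = 1"
    unfolding line_poly_linear[OF Af] line_poly_linear[OF Bf]
    using q(1) L(2)[OF s] by (auto simp: A_def B_def ev_simps B0p \<rho>_def monom_Suc one_pCons)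
  define F where "F k = A ^ k * B ^ (s - k)" for k
  have Ff: "F k \<in> forms {..n} s" if "k \<le> s" for k
    using forms_mult[OF forms_power[OF Af, of k] forms_power[OF Bf, of "s - k"]] that by (simp add: F_def)
  have lpF: "line_poly p q (F k) = monom 1 k" for k
    by (simp add: F_def line_poly_simps lpA lpB monom_power)
  define c where "c i = (\<Prod>k\<in>{..<s} - {i}. \<rho> i - \<rho> k)" for i
  have c0: "c i \<noteq> 0" if "i < s" for i using \<rho> that by (auto simp: c_def)
  \<comment> \<open>Velocity of the root \<open>\<rho> i\<close> of \<open>D0 + t w\<close> by
    implicit differentiation; \<open>c i\<close> is the derivative of the restricted
    \<open>D0\<close> there.\<close>
  define \<rho>' where "\<rho>' i = - poly (line_poly p q w) (\<rho> i) / c i" for i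
  define r where "r t i = \<rho> i + t * \<rho>' i" for t i
  define R where "R t = (\<Prod>i<s. [:- r t i, 1:])" for t
  define \<kappa> where "\<kappa> t k = coeff (R t) k - coeff (line_poly p q D0) k - t * coeff (line_poly p q w) k" for t k
  \<comment> \<open>a curve with tangent \<open>w\<close> at \<open>D0\<close> whose roots on the line are exactly \<open>\<rho> i + t * \<rho>' i\<close>\<close>
  define C where "C t = D0 + cst t * w + (\<Sum>k\<le>s. cst (\<kappa> t k) * F k)" for t
  have lpD0: "line_poly p q D0 = (\<Prod>i<s. [:- \<rho> i, 1:])"
    unfolding D0_def line_poly_simps by (intro prod.cong) (auto simp: line_poly_linear[OF L(1)] L(2) \<rho>_def)
  have R0: "R 0 = line_poly p q D0" by (simp add: R_def r_def lpD0)
  have degR: "degree (R t) = s" for t unfolding R_def by (subst degree_prod_eq_sum_degree) auto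
  have Rtop: "coeff (R t) s = 1" for t using coeff_prod_linear[of 0 s "r t"] by (simp add: R_def)
  have degw: "degree (line_poly p q w) < s"
  proof -
    have "degree (line_poly p q w) \<le> s" "coeff (line_poly p q w) s = 0"
      using line_poly_form(1,2)[OF _ wf] wp by auto
    thus ?thesis using s by (metis degree_0 le_neq_implies_less leading_coeff_0_iff)
  qed
  \<comment> \<open>Velocity of the polynomial \<open>R t\<close>. It agrees with the restriction of
    \<open>w\<close> at \<open>s\<close> points, and both have degree below \<open>s\<close>. Hence
    \<open>\<kappa>\<close> vanishes at 0 with its derivative, and the correction does not change
    the tangent.\<close>
  define N where "N = (\<Sum>i<s. smult (- \<rho>' i) (\<Prod>j\<in>{..<s} - {i}. [:- \<rho> j, 1:]))"
  have N: "N = line_poly p q w"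
  proof (rule poly_eqI_degree)
    have inj\<rho>: "inj_on \<rho> {..<s}" using \<rho> by (meson inj_onI lessThan_iff)
    show "card (\<rho> ` {..<s}) > degree (line_poly p q w)" using degw by (simp add: card_image[OF inj\<rho>])
    have "degree N \<le> s - 1"
      unfolding N_def
    proof (intro degree_sum_le order.trans[OF degree_smult_le])
      fix i assume "i \<in> {..<s}"
      thus "degree (\<Prod>j\<in>{..<s} - {i}. [:- \<rho> j, 1:]) \<le> s - 1"
        by (subst degree_prod_eq_sum_degree) auto
    qed simp
    thus "card (\<rho> ` {..<s}) > degree N" using s by (simp add: card_image[OF inj\<rho>])
    fix T assume "T \<in> \<rho> ` {..<s}"
    then obtain i where i: "i < s" "T = \<rho> i" by blast
    have "poly N T = (\<Sum>k<s. if k = i then - \<rho>' i * c i else 0)"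
      unfolding N_def poly_sum poly_smult poly_prod i(2)
    proof (intro sum.cong refl)
      fix k assume "k \<in> {..<s}"
      show "- \<rho>' k * (\<Prod>x\<in>{..<s} - {k}. poly [:- \<rho> x, 1:] (\<rho> i)) = (if k = i then - \<rho>' i * c i else 0)"
      proof (cases "k = i")
        case False
        hence "(\<Prod>x\<in>{..<s} - {k}. poly [:- \<rho> x, 1:] (\<rho> i)) = 0"
          using i(1) by (intro prod_zero) auto
        thus ?thesis using False by simp
      qed (simp add: c_def)
    qed
    also have "\<dots> = poly (line_poly p q w) T" using i c0[OF i(1)] by (simp add: \<rho>'_def)
    finally show "poly N T = poly (line_poly p q w) T" .
  qed
  have \<kappa>0: "\<kappa> 0 k = 0" for k by (simp add: \<kappa>_def R0)
  have \<kappa>': "((\<lambda>t. \<kappa> t k) has_field_derivative 0) (at 0)" for k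
  proof -
    have "((\<lambda>t. coeff (R t) k) has_field_derivative coeff N k) (at 0)"
      unfolding R_def N_def r_def by (rule DERIV_coeff_prod_linear) simp
    hence "((\<lambda>t. \<kappa> t k) has_field_derivative coeff N k - 0 - 1 * coeff (line_poly p q w) k) (at 0)"
      unfolding \<kappa>_def by (intro DERIV_diff DERIV_const DERIV_cmult_right DERIV_ident)
    thus ?thesis by (simp add: N)
  qed
  have Cf: "C t \<in> forms {..n} s" for t
    unfolding C_def by (intro forms_add forms_sum forms_cst_mult D0f wf Ff) auto
  have C0: "C 0 = D0" by (simp add: C_def \<kappa>0)
  have lpC: "line_poly p q (C t) = R t" for t
  proof (rule poly_eqI)
    fix k
    have sm: "coeff (\<Sum>j\<le>s. smult (\<kappa> t j) (monom 1 j)) k = (if k \<le> s then \<kappa> t k else 0)"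
      by (simp add: coeff_sum if_distrib cong: if_cong)
    have "coeff (line_poly p q (C t)) k = coeff (line_poly p q D0) k + t * coeff (line_poly p q w) k +
        (if k \<le> s then \<kappa> t k else 0)"
      using sm by (simp add: C_def line_poly_simps(1,3,4) lpF)
    moreover have "coeff (line_poly p q D0) k = 0" "coeff (line_poly p q w) k = 0" "coeff (R t) k = 0" if "s < k"
      using that line_poly_form(1)[OF _ D0f, of p q] line_poly_form(1)[OF _ wf, of p q] degR[of t]
      by (auto intro!: coeff_eq_0)
    ultimately show "coeff (line_poly p q (C t)) k = coeff (R t) k"
      by (cases "k \<le> s") (auto simp: \<kappa>_def)
  qed
  have Cp: "evc p (C t) = 1" for t
    using line_poly_form(2)[OF _ Cf, of p q t] Rtop by (simp add: lpC)
  define y where "y t i = (\<lambda>j. r t i * p j - q j)" for t i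
  define E where "E t i j = evc (y t i) (partial j (C t))" for t i j
  have Ct: "(\<Sum>j\<le>n. x j * E t i j) = evc (y t i) (dir_deriv n x (C t))" for x t i
    by (simp add: E_def dir_deriv_def ev_simps)
  have "\<exists>E'. ((\<lambda>t. E t i j) has_field_derivative E') (at 0)" for i j
  proof -
    have ex: "\<exists>d. ((\<lambda>t. evc (y t i) g) has_field_derivative d) (at 0)" if "g \<in> polys {..n}" for g
    proof -
      have "((\<lambda>t. y t i j) has_field_derivative \<rho>' i * p j) (at 0)" for j
        unfolding y_def r_def by (auto intro!: derivative_eq_intros)
      hence "((\<lambda>t. evc (y t i) g) has_field_derivative (\<Sum>j\<le>n. evc (y 0 i) (partial j g) * (\<rho>' i * p j))) (at 0)"
        by (intro DERIV_evc[OF that]) auto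
      thus ?thesis by blast
    qed
    have part: "partial j (C t) = partial j D0 + cst t * partial j w + (\<Sum>k\<le>s. cst (\<kappa> t k) * partial j (F k))" for t
      by (simp add: C_def partial_add partial_mult partial_sum)
    obtain d0 where d0: "((\<lambda>t. evc (y t i) (partial j D0)) has_field_derivative d0) (at 0)"
      using ex[OF polys_partial[OF forms_polys[OF D0f]]] by blast
    obtain d1 where d1: "((\<lambda>t. evc (y t i) (partial j w)) has_field_derivative d1) (at 0)"
      using ex[OF polys_partial[OF forms_polys[OF wf]]] by blast
    have "\<forall>k. \<exists>d. k \<le> s \<longrightarrow> ((\<lambda>t. evc (y t i) (partial j (F k))) has_field_derivative d) (at 0)"
      using ex[OF polys_partial[OF forms_polys[OF Ff]]] by blast
    then obtain d2 where d2: "\<And>k. k \<le> s \<Longrightarrow> ((\<lambda>t. evc (y t i) (partial j (F k))) has_field_derivative d2 k) (at 0)"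
      by metis
    have "((\<lambda>t. E t i j) has_field_derivative d0 + (1 * evc (y 0 i) (partial j w) + d1 * 0) +
        (\<Sum>k\<le>s. 0 * evc (y 0 i) (partial j (F k)) + d2 k * \<kappa> 0 k)) (at 0)"
      unfolding E_def part by (simp only: ev_simps ring_hom_c_id)
        (intro DERIV_add DERIV_mult DERIV_sum DERIV_ident d0 d1 d2 \<kappa>'; simp)
    thus ?thesis by blast
  qed
  then obtain E' where E': "\<And>i j. ((\<lambda>t. E t i j) has_field_derivative E' i j) (at 0)" by metis
  \<comment> \<open>\<open>P x t i\<close> is linear in \<open>x\<close> for every \<open>t\<close>,
    hence so is its derivative \<open>P' x i\<close> at 0.\<close>
  define P where "P x t i = evc (y t i) (dir_deriv n x (C t))" for x t i
  define P' where "P' x i = (\<Sum>j\<le>n. x j * E' i j)" for x :: "nat \<Rightarrow> complex" and i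
  have P': "((\<lambda>t. P x t i) has_field_derivative P' x i) (at 0)" for x i
    unfolding P_def P'_def Ct[symmetric] by (intro DERIV_sum DERIV_cmult E')
  have P0: "P x 0 i = evc x (L i) * c i" if i: "i < s" for x i
  proof -
    have yi: "evc (y 0 i) (L k) = \<rho> i - \<rho> k" if "k < s" for k
      unfolding y_def linear_form_evc_diff[OF L(1)[OF that]] by (simp add: L(2)[OF that] \<rho>_def r_def)
    have "P x 0 i = evc x (L i) * (\<Prod>k\<in>{..<s} - {i}. evc (y 0 i) (L k))"
      unfolding P_def C0 D0_def using yi[OF i] by (intro evc_dir_deriv_prod[OF L(1) i]) auto
    also have "(\<Prod>k\<in>{..<s} - {i}. evc (y 0 i) (L k)) = c i"
      unfolding c_def by (intro prod.cong) (auto simp: yi)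
    finally show ?thesis .
  qed
  define CC where "CC = (\<Prod>i<s. c i)"
  have CC0: "CC \<noteq> 0" using c0 by (auto simp: CC_def)
  define K where "K = (\<Sum>i<s. P' p i * (\<Prod>k\<in>{..<s} - {i}. P p 0 k))"
  \<comment> \<open>The equation differentiated at \<open>t = 0\<close>, where the derivative of its
    left side vanishes because \<open>w\<close> is tangent.\<close>
  have key: "evc x w * CC = (\<Sum>i<s. P' x i * (\<Prod>k\<in>{..<s} - {i}. c k) * evc x (others s i L)) - evc x D0 * K" for x
  proof -
    obtain g where g: "g \<in> vanishing_ideal ?mon (decomposable_variety n s)"
      "\<And>D r. D \<in> forms {..n} s \<Longrightarrow> evc p D = 1 \<Longrightarrow> line_poly p q D = (\<Prod>i<s. [:- r i, 1:]) \<Longrightarrow>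
      evc (lk D) g = (\<Prod>i<s. evc (\<lambda>j. r i * p j - q j) (dir_deriv n x D)) -
         evc x D * (\<Prod>i<s. evc (\<lambda>j. r i * p j - q j) (dir_deriv n p D))"
      using decomposable_equation[of n s p q x] by blast
    have gC: "evc (lk (C t)) g = (\<Prod>i<s. P x t i) - evc x (C t) * (\<Prod>i<s. P p t i)" for t
      using g(2)[OF Cf Cp, of t "r t"] lpC[of t] by (simp add: P_def y_def R_def)
    have lkC: "((\<lambda>t. lk (C t) \<alpha>) has_field_derivative lk w \<alpha>) (at 0)" for \<alpha>
    proof -
      have "((\<lambda>t. lk D0 \<alpha> + t * lk w \<alpha> + (\<Sum>k\<le>s. \<kappa> t k * lk (F k) \<alpha>)) has_field_derivative
         0 + 1 * lk w \<alpha> + (\<Sum>k\<le>s. 0 * lk (F k) \<alpha>)) (at 0)"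
        by (intro DERIV_add DERIV_const DERIV_cmult_right DERIV_ident DERIV_sum \<kappa>')
      thus ?thesis by (simp add: C_def lookup_add lookup_sum)
    qed
    have evC: "((\<lambda>t. evc x (C t)) has_field_derivative evc x w) (at 0)"
      unfolding evc_form_expand[OF finite_atMost Cf] evc_form_expand[OF finite_atMost wf]
      by (intro DERIV_sum DERIV_cmult_right lkC)
    have gp: "g \<in> polys ?mon" using g(1) by (simp add: vanishing_ideal_def)
    have "((\<lambda>t. evc (lk (C t)) g) has_field_derivative (\<Sum>\<alpha>\<in>?mon. evc (lk (C 0)) (partial \<alpha> g) * lk w \<alpha>)) (at 0)"
      using gp by (rule DERIV_evc) (auto intro: lkC)
    hence d1: "((\<lambda>t. evc (lk (C t)) g) has_field_derivative 0) (at 0)"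
      unfolding C0 wt[OF g(1)] .
    have pr: "((\<lambda>t. \<Prod>i<s. P x t i) has_field_derivative (\<Sum>i<s. P' x i * (\<Prod>k\<in>{..<s} - {i}. P x 0 k))) (at 0)" for x
      by (rule has_field_derivative_prod) (rule P')
    have "((\<lambda>t. evc (lk (C t)) g) has_field_derivative
      (\<Sum>i<s. P' x i * (\<Prod>k\<in>{..<s} - {i}. P x 0 k)) -
      (evc x w * (\<Prod>i<s. P p 0 i) + K * evc x (C 0))) (at 0)"
      unfolding gC K_def by (intro DERIV_diff DERIV_mult pr evC)
    from DERIV_unique[OF d1 this] have
      "evc x w * (\<Prod>i<s. P p 0 i) = (\<Sum>i<s. P' x i * (\<Prod>k\<in>{..<s} - {i}. P x 0 k)) - K * evc x D0"
      by (simp add: C0 algebra_simps)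
    moreover have "(\<Prod>i<s. P p 0 i) = CC" unfolding CC_def using P0 L(2) by (intro prod.cong) auto
    moreover have "(\<Prod>k\<in>{..<s} - {i}. P x 0 k) = (\<Prod>k\<in>{..<s} - {i}. c k) * evc x (others s i L)" for i
    proof -
      have "(\<Prod>k\<in>{..<s} - {i}. P x 0 k) = (\<Prod>k\<in>{..<s} - {i}. c k * evc x (L k))"
        using P0 by (intro prod.cong) (auto simp: mult.commute)
      thus ?thesis by (simp add: ev_simps prod.distrib)
    qed
    ultimately show ?thesis by (simp add: mult_ac)
  qed
  define l0 where "l0 i = (\<Sum>j\<le>n. cst (E' i j * (\<Prod>k\<in>{..<s} - {i}. c k) / CC) * var j)" for i
  \<comment> \<open>The radial part of \<open>v\<close> and the multiple of the product by
    \<open>K / CC\<close> are absorbed into the multiplier of index 0.\<close>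
  define l where "l i = (if i = 0 then l0 0 + cst (evc p v - K / CC) * L 0 else l0 i)" for i
  have l0f: "l0 i \<in> forms {..n} 1" for i unfolding l0_def by (intro forms_sum forms_cst_mult forms_var) auto
  have el0: "evc x (l0 i) = P' x i * (\<Prod>k\<in>{..<s} - {i}. c k) / CC" for x i
    by (simp add: l0_def ev_simps P'_def sum_distrib_left sum_distrib_right sum_divide_distrib mult_ac)
  show ?thesis
  proof (rule that[of l])
    show "l i \<in> forms {..n} 1" if "i < s" for i
      unfolding l_def using l0f L(1)[OF s] by (auto intro: forms_add forms_cst_mult)
    show "v = (\<Sum>i<s. l i * others s i L)"
    proof (rule poly_eq_of_evc_eq)
      fix x
      have "(\<Sum>i<s. l i * others s i L) = (\<Sum>i<s. l0 i * others s i L) +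
         (\<Sum>i<s. if i = 0 then cst (evc p v - K / CC) * (L 0 * others s 0 L) else 0)"
        unfolding sum.distrib[symmetric] by (intro sum.cong) (auto simp: l_def distrib_right mult.assoc)
      also have "L 0 * others s 0 L = D0" unfolding D0_def using s by (subst prod.remove[of _ 0]) auto
      finally have "(\<Sum>i<s. l i * others s i L) = (\<Sum>i<s. l0 i * others s i L) + cst (evc p v - K / CC) * D0"
        using s by simp
      hence "evc x (\<Sum>i<s. l i * others s i L) =
         (\<Sum>i<s. P' x i * (\<Prod>k\<in>{..<s} - {i}. c k) * evc x (others s i L)) / CC + (evc p v - K / CC) * evc x D0"
        by (simp add: ev_simps el0 sum_divide_distrib mult_ac)
      also have "\<dots> = evc x w + evc p v * evc x D0"
      proof -
        have "S / c + (v - K / c) * D = W + v * D" if "W * c = S - D * K" "c \<noteq> 0" for S W c K D v :: complex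
        proof -
          have "S = W * c + D * K" using that(1) by simp
          thus ?thesis using that(2) by (simp add: field_simps)
        qed
        thus ?thesis using key[of x] CC0 by blast
      qed
      also have "\<dots> = evc x v" by (simp add: w_def ev_simps)
      finally show "evc x v = evc x (\<Sum>i<s. l i * others s i L)" by simp
    qed
  qed
qed

section \<open>Formal curves\<close>

text \<open>Finite-dimensional duality: a subspace annihilated by no nonzero functional of the
  coordinates in \<open>K\<close> projects onto all of them.\<close>

lemma surjective_of_annihilator:
  fixes U :: "('k \<Rightarrow> complex) set"
  assumes "finite K"
    and U: "\<And>u v. u \<in> U \<Longrightarrow> v \<in> U \<Longrightarrow> (\<lambda>k. u k + v k) \<in> U" "\<And>u c. u \<in> U \<Longrightarrow> (\<lambda>k. c * u k) \<in> U" "U \<noteq> {}"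
    and "\<And>w k. (\<And>u. u \<in> U \<Longrightarrow> (\<Sum>k\<in>K. w k * u k) = 0) \<Longrightarrow> k \<in> K \<Longrightarrow> w k = 0"
  shows "\<exists>u\<in>U. \<forall>k\<in>K. u k = c k"
  using assms(1,5)
proof (induction K arbitrary: c rule: finite_induct)
  case empty thus ?case using U(3) by auto
next
  case (insert k0 K)
  have IH: "\<exists>u\<in>U. \<forall>k\<in>K. u k = c k" for c
  proof (rule insert.IH)
    fix w k assume w: "\<And>u. u \<in> U \<Longrightarrow> (\<Sum>k\<in>K. w k * u k) = 0" and k: "k \<in> K"
    define w' where "w' = w(k0 := 0)"
    have "(\<Sum>k\<in>insert k0 K. w' k * u k) = 0" if "u \<in> U" for u
    proof -
      have "(\<Sum>k\<in>K. w' k * u k) = (\<Sum>k\<in>K. w k * u k)"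
        using insert.hyps by (intro sum.cong) (auto simp: w'_def)
      thus ?thesis using w[OF that] insert.hyps by (simp add: w'_def)
    qed
    hence "w' k = 0" using insert.prems[of w' k] k by blast
    moreover have "k \<noteq> k0" using k insert.hyps by auto
    ultimately show "w k = 0" by (simp add: w'_def)
  qed
  \<comment> \<open>Otherwise the coordinate \<open>k0\<close> is determined on \<open>U\<close> by
    those in \<open>K\<close>, and this linear relation is a functional \<open>w\<close> with
    \<open>w k0 = 1\<close> that annihilates \<open>U\<close>.\<close>
  have "\<exists>u\<in>U. (\<forall>k\<in>K. u k = 0) \<and> u k0 \<noteq> 0"
  proof (rule ccontr)
    assume "\<not> ?thesis"
    hence neg: "u k0 = 0" if "u \<in> U" "\<And>k. k \<in> K \<Longrightarrow> u k = 0" for u using that by auto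
    define e where "e j = (SOME u. u \<in> U \<and> (\<forall>k\<in>K. u k = (if k = j then 1 else 0)))" for j
    have "e j \<in> U \<and> (\<forall>k\<in>K. e j k = (if k = j then 1 else 0))" for j
      using someI_ex[OF IH[of "\<lambda>k. if k = j then 1 else 0", unfolded Bex_def]] unfolding e_def .
    hence e: "\<And>j. e j \<in> U" "\<And>j k. k \<in> K \<Longrightarrow> e j k = (if k = j then 1 else 0)" by simp_all
    define w where "w k = (if k = k0 then 1 else - e k k0)" for k
    have Usum: "(\<lambda>k. \<Sum>j\<in>A. a j * e j k) \<in> U" if "finite A" for A a
      using that
    proof (induction A rule: finite_induct)
      case empty
      from U(3) obtain u where "u \<in> U" by blast
      from U(2)[OF this, of 0] show ?case by simp
    next
      case (insert x F)
      from U(1)[OF U(2)[OF e(1)[of x], of "a x"] insert.IH] show ?case using insert.hyps by simp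
    qed
    have "(\<Sum>k\<in>insert k0 K. w k * u k) = 0" if u: "u \<in> U" for u
    proof -
      let ?u = "\<lambda>k. u k + (\<Sum>j\<in>K. - u j * e j k)"
      have uU: "?u \<in> U" by (intro U(1) u Usum insert.hyps)
      have u0: "?u k = 0" if "k \<in> K" for k
      proof -
        have "(\<Sum>j\<in>K. - u j * e j k) = (\<Sum>j\<in>K. if j = k then - u k else 0)"
          using e(2)[OF that] by (intro sum.cong) auto
        thus ?thesis using that insert.hyps by simp
      qed
      have "?u k0 = 0" by (rule neg[OF uU u0])
      moreover have "(\<Sum>k\<in>K. w k * u k) = (\<Sum>j\<in>K. - u j * e j k0)"
        using insert.hyps by (intro sum.cong) (auto simp: w_def)
      ultimately show ?thesis using insert.hyps by (simp add: w_def)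
    qed
    hence "w k0 = 0" using insert.prems[of w k0] by blast
    thus False by (simp add: w_def)
  qed
  then obtain u0 where u0: "u0 \<in> U" "\<And>k. k \<in> K \<Longrightarrow> u0 k = 0" "u0 k0 \<noteq> 0" by blast
  obtain u1 where u1: "u1 \<in> U" "\<And>k. k \<in> K \<Longrightarrow> u1 k = c k" using IH by blast
  let ?u = "\<lambda>k. u1 k + (c k0 - u1 k0) / u0 k0 * u0 k"
  show ?case
  proof (rule bexI[of _ ?u])
    show "?u \<in> U" by (intro U u0 u1)
    show "\<forall>k\<in>insert k0 K. ?u k = c k" using u0 u1 by auto
  qed
qed

text \<open>A functional annihilating the image assembles into a polynomial \<open>h\<close> as in
  \<open>critical\<close>, so it is zero.\<close>

lemma deformations_surjective:
  assumes "\<not> critical n d s f" "\<And>i. i < s \<Longrightarrow> L i \<in> forms {..n} 1 \<and> L i \<noteq> 0"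
    "annihilates n d s (\<Prod>i<s. L i) f"
  shows "\<exists>l. (\<forall>i. l i \<in> forms {..n} 1) \<and>
     (\<forall>\<beta>\<in>cofactor_exps n d s. apol f ((\<Sum>i<s. l i * others s i L) * xpow \<beta>) = c \<beta>)"
proof -
  let ?B = "cofactor_exps n d s"
  let ?F = "\<lambda>l \<beta>. apol f ((\<Sum>i<s. l i * others s i L) * xpow \<beta>)"
  define U where "U = ?F ` {l. \<forall>i. l i \<in> forms {..n} 1}"
  have inU: "?F l \<in> U" if "\<And>i. l i \<in> forms {..n} 1" for l using that by (auto simp: U_def)
  have "\<exists>u\<in>U. \<forall>\<beta>\<in>?B. u \<beta> = c \<beta>"
  proof (rule surjective_of_annihilator)
    show "finite ?B" by simp
  next
    fix u v assume "u \<in> U" "v \<in> U"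
    then obtain l m where lm: "\<And>i. l i \<in> forms {..n} 1" "\<And>i. m i \<in> forms {..n} 1" "u = ?F l" "v = ?F m"
      by (auto simp: U_def)
    have "?F (\<lambda>i. l i + m i) \<in> U" by (intro inU forms_add lm)
    moreover have "?F (\<lambda>i. l i + m i) = (\<lambda>k. u k + v k)"
      by (rule ext) (simp add: lm distrib_right sum.distrib apol_add)
    ultimately show "(\<lambda>k. u k + v k) \<in> U" by simp
  next
    fix u c assume "u \<in> U"
    then obtain l where l: "\<And>i. l i \<in> forms {..n} 1" "u = ?F l" by (auto simp: U_def)
    have "?F (\<lambda>i. cst c * l i) \<in> U" by (intro inU forms_cst_mult l)
    moreover have "?F (\<lambda>i. cst c * l i) = (\<lambda>k. c * u k)"
    proof
      fix \<beta>
      have "(\<Sum>i<s. cst c * l i * others s i L) * xpow \<beta> = cst c * ((\<Sum>i<s. l i * others s i L) * xpow \<beta>)"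
        by (simp add: sum_distrib_left mult.assoc)
      thus "?F (\<lambda>i. cst c * l i) \<beta> = c * u \<beta>" by (simp only: apol_cst_mult l(2))
    qed
    ultimately show "(\<lambda>k. c * u k) \<in> U" by simp
  next
    show "U \<noteq> {}" using inU[of "\<lambda>_. 0"] by auto
  next
    fix w b assume w: "\<And>u. u \<in> U \<Longrightarrow> (\<Sum>\<beta>\<in>?B. w \<beta> * u \<beta>) = 0" and b: "b \<in> ?B"
    define h where "h = (\<Sum>\<beta>\<in>?B. cst (w \<beta>) * xpow \<beta>)"
    have lkh: "lk h \<beta> = (if \<beta> \<in> ?B then w \<beta> else 0)" for \<beta>
      by (simp add: h_def lookup_sum xpow_def lookup_single when_def if_distrib cong: if_cong)
    have kh: "ks h \<subseteq> ?B"
      by (auto simp: in_keys_iff lkh simp del: lookup_not_eq_zero_eq_in_keys split: if_splits)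
    have "apol f (l * others s i L * h) = 0" if i: "i < s" and l: "l \<in> forms {..n} 1" for i l
    proof -
      define l' where "l' j = (if j = i then l else 0)" for j
      have "(\<Sum>j<s. l' j * others s j L) = (\<Sum>j<s. if j = i then l * others s i L else 0)"
        by (intro sum.cong) (auto simp: l'_def)
      hence sm: "(\<Sum>j<s. l' j * others s j L) = l * others s i L" using i by simp
      have "?F l' \<in> U" using l by (intro inU) (auto simp: l'_def)
      from w[OF this] have "(\<Sum>\<beta>\<in>?B. w \<beta> * apol f (l * others s i L * xpow \<beta>)) = 0" by (simp add: sm)
      moreover have "apol f (l * others s i L * h) = (\<Sum>\<beta>\<in>?B. lk h \<beta> * apol f (l * others s i L * xpow \<beta>))"
        by (rule apol_mult_expand[OF _ kh]) simp
      ultimately show ?thesis by (simp add: lkh)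
    qed
    hence "h = 0" using assms kh unfolding critical_def by blast
    thus "w b = 0" using lkh[of b] b by simp
  qed
  thus ?thesis by (auto simp: U_def)
qed

section \<open>Lifting deformations to power series\<close>

lemma fps_prod_nth_cong:
  fixes A B :: "'i \<Rightarrow> 'a::comm_ring_1 fps"
  assumes "\<And>i j. i \<in> S \<Longrightarrow> j \<le> k \<Longrightarrow> fps_nth (A i) j = fps_nth (B i) j" "j \<le> k"
  shows "fps_nth (\<Prod>i\<in>S. A i) j = fps_nth (\<Prod>i\<in>S. B i) j"
  using assms
proof (induction S arbitrary: j rule: infinite_finite_induct)
  case (insert x S)
  show ?case unfolding prod.insert[OF insert.hyps] fps_mult_nth
    using insert.IH insert.prems by (intro sum.cong refl arg_cong2[where f = "(*)"]) auto
qed auto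

lemma fps_prod_nth_0: "fps_nth (\<Prod>i\<in>S. A i) 0 = (\<Prod>i\<in>S. fps_nth (A i :: 'a::comm_ring_1 fps) 0)"
  by (induction S rule: infinite_finite_induct) auto

text \<open>Products of two perturbation terms start in order \<open>2 m\<close>, so a new
  coefficient of order \<open>m\<close> enters the equation of this order linearly, through the
  constant terms of the other factors.\<close>

lemma fps_prod_perturb_nth:
  fixes A :: "'i \<Rightarrow> 'a::comm_ring_1 fps"
  assumes "finite S" "m > 0" "j \<le> m"
  shows "fps_nth (\<Prod>i\<in>S. A i + fps_const (c i) * fps_X ^ m) j = fps_nth (\<Prod>i\<in>S. A i) j +
    (if j = m then \<Sum>i\<in>S. c i * (\<Prod>k\<in>S - {i}. fps_nth (A k) 0) else 0)"
  using assms(1,3)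
proof (induction S arbitrary: j rule: finite_induct)
  case empty thus ?case by simp
next
  case (insert x S)
  let ?P = "\<Prod>i\<in>S. A i + fps_const (c i) * fps_X ^ m" and ?Q = "\<Prod>i\<in>S. A i"
  let ?E = "\<Sum>i\<in>S. c i * (\<Prod>k\<in>S - {i}. fps_nth (A k) 0)"
  have "fps_nth (A x * ?P) j = (\<Sum>a=0..j. fps_nth (A x) a * fps_nth ?Q (j - a) +
      (if a = 0 \<and> j = m then fps_nth (A x) 0 * ?E else 0))"
    unfolding fps_mult_nth using insert.IH insert.prems
    by (intro sum.cong refl) (auto simp: distrib_left)
  also have "\<dots> = fps_nth (A x * ?Q) j + (if j = m then fps_nth (A x) 0 * ?E else 0)"
    by (cases "j = m") (simp_all add: fps_mult_nth sum.distrib)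
  finally have 1: "fps_nth (A x * ?P) j = fps_nth (A x * ?Q) j + (if j = m then fps_nth (A x) 0 * ?E else 0)" .
  have "fps_nth (fps_const (c x) * fps_X ^ m * ?P) j = (if j = m then c x * fps_nth ?P 0 else 0)"
    using insert.prems by (simp add: mult.assoc fps_X_power_mult_nth)
  moreover have "fps_nth ?P 0 = (\<Prod>k\<in>S. fps_nth (A k) 0)"
    using insert.IH[of 0] assms(2) by (simp add: fps_prod_nth_0)
  ultimately have 2: "fps_nth (fps_const (c x) * fps_X ^ m * ?P) j =
      (if j = m then c x * (\<Prod>k\<in>S. fps_nth (A k) 0) else 0)" by simp
  have 3: "(\<Sum>i\<in>S. c i * (\<Prod>k\<in>insert x S - {i}. fps_nth (A k) 0)) = fps_nth (A x) 0 * ?E"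
    unfolding sum_distrib_left
  proof (intro sum.cong refl)
    fix i assume "i \<in> S"
    hence "insert x S - {i} = insert x (S - {i})" using insert.hyps by auto
    thus "c i * (\<Prod>k\<in>insert x S - {i}. fps_nth (A k) 0) = fps_nth (A x) 0 * (c i * (\<Prod>k\<in>S - {i}. fps_nth (A k) 0))"
      using insert.hyps by (simp add: mult_ac)
  qed
  show ?case
    unfolding prod.insert[OF insert.hyps] sum.insert[OF insert.hyps] distrib_right fps_add_nth 1 2
    using insert.hyps 3 by simp
qed

text \<open>From order 2 on, the new coefficients of the factors enter the equation of their order
  only through the surjective map of \<open>deformations_surjective\<close>, so they can be chosen
  to cancel what the lower ones produce.\<close>

lemma formal_curve:
  assumes nc: "\<not> critical n d s f" and L: "\<And>i. i < s \<Longrightarrow> L i \<in> forms {..n} 1 \<and> L i \<noteq> 0"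
    "\<And>i. L i \<in> forms {..n} 1" and ann: "annihilates n d s (\<Prod>i<s. L i) f"
    and l: "\<And>i. l i \<in> forms {..n} 1" "annihilates n d s (\<Sum>i<s. l i * others s i L) f"
  obtains \<Lambda> where "\<And>i. fps_nth (\<Lambda> i) 0 = L i" "\<And>i. fps_nth (\<Lambda> i) 1 = l i"
    "\<And>i k. fps_nth (\<Lambda> i) k \<in> forms {..n} 1" "\<And>k. annihilates n d s (fps_nth (\<Prod>i<s. \<Lambda> i) k) f"
proof -
  \<comment> \<open>Stage \<open>k\<close> controls the orders up to \<open>Suc k\<close>, so that
    the prescribed orders 0 and 1 form stage 0.\<close>
  define P where "P k A \<longleftrightarrow> (\<forall>i. fps_nth (A i) 0 = L i \<and> fps_nth (A i) 1 = l i \<and> (\<forall>j. fps_nth (A i) j \<in> forms {..n} 1)) \<and>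
    (\<forall>j\<le>Suc k. annihilates n d s (fps_nth (\<Prod>i<s. A i) j) f)" for k and A :: "nat \<Rightarrow> (nat mpoly) fps"
  have "\<exists>A. \<forall>k. P k (A k) \<and> (\<forall>i. \<forall>j\<le>Suc k. fps_nth (A (Suc k) i) j = fps_nth (A k i) j)"
  proof (rule dependent_nat_choice)
    let ?A = "\<lambda>i. fps_const (L i) + fps_const (l i) * fps_X ^ 1"
    have pn: "fps_nth (\<Prod>i<s. ?A i) j = fps_nth (\<Prod>i<s. fps_const (L i)) j +
        (if j = 1 then \<Sum>i<s. l i * others s i L else 0)" if "j \<le> 1" for j
      using fps_prod_perturb_nth[of "{..<s}" 1 j "\<lambda>i. fps_const (L i)" l] that by simp
    have cp: "(\<Prod>i<s. fps_const (L i)) = fps_const (\<Prod>i<s. L i)"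
      by (induction s) (auto simp: fps_const_mult[symmetric] simp del: fps_const_mult)
    have "P 0 ?A"
      unfolding P_def
    proof (intro conjI allI impI)
      fix j :: nat assume "j \<le> Suc 0"
      hence "j = 0 \<or> j = 1" by auto
      thus "annihilates n d s (fps_nth (\<Prod>i<s. ?A i) j) f"
        using pn[of j] ann l(2) by (auto simp: cp)
    next
      fix i j show "fps_nth (?A i) j \<in> forms {..n} 1" using L(2) l(1) by (cases "j = 0"; cases "j = 1") auto
    qed auto
    thus "\<exists>A. P 0 A" by blast
  next
    fix A k assume A: "P k A"
    let ?m = "Suc (Suc k)"
    obtain b where b: "\<And>i. b i \<in> forms {..n} 1"
      "\<And>\<beta>. \<beta> \<in> cofactor_exps n d s \<Longrightarrow> apol f ((\<Sum>i<s. b i * others s i L) * xpow \<beta>) =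
         - apol f (fps_nth (\<Prod>i<s. A i) ?m * xpow \<beta>)"
      using deformations_surjective[OF nc L(1) ann, of "\<lambda>\<beta>. - apol f (fps_nth (\<Prod>i<s. A i) ?m * xpow \<beta>)"] by blast
    let ?A = "\<lambda>i. A i + fps_const (b i) * fps_X ^ ?m"
    have nth: "fps_nth (?A i) j = fps_nth (A i) j + (if j = ?m then b i else 0)" for i j by simp arith
    have pn: "fps_nth (\<Prod>i<s. ?A i) j = fps_nth (\<Prod>i<s. A i) j +
        (if j = ?m then \<Sum>i<s. b i * others s i L else 0)" if "j \<le> ?m" for j
      using fps_prod_perturb_nth[of "{..<s}" ?m j A b] that A by (simp add: P_def)
    have "P (Suc k) ?A"
      unfolding P_def
    proof (intro conjI allI impI)
      fix i
      show "fps_nth (?A i) 0 = L i" "fps_nth (?A i) 1 = l i" using A unfolding nth P_def by auto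
      show "fps_nth (?A i) j \<in> forms {..n} 1" for j
        using A b(1) unfolding nth P_def by (auto intro: forms_add)
    next
      fix j assume j: "j \<le> ?m"
      show "annihilates n d s (fps_nth (\<Prod>i<s. ?A i) j) f"
      proof (cases "j = ?m")
        case False thus ?thesis using A j unfolding pn[OF j] P_def by auto
      next
        case True
        thus ?thesis unfolding pn[OF j] annihilates_def using b(2) by (simp add: distrib_right apol_add)
      qed
    qed
    moreover have "\<forall>i. \<forall>j\<le>Suc k. fps_nth (?A i) j = fps_nth (A i) j" unfolding nth by auto
    ultimately show "\<exists>B. P (Suc k) B \<and> (\<forall>i. \<forall>j\<le>Suc k. fps_nth (B i) j = fps_nth (A i) j)" by blast
  qed
  then obtain A where A0: "\<forall>k. P k (A k) \<and> (\<forall>i. \<forall>j\<le>Suc k. fps_nth (A (Suc k) i) j = fps_nth (A k i) j)" ..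
  have A: "P k (A k)" "j \<le> Suc k \<Longrightarrow> fps_nth (A (Suc k) i) j = fps_nth (A k i) j" for k i j
    by (rule conjunct1[OF spec[OF A0]])
       (rule conjunct2[OF spec[OF A0, of k], THEN spec, of i, THEN spec, THEN mp])
  have stable: "fps_nth (A k i) j = fps_nth (A j i) j" if "j \<le> k" for i j k
    using that by (induction k rule: dec_induct) (auto simp: A(2))
  \<comment> \<open>Diagonal limit: the coefficient of order \<open>j\<close> does not change after
    stage \<open>j\<close>.\<close>
  define \<Lambda> where "\<Lambda> i = Abs_fps (\<lambda>j. fps_nth (A j i) j)" for i
  show ?thesis
  proof (rule that[of \<Lambda>])
    show "fps_nth (\<Lambda> i) 0 = L i" for i using A(1)[of 0] by (simp add: \<Lambda>_def P_def)
    show "fps_nth (\<Lambda> i) 1 = l i" for i using A(1)[of 1] by (simp add: \<Lambda>_def P_def)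
    show "fps_nth (\<Lambda> i) k \<in> forms {..n} 1" for i k using A(1)[of k] by (simp add: \<Lambda>_def P_def)
    show "annihilates n d s (fps_nth (\<Prod>i<s. \<Lambda> i) k) f" for k
    proof -
      have "fps_nth (\<Prod>i<s. \<Lambda> i) k = fps_nth (\<Prod>i<s. A k i) k"
        by (rule fps_prod_nth_cong[where k = k]) (auto simp: \<Lambda>_def intro: stable[symmetric])
      thus ?thesis using A(1)[of k] by (simp add: P_def)
    qed
  qed
qed

section \<open>Evaluation along formal curves\<close>

abbreviation evf :: "('v \<Rightarrow> complex fps) \<Rightarrow> 'v mpoly \<Rightarrow> complex fps" where "evf \<equiv> ev fps_const"

lemma ring_hom_c_fps_const [simp]: "ring_hom_c (fps_const :: complex \<Rightarrow> complex fps)"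
  by (simp add: ring_hom_c_def)

lemma evf_nth_cong:
  assumes "p \<in> polys I" "\<And>i j. i \<in> I \<Longrightarrow> j \<le> k \<Longrightarrow> fps_nth (x i) j = fps_nth (y i) j" "j \<le> k"
  shows "fps_nth (evf x p) j = fps_nth (evf y p) j"
  using assms(1,3)
proof (induction p arbitrary: j rule: polys_induct)
  case (mult p q)
  thus ?case by (auto simp: ev_simps fps_mult_nth intro!: sum.cong arg_cong2[where f = "(*)"])
qed (auto simp: ev_simps assms(2))

lemma evf_nth_0: "fps_nth (evf x p) 0 = evc (\<lambda>i. fps_nth (x i) 0) p"
  by (rule ev_ev[where g = "\<lambda>a. a"]) auto

section \<open>Irreducible closed sets\<close>

text \<open>Nullstellensatz for the kernel of the substitution of \<open>\<Gamma> \<alpha>\<close>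
  times a new indeterminate for the variable \<alpha>. The indeterminate records the degree, so a
  form lies in the kernel exactly when it vanishes along the curve. The factor
  \<open>var \<alpha>0\<close> keeps the point off the origin.\<close>

lemma generic_point_lemma:
  fixes \<Gamma> :: "'i \<Rightarrow> complex fps"
  assumes "finite I" "\<alpha>0 \<in> I" "\<Gamma> \<alpha>0 \<noteq> 0" "h \<in> forms I m" "evf \<Gamma> h \<noteq> 0"
  shows "\<exists>a\<in>zero_locus I {g. (\<exists>m. g \<in> forms I m) \<and> evf \<Gamma> g = 0}. peval h a \<noteq> 0"
proof -
  define \<Phi> where "\<Phi> = ev (\<lambda>c. [:fps_const c:]) (\<lambda>\<alpha>. [:0, 1:] * [:\<Gamma> \<alpha>:])"
  have hom: "ring_hom_c (\<lambda>c. [:fps_const c:])" by (simp add: ring_hom_c_def one_pCons)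
  have \<Phi>f: "\<Phi> g = [:0, 1:] ^ m * [:evf \<Gamma> g:]" if "g \<in> forms I m" for g m
  proof -
    have "\<Phi> g = [:0, 1:] ^ m * ev (\<lambda>c. [:fps_const c:]) (\<lambda>\<alpha>. [:\<Gamma> \<alpha>:]) g"
      unfolding \<Phi>_def by (rule ev_scale_form[OF hom that])
    also have "ev (\<lambda>c. [:fps_const c:]) (\<lambda>\<alpha>. [:\<Gamma> \<alpha>:]) g = [:evf \<Gamma> g:]"
      by (rule ev_ev[symmetric, where g = "\<lambda>a. a"]) (auto simp: hom)
    finally show ?thesis .
  qed
  define P where "P = {g \<in> polys I. \<Phi> g = 0}"
  have "poly_ideal I P"
    unfolding poly_ideal_def P_def \<Phi>_def by (auto simp: ev_simps hom intro: polys_intros)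
  moreover have H: "var \<alpha>0 * h \<in> forms I (1 + m)" using assms by (intro forms_mult forms_var)
  moreover have "(var \<alpha>0 * h) ^ k \<notin> P" for k
  proof
    assume "(var \<alpha>0 * h) ^ k \<in> P"
    hence "\<Phi> (var \<alpha>0 * h) ^ k = 0" by (simp add: P_def \<Phi>_def ev_simps hom)
    hence "evf \<Gamma> (var \<alpha>0 * h) = 0" unfolding \<Phi>f[OF H] by simp
    thus False using assms by (simp add: ev_simps)
  qed
  ultimately obtain x where x: "\<And>g. g \<in> P \<Longrightarrow> evc x g = 0" "evc x (var \<alpha>0 * h) \<noteq> 0"
    using nullstellensatz_power[OF assms(1), of P "var \<alpha>0 * h"] forms_polys[OF H] by blast
  define a where "a = (\<Sum>i\<in>I. sg i (x i))"
  have lka: "lk a i = (if i \<in> I then x i else 0)" for i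
    using assms(1) by (simp add: a_def lookup_sum lookup_single when_def)
  have eva: "peval g a = evc x g" if "g \<in> polys I" for g
    unfolding peval_evc by (rule ev_cong_polys[OF that]) (simp add: lka)
  have "x \<alpha>0 \<noteq> 0" "evc x h \<noteq> 0" using x(2) by (auto simp: ev_simps)
  hence "lk a \<alpha>0 \<noteq> 0" using assms(2) by (simp add: lka)
  moreover have "ks a \<subseteq> I"
    by (auto simp: in_keys_iff lka simp del: lookup_not_eq_zero_eq_in_keys split: if_splits)
  ultimately have "a \<in> proj_space I" by (auto simp: proj_space_def)
  moreover have "peval g a = 0" if "g \<in> forms I m" "evf \<Gamma> g = 0" for g m
    using x(1)[of g] \<Phi>f[OF that(1)] that forms_polys[OF that(1)] eva by (simp add: P_def)
  ultimately show ?thesis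
    using \<open>evc x h \<noteq> 0\<close> eva[OF forms_polys[OF assms(4)]] by (intro bexI[of _ a]) (auto simp: zero_locus_def)
qed

lemma zariski_closed_form:
  assumes "zariski_closed I A" "a \<in> proj_space I" "a \<notin> A"
  obtains g m where "g \<in> forms I m" "peval g a \<noteq> 0" "\<And>b. b \<in> A \<Longrightarrow> peval g b = 0"
  using assms unfolding zariski_closed_def zero_locus_def by blast

text \<open>The set is the Zariski closure of the formal curve. Two forms that do not vanish along
  it have a product that does not, since power series form a domain, and
  \<open>generic_point_lemma\<close> gives a point of the set where this product is nonzero.\<close>

lemma irreducible_curve:
  assumes "finite I" "\<alpha>0 \<in> I" "\<Gamma> \<alpha>0 \<noteq> 0"
  shows "irreducible_closed I (zero_locus I {g. (\<exists>m. g \<in> forms I m) \<and> evf \<Gamma> g = 0})" (is "irreducible_closed I ?C")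
proof -
  have gen: "\<exists>a\<in>?C. peval h a \<noteq> 0" if "h \<in> forms I m" "evf \<Gamma> h \<noteq> 0" for h m
    using assms that by (intro generic_point_lemma[of I \<alpha>0 \<Gamma> h m])
  have "zariski_closed I ?C"
    unfolding zariski_closed_def by (rule exI, rule conjI[OF _ refl]) auto
  moreover have "?C \<noteq> {}" using gen[OF forms_1] by (auto simp: ev_simps)
  moreover have "?C \<subseteq> A \<or> ?C \<subseteq> B" if AB: "zariski_closed I A" "zariski_closed I B" "?C \<subseteq> A \<union> B" for A B
  proof (rule ccontr)
    assume "\<not> ?thesis"
    then obtain a b where ab: "a \<in> ?C" "a \<notin> A" "b \<in> ?C" "b \<notin> B" by blast
    have abp: "a \<in> proj_space I" "b \<in> proj_space I" using ab by (auto simp: zero_locus_def)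
    obtain g m where g: "g \<in> forms I m" "peval g a \<noteq> 0" "\<And>c. c \<in> A \<Longrightarrow> peval g c = 0"
      using zariski_closed_form[OF AB(1) abp(1) ab(2)] by blast
    obtain h k where h: "h \<in> forms I k" "peval h b \<noteq> 0" "\<And>c. c \<in> B \<Longrightarrow> peval h c = 0"
      using zariski_closed_form[OF AB(2) abp(2) ab(4)] by blast
    have "evf \<Gamma> g \<noteq> 0" using g(1,2) ab(1) by (auto simp: zero_locus_def)
    moreover have "evf \<Gamma> h \<noteq> 0" using h(1,2) ab(3) by (auto simp: zero_locus_def)
    ultimately have "evf \<Gamma> (g * h) \<noteq> 0" by (simp add: ev_simps)
    then obtain c where c: "c \<in> ?C" "peval (g * h) c \<noteq> 0" using gen[OF forms_mult[OF g(1) h(1)]] by blast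
    hence "c \<in> A \<union> B" using AB(3) by blast
    thus False using c(2) g(3) h(3) by (auto simp: peval_evc ev_simps)
  qed
  ultimately show ?thesis unfolding irreducible_closed_def by blast
qed

lemma zero_locus_scale:
  assumes "B \<subseteq> (\<Union>m. forms I m)" "a \<in> zero_locus I B" "b \<in> proj_space I" "b = cscale c a"
  shows "b \<in> zero_locus I B"
proof -
  have "peval g b = 0" if gB: "g \<in> B" for g
  proof -
    obtain m where g: "g \<in> forms I m" using assms(1) gB by blast
    have "lk b = (\<lambda>i. c * lk a i)" by (auto simp: assms(4))
    hence "peval g b = c ^ m * peval g a" using ev_scale_form[OF _ g, of "\<lambda>a. a" c "lk a"] by (simp add: peval_evc)
    thus ?thesis using assms(2) gB by (auto simp: zero_locus_def)
  qed
  thus ?thesis using assms(3) by (simp add: zero_locus_def)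
qed

text \<open>The 2 by 2 minors with \<open>a\<close> are its equations. A closed set containing
  \<open>a\<close> contains all its nonzero multiples, whence irreducibility.\<close>

lemma irreducible_point:
  assumes "a \<in> proj_space I"
  shows "irreducible_closed I {b \<in> proj_space I. \<exists>c. b = cscale c a}" (is "irreducible_closed I ?C")
proof -
  define m where "m \<alpha> \<beta> = cst (lk a \<alpha>) * var \<beta> - cst (lk a \<beta>) * var \<alpha>" for \<alpha> \<beta>
  define B where "B = (\<lambda>(\<alpha>, \<beta>). m \<alpha> \<beta>) ` (I \<times> I)"
  have em: "peval (m \<alpha> \<beta>) b = lk a \<alpha> * lk b \<beta> - lk a \<beta> * lk b \<alpha>" for \<alpha> \<beta> b
    by (simp add: m_def peval_evc ev_simps)
  have "m \<alpha> \<beta> \<in> forms I 1" if "\<alpha> \<in> I" "\<beta> \<in> I" for \<alpha> \<beta>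
    unfolding m_def using that by (intro forms_diff forms_cst_mult forms_var)
  hence B: "B \<subseteq> forms I 1" by (auto simp: B_def)
  have "?C = zero_locus I B"
  proof (intro set_eqI iffI)
    fix b assume "b \<in> ?C" thus "b \<in> zero_locus I B" by (auto simp: zero_locus_def B_def em)
  next
    fix b assume b: "b \<in> zero_locus I B"
    obtain \<alpha> where \<alpha>: "\<alpha> \<in> I" "lk a \<alpha> \<noteq> 0"
      using assms by (auto simp: proj_space_def) (metis in_keys_iff keys_eq_empty ex_in_conv subsetD)
    have "b = cscale (lk b \<alpha> / lk a \<alpha>) a"
    proof (rule poly_mapping_eqI)
      fix \<beta>
      show "lk b \<beta> = lk (cscale (lk b \<alpha> / lk a \<alpha>) a) \<beta>"
      proof (cases "\<beta> \<in> I")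
        case True
        hence "m \<alpha> \<beta> \<in> B" using \<alpha> by (auto simp: B_def)
        hence "peval (m \<alpha> \<beta>) b = 0" using b by (auto simp: zero_locus_def)
        thus ?thesis using \<alpha> by (simp add: em field_simps)
      next
        case False
        hence "\<beta> \<notin> ks a" "\<beta> \<notin> ks b" using assms b by (auto simp: proj_space_def zero_locus_def)
        thus ?thesis by (simp add: in_keys_iff)
      qed
    qed
    thus "b \<in> ?C" using b by (auto simp: zero_locus_def)
  qed
  hence "zariski_closed I ?C" unfolding zariski_closed_def using B by blast
  moreover have aC: "a \<in> ?C" using assms by (auto intro!: exI[of _ 1] poly_mapping_eqI)
  moreover have sub: "?C \<subseteq> A" if "zariski_closed I A" "a \<in> A" for A
    using that zero_locus_scale[of _ I a] unfolding zariski_closed_def by blast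
  ultimately show ?thesis unfolding irreducible_closed_def by (metis (no_types, lifting) UnE empty_iff subsetD)
qed

lemma krull_dim_ge_1:
  assumes "irreducible_closed I A" "irreducible_closed I B" "A \<subset> B" "B \<subseteq> Z"
  shows "krull_dim I Z \<noteq> 0"
proof -
  define C where "C j = (if j = 0 then A else B)" for j :: nat
  have "irreducible_chain I Z 1 C"
    using assms by (auto simp: irreducible_chain_def C_def)
  hence "enat 1 \<le> krull_dim I Z" unfolding krull_dim_def by (intro Sup_upper) blast
  thus ?thesis by (intro notI) (simp add: zero_enat_def)
qed

section \<open>Curves of decomposable forms\<close>

lemma cst_power: "cst (a ^ k) = cst a ^ k"
  by (induction k) (simp_all add: cst_mult)

lemma fps_prod_nth_forms:
  fixes \<Lambda> :: "'i \<Rightarrow> ('v mpoly) fps"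
  assumes "finite S" "\<And>i k. fps_nth (\<Lambda> i) k \<in> forms I 1"
  shows "fps_nth (\<Prod>i\<in>S. \<Lambda> i) k \<in> forms I (card S)"
  using assms(1)
proof (induction S arbitrary: k rule: finite_induct)
  case empty thus ?case by (cases k) (auto simp: forms_1)
next
  case (insert x S)
  have "fps_nth (\<Lambda> x * (\<Prod>i\<in>S. \<Lambda> i)) k \<in> forms I (1 + card S)"
    unfolding fps_mult_nth by (intro forms_sum forms_mult assms(2) insert.IH)
  thus ?case using insert.hyps by simp
qed

definition curve_coord :: "('v mpoly) fps \<Rightarrow> ('v \<Rightarrow>\<^sub>0 nat) \<Rightarrow> complex fps" where
  "curve_coord F \<alpha> = Abs_fps (\<lambda>k. lk (fps_nth F k) \<alpha>)"

text \<open>The coefficient of order \<open>k\<close> depends on the curve only up to order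
  \<open>k\<close>, so the factors may be truncated. The truncation is a polynomial curve whose
  nonzero values are decomposable; \<open>g\<close> vanishes at all but finitely many parameters,
  hence identically.\<close>

lemma vanishing_on_formal_curve:
  assumes g: "g \<in> vanishing_ideal (monomials {..n} s) (decomposable_variety n s)"
    and \<Lambda>: "\<And>i k. fps_nth (\<Lambda> i) k \<in> forms {..n} 1" "fps_nth (\<Prod>i<s. \<Lambda> i) 0 \<noteq> 0"
  shows "evf (curve_coord (\<Prod>i<s. \<Lambda> i)) g = 0"
proof (rule fps_ext)
  fix k
  define \<Lambda>p where "\<Lambda>p i = (\<Sum>j\<le>k. monom (fps_nth (\<Lambda> i) j) j)" for i
  define G where "G = (\<Prod>i<s. \<Lambda>p i)"
  define \<Gamma>p where "\<Gamma>p \<alpha> = map_poly (\<lambda>D. lk D \<alpha>) G" for \<alpha>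
  have coG: "coeff G j = fps_nth (\<Prod>i<s. \<Lambda> i) j" if "j \<le> k" for j
  proof -
    have "coeff G j = fps_nth (\<Prod>i<s. fps_of_poly (\<Lambda>p i)) j"
      unfolding G_def by (subst fps_of_poly_prod[symmetric]) simp
    also have "\<dots> = fps_nth (\<Prod>i<s. \<Lambda> i) j"
      by (rule fps_prod_nth_cong[OF _ that]) (auto simp: \<Lambda>p_def coeff_sum)
    finally show ?thesis .
  qed
  have co\<Gamma>: "coeff (\<Gamma>p \<alpha>) j = lk (coeff G j) \<alpha>" for \<alpha> j by (simp add: \<Gamma>p_def coeff_map_poly)
  have ev\<Gamma>: "poly (\<Gamma>p \<alpha>) \<tau> = lk (poly G (cst \<tau>)) \<alpha>" for \<alpha> \<tau>
  proof -
    have "poly (\<Gamma>p \<alpha>) \<tau> = (\<Sum>j\<le>degree G. coeff (\<Gamma>p \<alpha>) j * \<tau> ^ j)"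
      by (rule poly_eq_sum_bound, rule degree_le) (simp add: co\<Gamma> coeff_eq_0)
    thus ?thesis by (simp add: poly_altdef lookup_sum co\<Gamma> mult.commute flip: cst_power)
  qed
  define q where "q = ev (\<lambda>a. [:a:]) \<Gamma>p g"
  have evq: "poly q \<tau> = peval g (poly G (cst \<tau>))" for \<tau>
  proof -
    have "poly q \<tau> = evc (\<lambda>\<alpha>. poly (\<Gamma>p \<alpha>) \<tau>) g"
      unfolding q_def by (rule ev_ev[where g = "\<lambda>a. a"]) auto
    also have "(\<lambda>\<alpha>. poly (\<Gamma>p \<alpha>) \<tau>) = lk (poly G (cst \<tau>))" by (simp add: fun_eq_iff ev\<Gamma>)
    finally show ?thesis by (simp add: peval_evc)
  qed
  have dec: "poly G (cst \<tau>) \<in> decomposable_variety n s" if "poly G (cst \<tau>) \<noteq> 0" for \<tau>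
  proof -
    have "poly (\<Lambda>p i) (cst \<tau>) \<in> forms {..n} 1" for i
    proof -
      have "poly (\<Lambda>p i) (cst \<tau>) = (\<Sum>j\<le>k. cst (\<tau> ^ j) * fps_nth (\<Lambda> i) j)"
        by (simp add: \<Lambda>p_def poly_sum poly_monom cst_power mult.commute)
      also have "\<dots> \<in> forms {..n} 1" by (intro forms_sum forms_cst_mult \<Lambda>)
      finally show ?thesis .
    qed
    moreover have "poly G (cst \<tau>) = (\<Prod>i<s. poly (\<Lambda>p i) (cst \<tau>))" by (simp add: G_def poly_prod)
    ultimately show ?thesis using that unfolding decomposable_variety_def
      by (intro CollectI conjI exI[of _ "\<lambda>i. poly (\<Lambda>p i) (cst \<tau>)"]) auto
  qed
  have "coeff G 0 \<noteq> 0" using coG[of 0] \<Lambda>(2) by simp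
  then obtain \<alpha>0 where "lk (coeff G 0) \<alpha>0 \<noteq> 0" by (metis lookup_zero poly_mapping_eqI)
  hence "\<Gamma>p \<alpha>0 \<noteq> 0" using co\<Gamma>[of \<alpha>0 0] by auto
  hence fin: "finite {\<tau>. poly (\<Gamma>p \<alpha>0) \<tau> = 0}" by (rule poly_roots_finite)
  have "- {\<tau>. poly (\<Gamma>p \<alpha>0) \<tau> = 0} \<subseteq> {\<tau>. poly q \<tau> = 0}"
  proof
    fix \<tau> assume "\<tau> \<in> - {\<tau>. poly (\<Gamma>p \<alpha>0) \<tau> = 0}"
    hence "poly G (cst \<tau>) \<noteq> 0" using ev\<Gamma>[of \<alpha>0 \<tau>] by auto
    thus "\<tau> \<in> {\<tau>. poly q \<tau> = 0}" using dec g by (simp add: evq vanishing_ideal_def)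
  qed
  moreover have "infinite (- {\<tau>. poly (\<Gamma>p \<alpha>0) \<tau> = 0})"
    using fin infinite_UNIV_char_0[where 'a = complex] by (metis finite_compl)
  ultimately have "q = 0" using poly_roots_finite[of q] by (meson finite_subset)
  have "fps_of_poly q = evf (\<lambda>\<alpha>. fps_of_poly (\<Gamma>p \<alpha>)) g"
    unfolding q_def by (rule ev_ev[where g = "\<lambda>a. a"])
      (auto simp: fps_of_poly_add fps_of_poly_mult fps_of_poly_const)
  hence "evf (\<lambda>\<alpha>. fps_of_poly (\<Gamma>p \<alpha>)) g = 0" using \<open>q = 0\<close> by simp
  moreover have "fps_nth (evf (curve_coord (\<Prod>i<s. \<Lambda> i)) g) k = fps_nth (evf (\<lambda>\<alpha>. fps_of_poly (\<Gamma>p \<alpha>)) g) k"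
    by (rule evf_nth_cong[where k = k and I = UNIV]) (auto simp: curve_coord_def co\<Gamma> coG)
  ultimately show "fps_nth (evf (curve_coord (\<Prod>i<s. \<Lambda> i)) g) k = fps_nth 0 k" by simp
qed

text \<open>The factors of a curve that is constant up to a scalar function are roots of polynomials with
  constant coefficients, hence constant up to scalar functions.\<close>

lemma constant_curve_factors:
  fixes \<Lambda> :: "nat \<Rightarrow> (nat mpoly) fps"
  assumes \<Lambda>: "\<And>i k. fps_nth (\<Lambda> i) k \<in> forms {..n} 1"
    and D0: "D0 = (\<Prod>i<s. fps_nth (\<Lambda> i) 0)" "D0 \<noteq> 0"
    and const: "\<And>k. fps_nth (\<Prod>i<s. \<Lambda> i) k = cst (fps_nth \<theta> k) * D0"
    and i: "i < s"
  shows "\<exists>c. fps_nth (\<Lambda> i) 1 = cst c * fps_nth (\<Lambda> i) 0"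
proof -
  define E where "E y F = Abs_fps (\<lambda>k. evc y (fps_nth F k))" for y and F :: "(nat mpoly) fps"
  have E_mult: "E y (F * G) = E y F * E y G" for y F G
    by (rule fps_ext) (simp add: E_def fps_mult_nth ev_simps)
  have E_1: "E y 1 = 1" for y by (rule fps_ext) (simp add: E_def ev_simps)
  have E_prod: "E y (\<Prod>i<s. \<Lambda> i) = (\<Prod>i<s. E y (\<Lambda> i))" for y
    by (induction s) (simp_all add: E_mult E_1)
  have prod: "(\<Prod>i<s. E y (\<Lambda> i)) = \<theta> * fps_const (evc y D0)" for y
    unfolding E_prod[symmetric] by (rule fps_ext) (simp add: E_def const ev_simps)
  have "D0 = cst (fps_nth \<theta> 0) * D0"
    using const[of 0] by (simp add: fps_prod_nth_0 D0(1)[symmetric])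
  hence \<theta>: "\<theta> \<noteq> 0" using D0(2) by auto
  obtain p where p: "evc p D0 \<noteq> 0" using poly_nonvanishing_point[OF D0(2)] by blast
  define L where "L k = fps_nth (\<Lambda> k) 0" for k
  have Lp: "evc p (L k) \<noteq> 0" if "k < s" for k
    using p that by (auto simp: D0(1) ev_simps L_def)
  \<comment> \<open>First order part of the statement that the values of \<open>\<Lambda> i\<close>
    at \<open>y\<close> and at \<open>p\<close> have a constant ratio.\<close>
  have key: "fps_nth (E y (\<Lambda> i)) 1 * evc p (L i) = fps_nth (E p (\<Lambda> i)) 1 * evc y (L i)" for y
  proof -
    define a b where "a k = E p (\<Lambda> k)" and "b k = E y (\<Lambda> k)" for k
    have line: "E (\<lambda>j. \<tau> * p j - y j) (\<Lambda> k) = fps_const \<tau> * a k - b k" for \<tau> k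
      by (rule fps_ext) (simp add: E_def a_def b_def linear_form_evc_diff[OF \<Lambda>])
    \<comment> \<open>The ratio \<open>b i * inverse (a i)\<close> is a root of \<open>P\<close>,
      and the roots of \<open>Q\<close> are constants. They coincide, because at every constant
      \<tau> both give the value of the curve at the point \<open>\<tau> p - y\<close>.\<close>
    define P Q where "P = (\<Prod>k<s. [:- b k, a k:])"
      and "Q = smult \<theta> (\<Prod>k<s. [:- fps_const (evc y (L k)), fps_const (evc p (L k)):])"
    have "poly (P - Q) (fps_const \<tau>) = 0" for \<tau>
    proof -
      have "evc (\<lambda>j. \<tau> * p j - y j) D0 = (\<Prod>k<s. \<tau> * evc p (L k) - evc y (L k))"
        unfolding D0(1) L_def ev_prod[OF ring_hom_c_id(1)] linear_form_evc_diff[OF \<Lambda>] ..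
      hence "poly Q (fps_const \<tau>) = \<theta> * fps_const (evc (\<lambda>j. \<tau> * p j - y j) D0)"
      proof -
        have "fps_const (\<Prod>k<s. f k) = (\<Prod>k<s. fps_const (f k :: complex))" for f
          by (induction s) (auto simp: fps_const_mult[symmetric] simp del: fps_const_mult)
        thus ?thesis using \<open>evc _ D0 = _\<close>
          by (simp add: Q_def poly_prod fps_const_mult[symmetric] fps_const_sub[symmetric] mult.commute
              del: fps_const_mult fps_const_sub fps_const_neg)
      qed
      also have "\<dots> = (\<Prod>k<s. fps_const \<tau> * a k - b k)" by (simp add: prod[symmetric] line)
      also have "\<dots> = poly P (fps_const \<tau>)" by (simp add: P_def poly_prod)
      finally show ?thesis by simp
    qed
    hence "range fps_const \<subseteq> {t. poly (P - Q) t = 0}" by auto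
    moreover have "infinite (range (fps_const :: complex \<Rightarrow> complex fps))"
      by (subst finite_image_iff) (auto simp: inj_def infinite_UNIV_char_0)
    ultimately have PQ: "P = Q" using poly_roots_finite[of "P - Q"] by (metis eq_iff_diff_eq_0 finite_subset)
    have a0: "fps_nth (a i) 0 \<noteq> 0" using Lp[OF i] by (simp add: a_def E_def L_def)
    define t where "t = b i * inverse (a i)"
    have t: "t * a i = b i" unfolding t_def mult.assoc inverse_mult_eq_1[OF a0] by simp
    have "poly P t = 0" unfolding P_def poly_prod using i t by (intro prod_zero) auto
    hence "poly Q t = 0" by (simp add: PQ)
    then obtain k where k: "k < s" "t * fps_const (evc p (L k)) - fps_const (evc y (L k)) = 0"
      using \<theta> by (auto simp: Q_def poly_prod simp del: fps_const_neg)
    define c where "c = evc y (L k) / evc p (L k)"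
    have "t * fps_const (evc p (L k)) = fps_const c * fps_const (evc p (L k))"
      using k(2) Lp[OF k(1)] by (simp add: c_def)
    hence "t = fps_const c" using Lp[OF k(1)] by (simp del: fps_const_mult)
    hence b: "fps_nth (b i) m = c * fps_nth (a i) m" for m using t[symmetric] by (simp del: fps_const_mult)
    have "evc y (L i) = c * evc p (L i)" using b[of 0] by (simp add: a_def b_def E_def L_def)
    thus ?thesis using b[of 1] by (simp add: a_def b_def)
  qed
  have "fps_nth (\<Lambda> i) 1 = cst (fps_nth (E p (\<Lambda> i)) 1 / evc p (L i)) * L i"
  proof (rule poly_eq_of_evc_eq)
    fix y
    show "evc y (fps_nth (\<Lambda> i) 1) = evc y (cst (fps_nth (E p (\<Lambda> i)) 1 / evc p (L i)) * L i)"
      using key[of y] Lp[OF i] by (simp add: ev_simps field_simps E_def)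
  qed
  thus ?thesis unfolding L_def by blast
qed

section \<open>The scheme of sums of hyperplanes\<close>

text \<open>The coefficient of \<open>D \<circ> f\<close> at \<beta>, up to
  \<open>mfact \<beta>\<close>, as a linear form in the coordinates of \<open>D\<close>; these forms
  cut out \<open>perp_space\<close>.\<close>

definition apolar_eq :: "nat \<Rightarrow> nat \<Rightarrow> nat mpoly \<Rightarrow> (nat \<Rightarrow>\<^sub>0 nat) \<Rightarrow> (nat \<Rightarrow>\<^sub>0 nat) mpoly" where
  "apolar_eq n s f \<beta> = (\<Sum>\<alpha>\<in>monomials {..n} s. cst (apol f (xpow \<alpha> * xpow \<beta>)) * var \<alpha>)"

lemma apolar_eq_forms: "apolar_eq n s f \<beta> \<in> forms (monomials {..n} s) 1"
  unfolding apolar_eq_def by (intro forms_sum forms_cst_mult forms_var)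

lemma apol_form_expand:
  fixes n :: nat
  assumes "D \<in> forms {..n} s"
  shows "apol f (D * xpow \<beta>) = (\<Sum>\<alpha>\<in>monomials {..n} s. lk D \<alpha> * apol f (xpow \<alpha> * xpow \<beta>))"
proof -
  have "apol f (xpow \<beta> * D) = (\<Sum>\<alpha>\<in>monomials {..n} s. lk D \<alpha> * apol f (xpow \<beta> * xpow \<alpha>))"
    using assms by (intro apol_mult_expand) (auto simp: forms_def)
  thus ?thesis by (simp add: mult.commute)
qed

lemma evc_apolar_eq: "D \<in> forms {..n} s \<Longrightarrow> evc (lk D) (apolar_eq n s f \<beta>) = apol f (D * xpow \<beta>)"
  by (simp add: apol_form_expand apolar_eq_def ev_simps mult.commute)

lemma perp_space_annihilates:
  "f \<in> forms {..n} d \<Longrightarrow> D \<in> perp_space n s f \<longleftrightarrow> D \<in> forms {..n} s \<and> D \<noteq> 0 \<and> annihilates n d s D f"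
  unfolding perp_space_def using perp_iff_annihilates by blast

lemma apolar_eq_vanishing:
  assumes "f \<in> forms {..n} d" "\<beta> \<in> cofactor_exps n d s"
  shows "apolar_eq n s f \<beta> \<in> vanishing_ideal (monomials {..n} s) (perp_space n s f)"
  using assms forms_polys[OF apolar_eq_forms]
  by (auto simp: vanishing_ideal_def perp_space_annihilates peval_evc evc_apolar_eq annihilates_def)

lemma vanishing_ideal_poly_ideal: "poly_ideal I (vanishing_ideal I Z)"
  by (auto simp: poly_ideal_def vanishing_ideal_def peval_evc ev_simps intro: polys_intros)

lemma vanishing_ideal_homc:
  assumes "g \<in> vanishing_ideal I Z" "\<And>a c. a \<in> Z \<Longrightarrow> c \<noteq> 0 \<Longrightarrow> cscale c a \<in> Z"
  shows "homc m g \<in> vanishing_ideal I Z"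
proof -
  have g: "g \<in> polys I" using assms(1) by (simp add: vanishing_ideal_def)
  have "evc (lk a) (homc m g) = 0" if a: "a \<in> Z" for a
  proof (rule homc_vanish[OF g])
    show "infinite (UNIV - {0 :: complex})" using infinite_UNIV_char_0[where 'a = complex] by simp
    fix c :: complex assume "c \<in> UNIV - {0}"
    hence "peval g (cscale c a) = 0" using assms a by (auto simp: vanishing_ideal_def)
    moreover have "lk (cscale c a) = (\<lambda>i. c * lk a i)" by auto
    ultimately show "evc (\<lambda>i. c * lk a i) g = 0" by (simp add: peval_evc)
  qed
  thus ?thesis using forms_polys[OF homc_forms[OF g]] by (auto simp: vanishing_ideal_def peval_evc)
qed

text \<open>For \<open>s = 0\<close> the set of decomposable forms is \<open>{1}\<close>, which is not a cone.\<close>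

lemma decomposable_cone: "s > 0 \<Longrightarrow> D \<in> decomposable_variety n s \<Longrightarrow> c \<noteq> 0 \<Longrightarrow> cscale c D \<in> decomposable_variety n s"
  by (simp add: cscale_cst decomposable_scale)

lemma perp_space_cone:
  assumes "f \<in> forms {..n} d" "D \<in> perp_space n s f" "c \<noteq> 0" shows "cscale c D \<in> perp_space n s f"
  using assms by (auto simp: perp_space_annihilates cscale_cst intro: forms_cst_mult annihilates_cst_mult)

section \<open>The ideal of \<open>VSH\<close> and its zero locus\<close>

lemma ideal_sum_poly_ideal:
  assumes "poly_ideal I J" "poly_ideal I K" shows "poly_ideal I (ideal_sum J K)"
  unfolding poly_ideal_def
proof (intro conjI ballI)
  note J = poly_idealD[OF assms(1)] and K = poly_idealD[OF assms(2)]
  show "ideal_sum J K \<subseteq> polys I" using J(1) K(1) by (auto simp: ideal_sum_def intro: polys_add)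
  show "0 \<in> ideal_sum J K" unfolding ideal_sum_def using J(2) K(2)
    by (intro CollectI exI[of _ 0] exI[of _ 0]) auto
  fix p assume "p \<in> ideal_sum J K"
  then obtain p1 p2 where p: "p = p1 + p2" "p1 \<in> J" "p2 \<in> K" by (auto simp: ideal_sum_def)
  show "p + q \<in> ideal_sum J K" if "q \<in> ideal_sum J K" for q
  proof -
    have "\<exists>q1 q2. q = q1 + q2 \<and> q1 \<in> J \<and> q2 \<in> K" using that by (auto simp: ideal_sum_def)
    then obtain q1 q2 where q: "q = q1 + q2" "q1 \<in> J" "q2 \<in> K" by blast
    have "p + q = (p1 + q1) + (p2 + q2)" by (simp add: p q)
    thus ?thesis unfolding ideal_sum_def using J(3) K(3) p q by blast
  qed
  show "r * p \<in> ideal_sum J K" if "r \<in> polys I" for r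
    unfolding ideal_sum_def using J(4)[OF that p(2)] K(4)[OF that p(3)] by (auto simp: p distrib_left)
qed

lemma ideal_sum_sub:
  assumes "poly_ideal I J" "poly_ideal I K"
  shows "J \<subseteq> ideal_sum J K" "K \<subseteq> ideal_sum J K"
proof -
  have "p + 0 \<in> ideal_sum J K" if "p \<in> J" for p
    unfolding ideal_sum_def using that poly_idealD(2)[OF assms(2)] by blast
  thus "J \<subseteq> ideal_sum J K" by auto
  have "0 + p \<in> ideal_sum J K" if "p \<in> K" for p
    unfolding ideal_sum_def using that poly_idealD(2)[OF assms(1)] by blast
  thus "K \<subseteq> ideal_sum J K" by auto
qed

lemma VSH_poly_ideal: "poly_ideal (monomials {..n} s) (VSH n s f)"
  unfolding VSH_def by (intro ideal_sum_poly_ideal vanishing_ideal_poly_ideal)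

lemma VSH_sub:
  "vanishing_ideal (monomials {..n} s) (perp_space n s f) \<subseteq> VSH n s f"
  "vanishing_ideal (monomials {..n} s) (decomposable_variety n s) \<subseteq> VSH n s f"
  unfolding VSH_def
  by (rule ideal_sum_sub[OF vanishing_ideal_poly_ideal vanishing_ideal_poly_ideal])+

lemma VSH_homc:
  assumes "s > 0" "f \<in> forms {..n} d" "g \<in> VSH n s f"
  shows "homc m g \<in> VSH n s f"
proof -
  obtain p q where "g = p + q" "p \<in> vanishing_ideal (monomials {..n} s) (perp_space n s f)"
    "q \<in> vanishing_ideal (monomials {..n} s) (decomposable_variety n s)"
    using assms(3) by (auto simp: VSH_def ideal_sum_def)
  moreover from this have "homc m p \<in> vanishing_ideal (monomials {..n} s) (perp_space n s f)"
    "homc m q \<in> vanishing_ideal (monomials {..n} s) (decomposable_variety n s)"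
    using perp_space_cone[OF assms(2)] decomposable_cone[OF assms(1)] by (blast intro: vanishing_ideal_homc)+
  moreover have "homc m g = homc m p + homc m q" by (simp add: calculation(1) homc_add)
  ultimately show ?thesis unfolding VSH_def ideal_sum_def by blast
qed

lemma VSH_vanish:
  assumes "D \<in> perp_space n s f" "D \<in> decomposable_variety n s" "g \<in> VSH n s f"
  shows "evc (lk D) g = 0"
  using assms by (auto simp: VSH_def ideal_sum_def vanishing_ideal_def peval_evc ev_simps)

text \<open>The linear forms \<open>apolar_eq\<close> give the first membership. The second is
  \<open>decomposable_closed\<close>, since the ideal contains all equations of the decomposable
  forms.\<close>

lemma zero_locus_VSH:
  assumes "s > 0" "f \<in> forms {..n} d" "a \<in> zero_locus (monomials {..n} s) (VSH n s f)"
  shows "a \<in> perp_space n s f" "a \<in> decomposable_variety n s"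
proof -
  let ?mon = "monomials {..n} s"
  have a: "a \<in> forms {..n} s" "a \<noteq> 0" using assms(3) by (auto simp: zero_locus_def proj_space_def forms_def)
  have van: "evc (lk a) g = 0" if "g \<in> VSH n s f" for g
    using assms(3) that by (auto simp: zero_locus_def peval_evc)
  have "annihilates n d s a f"
    unfolding annihilates_def
  proof
    fix \<beta> assume "\<beta> \<in> cofactor_exps n d s"
    hence "apolar_eq n s f \<beta> \<in> VSH n s f" using apolar_eq_vanishing[OF assms(2)] VSH_sub(1) by blast
    thus "apol f (a * xpow \<beta>) = 0" using van evc_apolar_eq[OF a(1)] by metis
  qed
  thus "a \<in> perp_space n s f" using a assms(2) by (simp add: perp_space_annihilates)
  show "a \<in> decomposable_variety n s"
    using van VSH_sub(2) by (intro decomposable_closed[OF assms(1) a]) blast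
qed

section \<open>Positive dimension from a nontrivial deformation\<close>

text \<open>\<open>C0\<close> is the point \<open>D0\<close> and \<open>C1\<close> the closure of
  the lifted curve. If they were equal, the curve would be constant up to a scalar series, then each
  factor would be so to first order, and \<open>l i0\<close> would be a multiple of
  \<open>L i0\<close>. So they form a chain of length 1 in the zero locus.\<close>

lemma positive_dimensional:
  assumes s: "s > 0" and f: "f \<in> forms {..n} d" and nc: "\<not> critical n d s f"
    and L: "\<And>i. L i \<in> forms {..n} 1" "(\<Prod>i<s. L i) \<noteq> 0" "annihilates n d s (\<Prod>i<s. L i) f"
    and l: "\<And>i. l i \<in> forms {..n} 1" "annihilates n d s (\<Sum>i<s. l i * others s i L) f"
    and nt: "i0 < s" "\<nexists>c. l i0 = cst c * L i0"
  shows "krull_dim (monomials {..n} s) (zero_locus (monomials {..n} s) (VSH n s f)) \<noteq> 0"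
proof -
  let ?mon = "monomials {..n} s" let ?Z = "zero_locus ?mon (VSH n s f)"
  define D0 where "D0 = (\<Prod>i<s. L i)"
  have Ln: "L i \<in> forms {..n} 1 \<and> L i \<noteq> 0" if "i < s" for i using L that by auto
  obtain \<Lambda> where \<Lambda>: "\<And>i. fps_nth (\<Lambda> i) 0 = L i" "\<And>i. fps_nth (\<Lambda> i) 1 = l i"
    "\<And>i k. fps_nth (\<Lambda> i) k \<in> forms {..n} 1" "\<And>k. annihilates n d s (fps_nth (\<Prod>i<s. \<Lambda> i) k) f"
    using formal_curve[OF nc Ln L(1) L(3) l] by blast
  define \<Gamma> where "\<Gamma> = curve_coord (\<Prod>i<s. \<Lambda> i)"
  have nth0: "fps_nth (\<Prod>i<s. \<Lambda> i) 0 = D0" by (simp add: fps_prod_nth_0 \<Lambda>(1) D0_def)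
  have \<Gamma>0: "(\<lambda>\<alpha>. fps_nth (\<Gamma> \<alpha>) 0) = lk D0" by (simp add: \<Gamma>_def curve_coord_def nth0)
  have forms: "fps_nth (\<Prod>i<s. \<Lambda> i) k \<in> forms {..n} s" for k
    using fps_prod_nth_forms[of "{..<s}" \<Lambda> "{..n}" k] \<Lambda>(3) by simp
  have D0f: "D0 \<in> forms {..n} s" "D0 \<noteq> 0" using forms[of 0] nth0 L(2) by (auto simp: D0_def)
  have D0p: "D0 \<in> proj_space ?mon" using D0f by (auto simp: proj_space_def forms_def)
  obtain \<alpha>0 where \<alpha>0: "\<alpha>0 \<in> ?mon" "lk D0 \<alpha>0 \<noteq> 0"
    using D0f by (metis forms_def in_keys_iff keys_eq_empty ex_in_conv mem_Collect_eq subsetD)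
  have \<Gamma>\<alpha>0: "\<Gamma> \<alpha>0 \<noteq> 0" using \<alpha>0(2) fun_cong[OF \<Gamma>0, of \<alpha>0] by auto
  define C1 where "C1 = zero_locus ?mon {g. (\<exists>m. g \<in> forms ?mon m) \<and> evf \<Gamma> g = 0}"
  define C0 where "C0 = {b \<in> proj_space ?mon. \<exists>c. b = cscale c D0}"
  have irr1: "irreducible_closed ?mon C1"
    unfolding C1_def by (rule irreducible_curve[of _ \<alpha>0]) (use \<alpha>0 \<Gamma>\<alpha>0 in auto)
  have irr0: "irreducible_closed ?mon C0" unfolding C0_def by (rule irreducible_point[OF D0p])
  have D0C1: "D0 \<in> C1"
    unfolding C1_def zero_locus_def
  proof (intro CollectI conjI D0p ballI)
    fix g assume "g \<in> {g. (\<exists>m. g \<in> forms ?mon m) \<and> evf \<Gamma> g = 0}"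
    thus "peval g D0 = 0" using evf_nth_0[of \<Gamma> g] by (simp add: peval_evc \<Gamma>0)
  qed
  have "C0 \<subseteq> C1"
  proof
    fix b assume "b \<in> C0"
    thus "b \<in> C1" using D0C1 unfolding C0_def C1_def by (auto intro!: zero_locus_scale[of _ ?mon D0])
  qed
  moreover have "C0 \<noteq> C1"
  proof
    assume eq: "C0 = C1"
    \<comment> \<open>The minor \<open>g\<close> vanishes on all multiples of \<open>D0\<close>. If
      it did not vanish along the curve, \<open>C1\<close> would contain a point where it is
      nonzero.\<close>
    have proportional: "\<Gamma> \<beta> * fps_const (lk D0 \<alpha>0) = \<Gamma> \<alpha>0 * fps_const (lk D0 \<beta>)" if "\<beta> \<in> ?mon" for \<beta>
    proof (rule ccontr)
      assume ne: "\<not> ?thesis"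
      define g where "g = cst (lk D0 \<alpha>0) * var \<beta> - cst (lk D0 \<beta>) * var \<alpha>0"
      have g: "g \<in> forms ?mon 1" unfolding g_def using that \<alpha>0 by (intro forms_diff forms_cst_mult forms_var)
      have "evf \<Gamma> g \<noteq> 0" using ne by (simp add: g_def ev_simps mult.commute)
      then obtain a where "a \<in> C1" "peval g a \<noteq> 0"
        using generic_point_lemma[of ?mon \<alpha>0 \<Gamma> g 1] \<alpha>0 \<Gamma>\<alpha>0 g unfolding C1_def by auto
      moreover obtain c where "a = cscale c D0" using eq \<open>a \<in> C1\<close> unfolding C0_def by blast
      ultimately show False by (simp add: g_def peval_evc ev_simps)
    qed
    define \<theta> where "\<theta> = \<Gamma> \<alpha>0 * fps_const (1 / lk D0 \<alpha>0)"
    have multiple: "fps_nth (\<Prod>i<s. \<Lambda> i) k = cst (fps_nth \<theta> k) * D0" for k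
    proof (rule poly_mapping_eqI)
      fix \<beta>
      show "lk (fps_nth (\<Prod>i<s. \<Lambda> i) k) \<beta> = lk (cst (fps_nth \<theta> k) * D0) \<beta>"
      proof (cases "\<beta> \<in> ?mon")
        case True
        from proportional[OF this] have "fps_nth (\<Gamma> \<beta> * fps_const (lk D0 \<alpha>0)) k = fps_nth (\<Gamma> \<alpha>0 * fps_const (lk D0 \<beta>)) k" by simp
        thus ?thesis using \<alpha>0(2) by (simp add: \<theta>_def \<Gamma>_def curve_coord_def field_simps)
      next
        case False
        hence "\<beta> \<notin> ks (fps_nth (\<Prod>i<s. \<Lambda> i) k)" "\<beta> \<notin> ks D0"
          using forms[of k] D0f(1) unfolding forms_def by blast+
        thus ?thesis by (simp add: in_keys_iff)
      qed
    qed
    have "\<exists>c. fps_nth (\<Lambda> i0) 1 = cst c * fps_nth (\<Lambda> i0) 0"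
      by (rule constant_curve_factors[OF \<Lambda>(3) _ D0f(2) multiple nt(1)]) (simp add: D0_def \<Lambda>(1))
    thus False using nt(2) unfolding \<Lambda>(1,2) by blast
  qed
  ultimately have "C0 \<subset> C1" by blast
  moreover have "C1 \<subseteq> ?Z"
  proof
    fix a assume a: "a \<in> C1"
    hence ap: "a \<in> proj_space ?mon" and av: "\<And>g m. g \<in> forms ?mon m \<Longrightarrow> evf \<Gamma> g = 0 \<Longrightarrow> peval g a = 0"
      by (auto simp: C1_def zero_locus_def)
    have af: "a \<in> forms {..n} s" "a \<noteq> 0" using ap by (auto simp: proj_space_def forms_def)
    have "evf \<Gamma> (apolar_eq n s f \<beta>) = 0" if "\<beta> \<in> cofactor_exps n d s" for \<beta>
    proof (rule fps_ext)
      fix k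
      have "fps_nth (evf \<Gamma> (apolar_eq n s f \<beta>)) k = apol f (fps_nth (\<Prod>i<s. \<Lambda> i) k * xpow \<beta>)"
        unfolding apol_form_expand[OF forms]
        by (simp add: apolar_eq_def ev_simps fps_sum_nth \<Gamma>_def curve_coord_def mult.commute)
      thus "fps_nth (evf \<Gamma> (apolar_eq n s f \<beta>)) k = fps_nth 0 k"
        using \<Lambda>(4)[of k] that by (simp add: annihilates_def)
    qed
    hence "apol f (a * xpow \<beta>) = 0" if "\<beta> \<in> cofactor_exps n d s" for \<beta>
      using av[OF apolar_eq_forms] that evc_apolar_eq[OF af(1)] by (metis peval_evc)
    hence "a \<in> perp_space n s f" using af f by (simp add: perp_space_annihilates annihilates_def)
    moreover have "peval h a = 0" if h: "h \<in> vanishing_ideal ?mon (decomposable_variety n s)" for h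
    proof -
      have hp: "h \<in> polys ?mon" using h by (simp add: vanishing_ideal_def)
      \<comment> \<open>\<open>C1\<close> is defined by forms only, so \<open>h\<close> is treated
        through its homogeneous components.\<close>
      have "peval (homc m h) a = 0" for m
        by (rule av[OF homc_forms[OF hp]], unfold \<Gamma>_def, rule vanishing_on_formal_curve)
           (use vanishing_ideal_homc[OF h decomposable_cone[OF s]] \<Lambda>(3) nth0 D0f in auto)
      hence "peval (\<Sum>m\<le>tdeg h. homc m h) a = 0" by (simp add: peval_evc ev_simps)
      thus ?thesis by (simp add: homc_sum_le)
    qed
    ultimately have "peval g a = 0" if "g \<in> VSH n s f" for g
      using that by (auto simp: VSH_def ideal_sum_def peval_evc ev_simps vanishing_ideal_def)
    thus "a \<in> ?Z" using ap by (simp add: zero_locus_def)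
  qed
  ultimately show ?thesis by (rule krull_dim_ge_1[OF irr0 irr1])
qed

section \<open>Zero-dimensional smooth schemes are reduced\<close>

lemma homc_sum: "homc m (sum f A) = (\<Sum>a\<in>A. homc m (f a))"
  by (induction A rule: infinite_finite_induct) (simp_all add: homc_add)

lemma homc_form_mult:
  assumes "q \<in> forms I e" "p \<in> polys I"
  shows "homc m (q * p) = (if e \<le> m then q * homc (m - e) p else 0)"
proof -
  let ?K = "max (tdeg p) m"
  have "q * p = q * (\<Sum>j\<le>?K. homc j p)" by (simp add: homc_sum_le)
  hence "homc m (q * p) = (\<Sum>j\<le>?K. homc m (q * homc j p))" by (simp add: sum_distrib_left homc_sum)
  also have "\<dots> = (\<Sum>j\<le>?K. if e \<le> m \<and> j = m - e then q * homc (m - e) p else 0)"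
    by (intro sum.cong refl) (auto simp: homc_form[OF forms_mult[OF assms(1) homc_forms[OF assms(2)]]])
  finally show ?thesis by auto
qed

lemma homc_diff: "homc m (p - q) = homc m p - homc m q"
  using homc_add[of m "p - q" q] by simp

text \<open>A linear system whose matrix is the identity at \<open>a\<close> is solvable near
  \<open>a\<close>. Fraction-free elimination, one unknown at a time, replaces Cramer's rule, and
  \<open>h\<close> is the common denominator.\<close>

lemma eliminate:
  assumes J: "poly_ideal I J" and "finite K"
    and "\<And>k. k \<in> K \<Longrightarrow> y k \<in> polys I"
    and "\<And>j k. j \<in> K \<Longrightarrow> k \<in> K \<Longrightarrow> M j k \<in> polys I"
    and "\<And>j k. j \<in> K \<Longrightarrow> k \<in> K \<Longrightarrow> evc a (M j k) = (if j = k then 1 else 0)"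
    and "\<And>j. j \<in> K \<Longrightarrow> (\<Sum>k\<in>K. M j k * y k) \<in> J"
  shows "\<exists>h\<in>polys I. evc a h = 1 \<and> (\<forall>k\<in>K. h * y k \<in> J)"
  using assms(2-)
proof (induction K arbitrary: M rule: finite_induct)
  case empty thus ?case by (intro bexI[of _ 1]) (auto simp: ev_simps)
next
  case (insert x K)
  define N where "N j k = M x x * M j k - M j x * M x k" for j k
  have "\<exists>h\<in>polys I. evc a h = 1 \<and> (\<forall>k\<in>K. h * y k \<in> J)"
  proof (rule insert.IH[of N])
    show "y k \<in> polys I" if "k \<in> K" for k using insert.prems(1) that by blast
    show "N j k \<in> polys I" if "j \<in> K" "k \<in> K" for j k
      unfolding N_def using insert.prems(2) that by (intro polys_intros) auto
    show "evc a (N j k) = (if j = k then 1 else 0)" if jk: "j \<in> K" "k \<in> K" for j k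
    proof -
      have "j \<noteq> x" using jk insert.hyps by auto
      thus ?thesis using insert.prems(3) jk by (simp add: N_def ev_simps)
    qed
    show "(\<Sum>k\<in>K. N j k * y k) \<in> J" if j: "j \<in> K" for j
    proof -
      have "(\<Sum>k\<in>K. N j k * y k) = M x x * (\<Sum>k\<in>insert x K. M j k * y k) - M j x * (\<Sum>k\<in>insert x K. M x k * y k)"
        using insert.hyps by (simp add: N_def algebra_simps sum_subtractf sum_distrib_left)
      also have "\<dots> \<in> J"
        using insert.prems j by (intro poly_ideal_diff[OF J] poly_idealD(4)[OF J]) auto
      finally show ?thesis .
    qed
  qed
  then obtain h where h: "h \<in> polys I" "evc a h = 1" "\<And>k. k \<in> K \<Longrightarrow> h * y k \<in> J" by blast
  have Mx: "M x k \<in> polys I" if "k \<in> insert x K" for k using insert.prems(2) that by blast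
  have "M x x * h * y x = h * (\<Sum>k\<in>insert x K. M x k * y k) - (\<Sum>k\<in>K. M x k * (h * y k))"
    using insert.hyps by (simp add: distrib_left sum_distrib_left mult_ac)
  also have "\<dots> \<in> J"
  proof (rule poly_ideal_diff[OF J])
    show "h * (\<Sum>k\<in>insert x K. M x k * y k) \<in> J" using insert.prems(4) h(1) by (intro poly_idealD(4)[OF J]) auto
    show "(\<Sum>k\<in>K. M x k * (h * y k)) \<in> J"
      by (rule poly_ideal_sum[OF J], rule poly_idealD(4)[OF J Mx h(3)]) auto
  qed
  finally have "M x x * h * y x \<in> J" .
  moreover have "M x x * h * y k \<in> J" if "k \<in> K" for k
    using poly_idealD(4)[OF J Mx h(3)[OF that], of x] by (simp add: mult.assoc)
  moreover have "evc a (M x x * h) = 1" using insert.prems(3) h(2) by (simp add: ev_simps)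
  ultimately show ?case using Mx h(1) by (intro bexI[of _ "M x x * h"]) (auto intro: polys_mult)
qed

text \<open>Nakayama's lemma at a reduced point, with the affine chart realised by adding the equation
  \<open>x\<^sub>i = a\<^sub>i\<close> to the ideal.\<close>

lemma locally_reduced:
  assumes fin: "finite I" and J: "poly_ideal I J" and hJ: "\<And>g m. g \<in> J \<Longrightarrow> homc m g \<in> J"
    and van: "\<And>g. g \<in> J \<Longrightarrow> evc a g = 0" and i: "i \<in> I" "a i \<noteq> 0"
    and tan: "\<And>v. (\<And>g. g \<in> J \<Longrightarrow> (\<Sum>k\<in>I. evc a (partial k g) * v k) = 0) \<Longrightarrow> \<exists>c. \<forall>k\<in>I. v k = c * a k"
    and g: "g \<in> forms I m" "evc a g = 0"
  shows "\<exists>h\<in>polys I. evc a h \<noteq> 0 \<and> h * g \<in> J"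
proof -
  define z where "z = var i - cst (a i)"
  have z: "z \<in> polys I" using i by (auto simp: z_def intro: polys_intros)
  define J' where "J' = {r + z * b | r b. r \<in> J \<and> b \<in> polys I}"
  have J'I: "r + z * b \<in> J'" if "r \<in> J" "b \<in> polys I" for r b using that by (auto simp: J'_def)
  have J': "poly_ideal I J'"
    unfolding poly_ideal_def
  proof (intro conjI ballI)
    show "J' \<subseteq> polys I" using z poly_idealD(1)[OF J] by (auto simp: J'_def intro!: polys_intros)
    show "0 \<in> J'" using J'I[of 0 0] poly_idealD(2)[OF J] by simp
    fix p assume "p \<in> J'"
    then obtain r b where p: "p = r + z * b" "r \<in> J" "b \<in> polys I" by (auto simp: J'_def)
    show "p + q \<in> J'" if "q \<in> J'" for q
    proof -
      have "\<exists>r' b'. q = r' + z * b' \<and> r' \<in> J \<and> b' \<in> polys I" using that by (auto simp: J'_def)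
      then obtain r' b' where q: "q = r' + z * b'" "r' \<in> J" "b' \<in> polys I" by blast
      have "(r + r') + z * (b + b') \<in> J'" using p q by (intro J'I poly_idealD(3)[OF J] polys_add)
      thus ?thesis by (simp add: p q algebra_simps)
    qed
    show "q * p \<in> J'" if "q \<in> polys I" for q
    proof -
      have "(q * r) + z * (q * b) \<in> J'" using p that by (intro J'I poly_idealD(4)[OF J] polys_mult)
      thus ?thesis by (simp add: p algebra_simps)
    qed
  qed
  have vz: "evc a z = 0" by (simp add: z_def ev_simps)
  have vanJ': "evc a p = 0" if "p \<in> J'" for p using that van vz by (auto simp: J'_def ev_simps)
  define U where "U = (\<lambda>G k. evc a (partial k G)) ` J'"
  \<comment> \<open>A vector killed by all differentials of \<open>J'\<close> is a multiple of
    \<open>a\<close> with coordinate \<open>i\<close> equal to 0, hence zero. So the differentials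
    at \<open>a\<close> of members of \<open>J'\<close> take all values.\<close>
  have realize: "\<exists>G\<in>J'. \<forall>k\<in>I. evc a (partial k G) = c k" for c
  proof -
    have "\<exists>u\<in>U. \<forall>k\<in>I. u k = c k"
    proof (rule surjective_of_annihilator[OF fin])
      show "U \<noteq> {}" using poly_idealD(2)[OF J'] by (auto simp: U_def)
    next
      fix u v assume "u \<in> U" "v \<in> U"
      then obtain G H where "G \<in> J'" "H \<in> J'" "u = (\<lambda>k. evc a (partial k G))" "v = (\<lambda>k. evc a (partial k H))"
        by (auto simp: U_def)
      thus "(\<lambda>k. u k + v k) \<in> U" unfolding U_def
        by (intro image_eqI[of _ _ "G + H"] poly_idealD(3)[OF J']) (auto simp: partial_add ev_simps)
    next
      fix u c assume "u \<in> U"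
      then obtain G where "G \<in> J'" "u = (\<lambda>k. evc a (partial k G))" by (auto simp: U_def)
      thus "(\<lambda>k. c * u k) \<in> U" unfolding U_def
        by (intro image_eqI[of _ _ "cst c * G"] poly_idealD(4)[OF J']) (auto simp: partial_mult ev_simps)
    next
      fix w k assume w: "\<And>u. u \<in> U \<Longrightarrow> (\<Sum>k\<in>I. w k * u k) = 0" and k: "k \<in> I"
      have wJ': "(\<Sum>k\<in>I. evc a (partial k G) * w k) = 0" if "G \<in> J'" for G
        using w[of "\<lambda>k. evc a (partial k G)"] that by (simp add: U_def mult.commute)
      have "\<exists>c. \<forall>k\<in>I. w k = c * a k"
      proof (rule tan)
        fix G assume "G \<in> J"
        thus "(\<Sum>k\<in>I. evc a (partial k G) * w k) = 0" using J'I[of G 0] by (intro wJ') simp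
      qed
      then obtain c where c: "\<And>k. k \<in> I \<Longrightarrow> w k = c * a k" by blast
      have "z \<in> J'" using J'I[of 0 1] poly_idealD(2)[OF J] by simp
      from wJ'[OF this] have "w i = 0" using i fin
        by (simp add: z_def partial_diff partial_var ev_simps if_distrib if_distribR cong: if_cong)
      thus "w k = 0" using c[OF i(1)] c[OF k] i(2) by simp
    qed
    then obtain u where "u \<in> U" "\<forall>k\<in>I. u k = c k" by blast
    thus ?thesis unfolding U_def by blast
  qed
  \<comment> \<open>Members of \<open>J'\<close> whose differentials at \<open>a\<close> are the
    coordinate functionals; their Taylor quotients form a matrix that is the identity at
    \<open>a\<close>.\<close>
  have "\<exists>G. G \<in> J' \<and> (\<forall>k\<in>I. evc a (partial k G) = (if j = k then 1 else 0))" for j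
    using realize[of "\<lambda>k. if j = k then 1 else 0"] by (simp only: Bex_def)
  then obtain G where G: "\<And>j. G j \<in> J'" "\<And>j k. k \<in> I \<Longrightarrow> evc a (partial k (G j)) = (if j = k then 1 else 0)"
    by metis
  have "\<exists>M. (\<forall>k. M k \<in> polys I) \<and> (\<forall>k. evc a (M k) = evc a (partial k (G j))) \<and>
      G j = (\<Sum>k\<in>I. M k * (var k - cst (a k)))" for j
  proof -
    obtain N where N: "\<And>k. N k \<in> polys I" "\<And>k. evc a (N k) = evc a (partial k (G j))"
      "G j = cst (evc a (G j)) + (\<Sum>k\<in>I. N k * (var k - cst (a k)))"
      by (rule taylor1[OF poly_idealD(1)[OF J' G(1)[of j]] fin, of a]) (rule that)
    from N(3)[unfolded vanJ'[OF G(1)[of j]] cst_0 add_0_left] show ?thesis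
      by (intro exI[of _ N] conjI allI N(1,2))
  qed
  then obtain M where M: "\<And>j k. M j k \<in> polys I" "\<And>j k. evc a (M j k) = evc a (partial k (G j))"
    "\<And>j. G j = (\<Sum>k\<in>I. M j k * (var k - cst (a k)))" by metis
  have "\<exists>h\<in>polys I. evc a h = 1 \<and> (\<forall>k\<in>I. h * (var k - cst (a k)) \<in> J')"
  proof (rule eliminate[OF J' fin, where M = M and y = "\<lambda>k. var k - cst (a k)"])
    show "var k - cst (a k) \<in> polys I" if "k \<in> I" for k using that by (intro polys_intros)
    show "evc a (M j k) = (if j = k then 1 else 0)" if "k \<in> I" for j k using M(2) G(2)[OF that] by simp
    show "(\<Sum>k\<in>I. M j k * (var k - cst (a k))) \<in> J'" for j using G(1)[of j] unfolding M(3)[of j] .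
  qed (rule M(1))
  then obtain h where h: "h \<in> polys I" "evc a h = 1" "\<And>k. k \<in> I \<Longrightarrow> h * (var k - cst (a k)) \<in> J'" by blast
  have gp: "g \<in> polys I" by (rule forms_polys[OF g(1)])
  obtain N where N0: "\<And>k. N k \<in> polys I" "\<And>k. evc a (N k) = evc a (partial k g)"
    "g = cst (evc a g) + (\<Sum>k\<in>I. N k * (var k - cst (a k)))"
    by (rule taylor1[OF gp fin, of a]) (rule that)
  note N = N0(1) N0(3)[unfolded g(2) cst_0 add_0_left]
  have "h * g = (\<Sum>k\<in>I. N k * (h * (var k - cst (a k))))"
    by (subst N(2)) (simp add: sum_distrib_left mult_ac)
  also have "\<dots> \<in> J'" by (rule poly_ideal_sum[OF J'], rule poly_idealD(4)[OF J' N(1) h(3)])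
  finally obtain r b where rb: "h * g = r + z * b" "r \<in> J" "b \<in> polys I" by (auto simp: J'_def)
  \<comment> \<open>\<open>\<eta> p\<close> is \<open>x_i^K p(a_i x / x_i)\<close>: this undoes the
    chart, kills multiples of \<open>z\<close> and maps \<open>J\<close> to itself. \<open>K\<close>
    is at least the degrees of \<open>h * g\<close> and \<open>z * b\<close>, so no component of
    either is lost.\<close>
  define K where "K = m + tdeg h + tdeg b + 1"
  define \<eta> where "\<eta> p = (\<Sum>k\<le>K. cst (a i ^ k) * var i ^ (K - k) * homc k p)" for p
  have \<eta>_add: "\<eta> (p + q) = \<eta> p + \<eta> q" for p q by (simp add: \<eta>_def homc_add distrib_left sum.distrib)
  have \<eta>z: "\<eta> (z * b) = 0"
  proof -
    let ?f = "\<lambda>k. cst (a i ^ Suc k) * var i ^ (K - k) * homc k b"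
    have t1: "cst (a i ^ k) * var i ^ (K - k) * homc k (var i * b) = (if k = 0 then 0 else ?f (k - 1))" if "k \<le> K" for k
    proof (cases k)
      case (Suc k')
      have "var i ^ (K - k') = var i ^ (K - k) * var i" using that Suc
        by (simp add: Suc_diff_Suc flip: power_Suc2)
      thus ?thesis using homc_form_mult[OF forms_var[OF i(1)] rb(3), of k] Suc by (simp add: mult_ac)
    qed (use homc_form_mult[OF forms_var[OF i(1)] rb(3), of k] in simp)
    have t2: "homc k (cst (a i) * b) = cst (a i) * homc k b" for k
      using homc_form_mult[OF forms_cst rb(3), of k "a i"] by simp
    have "\<eta> (z * b) = (\<Sum>k\<le>K. if k = 0 then 0 else ?f (k - 1)) - (\<Sum>k\<le>K. ?f k)"
      unfolding \<eta>_def z_def left_diff_distrib homc_diff right_diff_distrib sum_subtractf t2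
      using t1 by (intro arg_cong2[where f = "(-)"] sum.cong) (auto simp: cst_mult mult_ac)
    also have "(\<Sum>k\<le>K. if k = 0 then 0 else ?f (k - 1)) = (\<Sum>k<K. ?f k)"
      by (simp add: sum.atMost_shift)
    also have "(\<Sum>k\<le>K. ?f k) = (\<Sum>k<K. ?f k) + ?f K" by (simp flip: lessThan_Suc_atMost)
    also have "homc K b = 0" by (rule homc_gt) (simp add: K_def)
    finally show ?thesis by simp
  qed
  have \<eta>r: "\<eta> r \<in> J" unfolding \<eta>_def
    using i(1) rb(2) by (intro poly_ideal_sum[OF J] poly_idealD(4)[OF J] hJ) (auto intro!: polys_intros)
  define H where "H = (\<Sum>k\<le>K - m. cst (a i ^ (k + m)) * var i ^ (K - m - k) * homc k h)"
  have Hp: "H \<in> polys I" unfolding H_def using i(1) by (intro polys_intros forms_polys[OF homc_forms[OF h(1)]])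
  have "\<eta> (h * g) = H * g"
  proof -
    have "homc k (h * g) = (if m \<le> k then g * homc (k - m) h else 0)" for k
      using homc_form_mult[OF g(1) h(1), of k] by (simp add: mult.commute)
    hence "\<eta> (h * g) = (\<Sum>k\<le>K. if m \<le> k then cst (a i ^ k) * var i ^ (K - k) * (g * homc (k - m) h) else 0)"
      unfolding \<eta>_def by (intro sum.cong) auto
    also have "\<dots> = (\<Sum>k\<in>{m..K}. cst (a i ^ k) * var i ^ (K - k) * (g * homc (k - m) h))"
      by (intro sum.mono_neutral_cong_right) auto
    also have "\<dots> = (\<Sum>k\<le>K - m. cst (a i ^ (k + m)) * var i ^ (K - m - k) * (g * homc k h))"
      by (rule sum.reindex_bij_witness[of _ "\<lambda>k. k + m" "\<lambda>k. k - m"]) (auto simp: K_def add_ac)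
    finally show ?thesis by (simp add: H_def sum_distrib_left sum_distrib_right mult_ac)
  qed
  hence "H * g \<in> J" using \<eta>r by (simp add: rb(1) \<eta>_add \<eta>z)
  moreover have "evc a H \<noteq> 0"
  proof -
    have "evc a H = (\<Sum>k\<le>K - m. a i ^ K * evc a (homc k h))"
      unfolding H_def by (simp add: ev_simps) (intro sum.cong refl, auto simp: K_def add_ac simp flip: power_add)
    also have "\<dots> = a i ^ K * evc a (\<Sum>k\<le>K - m. homc k h)" by (simp add: ev_simps sum_distrib_left)
    also have "(\<Sum>k\<le>K - m. homc k h) = h" by (rule homc_sum_le) (simp add: K_def)
    finally show ?thesis using i(2) h(2) by simp
  qed
  ultimately show ?thesis using Hp by blast
qed

text \<open>\<open>Q\<close> consists of the multipliers bringing \<open>g\<close> into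
  \<open>J\<close> after localisation at \<open>var i\<close>. If it contained no power of
  \<open>var i\<close>, there would be a point of the scheme in this chart where all of
  \<open>Q\<close> vanishes. There \<open>g\<close> is zero because \<open>var i ^ N * g ^ k\<close>
  lies in \<open>J\<close>, and \<open>locally_reduced\<close> gives a member of \<open>Q\<close>
  that is nonzero at the point.\<close>

theorem reduced_of_smooth:
  assumes fin: "finite I" and J: "poly_ideal I J" and hJ: "\<And>g m. g \<in> J \<Longrightarrow> homc m g \<in> J"
    and tan: "\<And>a. a \<in> zero_locus I J \<Longrightarrow> tangent_cone_space I J a \<subseteq> cvec.span {a}"
  shows "reduced_scheme I J"
  unfolding reduced_scheme_def
proof (intro ballI allI impI)
  fix i m k g assume i: "i \<in> I" and g: "g \<in> forms I m" and "\<exists>N. var i ^ N * g ^ k \<in> J"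
  then obtain N where N: "var i ^ N * g ^ k \<in> J" by blast
  have gp: "g \<in> polys I" by (rule forms_polys[OF g])
  have vi: "var i \<in> polys I" using i by (rule polys_var)
  define Q where "Q = {h \<in> polys I. \<exists>N. var i ^ N * h * g \<in> J}"
  have Q: "poly_ideal I Q"
    unfolding poly_ideal_def
  proof (intro conjI ballI)
    show "Q \<subseteq> polys I" by (auto simp: Q_def)
    show "0 \<in> Q" using poly_idealD(2)[OF J] by (auto simp: Q_def)
    fix p assume "p \<in> Q"
    then obtain N1 where p: "p \<in> polys I" "var i ^ N1 * p * g \<in> J" by (auto simp: Q_def)
    show "p + q \<in> Q" if "q \<in> Q" for q
    proof -
      have "\<exists>N2. q \<in> polys I \<and> var i ^ N2 * q * g \<in> J" using that by (auto simp: Q_def)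
      then obtain N2 where q: "q \<in> polys I" "var i ^ N2 * q * g \<in> J" by blast
      have "var i ^ N2 * (var i ^ N1 * p * g) + var i ^ N1 * (var i ^ N2 * q * g) \<in> J"
        by (rule poly_idealD(3)[OF J poly_idealD(4)[OF J polys_power[OF vi] p(2)] poly_idealD(4)[OF J polys_power[OF vi] q(2)]])
      also have "var i ^ N2 * (var i ^ N1 * p * g) + var i ^ N1 * (var i ^ N2 * q * g) = var i ^ (N1 + N2) * (p + q) * g"
        by (simp add: power_add algebra_simps)
      finally show ?thesis using p q by (auto simp: Q_def intro: polys_add)
    qed
    show "r * p \<in> Q" if "r \<in> polys I" for r
    proof -
      have "var i ^ N1 * (r * p) * g = r * (var i ^ N1 * p * g)" by (simp add: mult_ac)
      hence "var i ^ N1 * (r * p) * g \<in> J" using poly_idealD(4)[OF J that p(2)] by (simp only:)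
      thus ?thesis using polys_mult[OF that p(1)] unfolding Q_def by blast
    qed
  qed
  have JQ: "J \<subseteq> Q"
  proof
    fix p assume p: "p \<in> J"
    have "var i ^ 0 * p * g \<in> J" using poly_idealD(5)[OF J gp p] by simp
    thus "p \<in> Q" using poly_idealD(1)[OF J p] unfolding Q_def by blast
  qed
  have "\<exists>e. var i ^ e \<in> Q"
  proof (rule ccontr)
    assume "\<not> ?thesis"
    then obtain x where x: "\<And>p. p \<in> Q \<Longrightarrow> evc x p = 0" "evc x (var i) \<noteq> 0"
      using nullstellensatz_power[OF fin Q vi] by blast
    have xi: "x i \<noteq> 0" using x(2) by (simp add: ev_simps)
    define a where "a = (\<Sum>i\<in>I. sg i (x i))"
    have lka: "lk a j = (if j \<in> I then x j else 0)" for j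
      using fin by (simp add: a_def lookup_sum lookup_single when_def)
    have eva: "evc (lk a) p = evc x p" if "p \<in> polys I" for p
      by (rule ev_cong_polys[OF that]) (simp add: lka)
    have van: "evc (lk a) p = 0" if "p \<in> J" for p
      using x(1) JQ that eva poly_idealD(1)[OF J that] by auto
    have "lk a i \<noteq> 0" using i xi by (simp add: lka)
    moreover have "ks a \<subseteq> I"
      by (auto simp: in_keys_iff lka simp del: lookup_not_eq_zero_eq_in_keys split: if_splits)
    ultimately have aZ: "a \<in> zero_locus I J"
      using van by (auto simp: zero_locus_def proj_space_def peval_evc)
    have "lk a i ^ N * evc (lk a) g ^ k = 0" using van[OF N] by (simp add: ev_simps)
    hence g0: "evc (lk a) g = 0" using \<open>lk a i \<noteq> 0\<close> by auto
    have "\<exists>h\<in>polys I. evc (lk a) h \<noteq> 0 \<and> h * g \<in> J"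
    proof (rule locally_reduced[OF fin J hJ van i \<open>lk a i \<noteq> 0\<close> _ g g0])
      fix v assume v: "\<And>g. g \<in> J \<Longrightarrow> (\<Sum>k\<in>I. evc (lk a) (partial k g) * v k) = 0"
      define w where "w = (\<Sum>i\<in>I. sg i (v i))"
      have lkw: "lk w j = (if j \<in> I then v j else 0)" for j
        using fin by (simp add: w_def lookup_sum lookup_single when_def)
      have "w \<in> tangent_cone_space I J a"
        unfolding tangent_cone_space_def using v
        by (auto simp: in_keys_iff lkw peval_evc simp del: lookup_not_eq_zero_eq_in_keys split: if_splits)
      then obtain c where "w = cscale c a" using tan[OF aZ] cvec.span_singleton[of a] by auto
      hence "\<forall>k\<in>I. v k = c * lk a k" using lkw by (metis lookup_cscale)
      thus "\<exists>c. \<forall>k\<in>I. v k = c * lk a k" by blast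
    qed
    then obtain h where h: "h \<in> polys I" "evc (lk a) h \<noteq> 0" "h * g \<in> J" by blast
    have "var i ^ 0 * h * g \<in> J" using h(3) by simp
    hence "h \<in> Q" using h(1) unfolding Q_def by blast
    thus False using x(1) h eva by auto
  qed
  then obtain e N' where "var i ^ N' * var i ^ e * g \<in> J" by (auto simp: Q_def)
  hence "var i ^ (N' + e) * g \<in> J" by (simp add: power_add)
  thus "\<exists>N. var i ^ N * g \<in> J" by blast
qed

section \<open>Smoothness of zero-dimensional fibres\<close>

text \<open>For \<open>s = 0\<close> a point of the locus is a nonzero constant operator, which does
  not annihilate a nonzero \<open>f\<close>.\<close>

lemma s_pos_of_zero_locus:
  assumes f: "f \<in> forms {..n} d" "f \<noteq> 0" and a: "a \<in> zero_locus (monomials {..n} s) (VSH n s f)"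
  shows "s > 0"
proof (rule ccontr)
  assume "\<not> s > 0"
  hence s: "s = 0" by simp
  have a0: "a \<in> forms {..n} s" "a \<noteq> 0" using a by (auto simp: zero_locus_def proj_space_def forms_def)
  have "\<alpha> = 0" if "\<alpha> \<in> ks a" for \<alpha>
  proof -
    have "mdeg \<alpha> = 0" using that a0(1) s by (auto simp: forms_def in_monomials)
    thus ?thesis by (intro poly_mapping_eqI) (auto simp: mdeg_def in_keys_iff simp del: lookup_not_eq_zero_eq_in_keys)
  qed
  hence ac: "a = cst (lk a 0)"
    by (intro poly_mapping_eqI) (force simp: cst_def lookup_single when_def in_keys_iff)
  have "lk f \<beta> = 0" for \<beta>
  proof (cases "\<beta> \<in> cofactor_exps n d s")
    case True
    have "apolar_eq n s f \<beta> \<in> VSH n s f" using apolar_eq_vanishing[OF f(1) True] VSH_sub(1) by blast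
    hence "apol f (a * xpow \<beta>) = 0" using a evc_apolar_eq[OF a0(1), of f \<beta>] by (auto simp: zero_locus_def peval_evc)
    hence "lk a 0 * (mfact \<beta> * lk f \<beta>) = 0" by (subst (asm) ac) (simp add: apol_cst_mult apol_xpow)
    moreover have "lk a 0 \<noteq> 0" using ac a0(2) by auto
    ultimately show ?thesis by simp
  next
    case False
    hence "\<beta> \<notin> ks f" using f(1) s by (auto simp: forms_def cofactor_exps_def monomials_def mdeg_def)
    thus ?thesis by (simp add: in_keys_iff)
  qed
  hence "f = 0" by (intro poly_mapping_eqI) simp
  thus False using f(2) by simp
qed

text \<open>Scaling \<open>p\<close> by an \<open>s\<close>-th root, instead of dividing
  \<open>a\<close> by its value, keeps the given representative of the point.\<close>

lemma normalization_point:
  fixes a :: "nat mpoly"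
  assumes "s > 0" "a \<in> forms {..n} s" "a \<noteq> 0"
  obtains p where "evc p a = 1"
proof -
  obtain p0 where p0: "evc p0 a \<noteq> 0" using poly_nonvanishing_point[OF assms(3)] by blast
  define P where "P = monom 1 s - [:1 / evc p0 a:]"
  have "coeff P s = 1" using assms(1) by (cases s) (auto simp: P_def)
  hence "degree P > 0" using le_degree[of P s] assms(1) by simp
  hence "\<not> constant (poly P)" by (simp add: constant_degree)
  then obtain t where "poly P t = 0" using fundamental_theorem_of_algebra by blast
  hence t: "t ^ s = 1 / evc p0 a" by (simp add: P_def poly_monom)
  have "evc (\<lambda>i. t * p0 i) a = 1" using ev_scale_form[OF _ assms(2), of "\<lambda>a. a" t p0] p0 t by simp
  thus ?thesis by (rule that)
qed

text \<open>\<open>var 0\<close> and \<open>var 1\<close> cannot both be multiples of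
  \<open>l\<close>.\<close>

lemma non_multiple_linear_form:
  fixes l :: "nat mpoly"
  assumes "n \<ge> 1" "l \<noteq> 0"
  obtains m where "m \<in> forms {..n} 1" "\<nexists>c. m = cst c * l"
proof (cases "\<exists>c. var 0 = cst c * l")
  case False
  thus ?thesis using that[of "var 0"] forms_var[of 0 "{..n}"] by auto
next
  case True
  then obtain c where c: "var 0 = cst c * l" by blast
  have "\<nexists>c'. var 1 = cst c' * l"
  proof
    assume "\<exists>c'. var 1 = cst c' * l"
    then obtain c' where c': "var 1 = cst c' * l" by blast
    have e: "cst c' * var 0 = cst c * var (1 :: nat)" unfolding c c' by (simp add: mult_ac)
    from arg_cong[OF e, of "evc (\<lambda>i. if i = 0 then 1 else 0)"] have "c' = 0" by (simp add: ev_simps)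
    hence "(var 1 :: nat mpoly) = 0" using c' by simp
    hence "evc (\<lambda>_. 1) (var 1 :: nat mpoly) = 0" by simp
    thus False by (simp add: ev_simps)
  qed
  thus ?thesis using that[of "var 1"] forms_var[of 1 "{..n}"] assms(1) by auto
qed

text \<open>The equations of decomposable forms bring a tangent vector into the shape of a
  deformation of the factors, and the linear equations of \<open>f\<close> put this deformation into
  the kernel of \<psi>. Conversely the radial direction is tangent because the locus is a
  cone.\<close>

lemma tangent_space_VSH:
  assumes n: "n \<ge> 1" and f: "f \<in> forms {..n} d" "f \<noteq> 0" and nc: "\<not> critical n d s f"
    and zd: "krull_dim (monomials {..n} s) (zero_locus (monomials {..n} s) (VSH n s f)) = 0"
    and a: "a \<in> zero_locus (monomials {..n} s) (VSH n s f)"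
  shows "tangent_cone_space (monomials {..n} s) (VSH n s f) a = cvec.span {a}"
proof -
  let ?mon = "monomials {..n} s"
  have s: "s > 0" by (rule s_pos_of_zero_locus[OF f a])
  note aZ = zero_locus_VSH[OF s f(1) a]
  have af: "a \<in> forms {..n} s" "a \<noteq> 0" "annihilates n d s a f"
    using aZ(1) f(1) by (auto simp: perp_space_annihilates)
  obtain p where p: "evc p a = 1" using normalization_point[OF s af(1,2)] .
  obtain M where M: "\<And>i. i < s \<Longrightarrow> M i \<in> forms {..n} 1" "\<And>i. i < s \<Longrightarrow> evc p (M i) = 1" "a = (\<Prod>i<s. M i)"
    using decomposable_normalized[OF aZ(2) p] by blast
  \<comment> \<open>Extended by zero beyond \<open>s\<close>, because
    \<open>positive_dimensional\<close> asks for linear forms at all indices.\<close>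
  define L where "L i = (if i < s then M i else 0)" for i
  have L: "L i \<in> forms {..n} 1" "i < s \<Longrightarrow> evc p (L i) = 1" for i using M by (auto simp: L_def)
  have aL: "a = (\<Prod>i<s. L i)" unfolding M(3) by (intro prod.cong) (auto simp: L_def)
  have diag: "\<exists>c. l i = cst c * L i"
    if l: "\<And>i. i < s \<Longrightarrow> l i \<in> forms {..n} 1" "annihilates n d s (\<Sum>i<s. l i * others s i L) f" "i < s" for l i
  proof (rule ccontr)
    assume nt: "\<nexists>c. l i = cst c * L i"
    define l' where "l' j = (if j < s then l j else 0)" for j
    have "(\<Sum>i<s. l' i * others s i L) = (\<Sum>i<s. l i * others s i L)"
      by (intro sum.cong) (auto simp: l'_def)
    hence "krull_dim ?mon (zero_locus ?mon (VSH n s f)) \<noteq> 0"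
      using l nt af by (intro positive_dimensional[OF s f(1) nc L(1), where l = l' and ?i0.0 = i]) (auto simp: l'_def aL)
    thus False using zd by simp
  qed
  have "inj_on L {..<s}"
  proof (rule inj_onI, rule ccontr)
    fix i k assume ik: "i \<in> {..<s}" "k \<in> {..<s}" "L i = L k" "i \<noteq> k"
    have "L i \<noteq> 0" using L(2)[of i] ik by auto
    then obtain m where m: "m \<in> forms {..n} 1" "\<nexists>c. m = cst c * L i"
      using non_multiple_linear_form[OF n] by metis
    \<comment> \<open>With two equal factors, \<open>m\<close> on one and \<open>- m\<close> on the
      other cancel in the differential, so this deformation lies in the kernel without being a
      rescaling.\<close>
    define l where "l j = (if j = i then m else if j = k then - m else 0)" for j
    have "others s i L = L k * (\<Prod>j\<in>{..<s} - {i} - {k}. L j)" using ik by (intro prod.remove) auto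
    moreover have "others s k L = L i * (\<Prod>j\<in>{..<s} - {k} - {i}. L j)" using ik by (intro prod.remove) auto
    ultimately have eq: "others s i L = others s k L" using ik by (simp add: Diff_insert2[symmetric] insert_commute)
    have "(\<Sum>j<s. l j * others s j L) = (\<Sum>j\<in>{i, k}. l j * others s j L)"
      using ik by (intro sum.mono_neutral_right) (auto simp: l_def)
    also have "\<dots> = 0" using ik(4) eq by (simp add: l_def)
    finally have "annihilates n d s (\<Sum>j<s. l j * others s j L) f" by (simp add: annihilates_def)
    moreover have "l j \<in> forms {..n} 1" for j using m(1) forms_uminus[OF m(1)] by (auto simp: l_def)
    ultimately have "\<exists>c. l i = cst c * L i" using diag[of l i] ik by auto
    thus False using m(2) by (simp add: l_def)
  qed
  note inj = this
  show ?thesis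
  proof (intro equalityI subsetI)
    fix v assume v: "v \<in> tangent_cone_space ?mon (VSH n s f) a"
    hence vf: "v \<in> forms {..n} s" by (auto simp: tangent_cone_space_def forms_def)
    have vt: "(\<Sum>\<alpha>\<in>?mon. evc (lk a) (partial \<alpha> g) * lk v \<alpha>) = 0" if "g \<in> VSH n s f" for g
      using v that by (auto simp: tangent_cone_space_def peval_evc)
    have "annihilates n d s v f"
      unfolding annihilates_def
    proof
      fix \<beta> assume "\<beta> \<in> cofactor_exps n d s"
      hence "apolar_eq n s f \<beta> \<in> VSH n s f" using apolar_eq_vanishing[OF f(1)] VSH_sub(1) by blast
      from vt[OF this] have "(\<Sum>\<alpha>\<in>?mon. apol f (xpow \<alpha> * xpow \<beta>) * lk v \<alpha>) = 0"
        by (simp add: apolar_eq_def partial_sum partial_mult partial_var ev_simps if_distrib cong: if_cong)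
      thus "apol f (v * xpow \<beta>) = 0" by (simp add: apol_form_expand[OF vf] mult.commute)
    qed
    moreover obtain l where l: "\<And>i. i < s \<Longrightarrow> l i \<in> forms {..n} 1" "v = (\<Sum>i<s. l i * others s i L)"
    proof (rule tangent_decomposable[OF n s L(1) L(2) inj vf])
      fix g assume "g \<in> vanishing_ideal ?mon (decomposable_variety n s)"
      hence "g \<in> VSH n s f" using VSH_sub(2) by blast
      from vt[OF this] show "(\<Sum>\<alpha>\<in>?mon. evc (lk (\<Prod>i<s. L i)) (partial \<alpha> g) * lk v \<alpha>) = 0"
        unfolding aL .
    qed (assumption, rule that)
    ultimately have "\<forall>i. \<exists>c. i < s \<longrightarrow> l i = cst c * L i" using diag by blast
    then obtain c where c: "\<And>i. i < s \<Longrightarrow> l i = cst (c i) * L i" by metis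
    have "v = (\<Sum>i<s. cst (c i) * a)"
      unfolding l(2)
    proof (intro sum.cong refl)
      fix i assume "i \<in> {..<s}"
      moreover have "a = L i * others s i L" if "i < s" unfolding aL using that by (intro prod.remove) auto
      ultimately show "l i * others s i L = cst (c i) * a" using c[of i] by (simp add: mult.assoc)
    qed
    also have "\<dots> = cscale (\<Sum>i<s. c i) a" by (simp add: cscale_cst cst_sum sum_distrib_right)
    finally show "v \<in> cvec.span {a}" unfolding cvec.span_singleton by (rule range_eqI)
  next
    fix v assume "v \<in> cvec.span {a}"
    then obtain c where v: "v = cscale c a" by (auto simp: cvec.span_singleton)
    have "(\<Sum>\<alpha>\<in>?mon. evc (lk a) (partial \<alpha> g) * lk a \<alpha>) = 0" if g: "g \<in> VSH n s f" for g
    proof (rule tangent_self)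
      show "g \<in> polys ?mon" using poly_idealD(1)[OF VSH_poly_ideal g] .
      fix c :: complex assume "c \<noteq> 0"
      hence "evc (lk (cscale c a)) g = 0"
        using VSH_vanish[OF perp_space_cone[OF f(1) aZ(1)] decomposable_cone[OF s aZ(2)] g] by blast
      moreover have "lk (cscale c a) = (\<lambda>i. c * lk a i)" by auto
      ultimately show "evc (\<lambda>i. c * lk a i) g = 0" by simp
    qed simp
    hence "(\<Sum>\<alpha>\<in>?mon. evc (lk a) (partial \<alpha> g) * lk v \<alpha>) = 0" if "g \<in> VSH n s f" for g
      using that by (simp add: v mult.left_commute flip: sum_distrib_left)
    moreover have "ks v \<subseteq> ?mon"
      using af(1) by (auto simp: v in_keys_iff forms_def simp del: lookup_not_eq_zero_eq_in_keys)
    ultimately show "v \<in> tangent_cone_space ?mon (VSH n s f) a"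
      by (auto simp: tangent_cone_space_def peval_evc)
  qed
qed

lemma local_dim_le_krull_dim: "local_dim I Z a \<le> krull_dim I Z"
  unfolding local_dim_def krull_dim_def by (intro Sup_subset_mono) blast

theorem proposition3p7:
  fixes n d :: nat
  assumes "n \<ge> 1" and "d \<ge> 1"
  shows "\<exists>U. zariski_open (monomials {..n} d) U \<and> U \<noteq> {} \<and>
    (\<forall>f\<in>U. zero_dimensional (monomials {..n} (s_min n d)) (VSH n (s_min n d) f) \<longrightarrow>
        smooth_scheme (monomials {..n} (s_min n d)) (VSH n (s_min n d) f) \<and>
        reduced_scheme (monomials {..n} (s_min n d)) (VSH n (s_min n d) f))"
proof -
  define s where "s = s_min n d"
  obtain U where U: "zariski_open (monomials {..n} d) U" "U \<noteq> {}"
    "\<And>f. f \<in> U \<Longrightarrow> f \<in> forms {..n} d \<and> \<not> critical n d s f"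
    using generic_not_critical[of n d s] by blast
  have "smooth_scheme (monomials {..n} s) (VSH n s f) \<and> reduced_scheme (monomials {..n} s) (VSH n s f)"
    if fU: "f \<in> U" and zd: "zero_dimensional (monomials {..n} s) (VSH n s f)" for f
  proof -
    let ?Z = "zero_locus (monomials {..n} s) (VSH n s f)"
    have f: "f \<in> forms {..n} d" "\<not> critical n d s f" using U(3)[OF fU] by auto
    have "f \<noteq> 0" using U(1) fU by (auto simp: zariski_open_def proj_space_def)
    have k0: "krull_dim (monomials {..n} s) ?Z = 0" and ne: "?Z \<noteq> {}"
      using zd by (auto simp: zero_dimensional_def)
    note tan = tangent_space_VSH[OF assms(1) f(1) \<open>f \<noteq> 0\<close> f(2) k0]
    obtain a0 where "a0 \<in> ?Z" using ne by blast
    hence s: "s > 0" by (rule s_pos_of_zero_locus[OF f(1) \<open>f \<noteq> 0\<close>])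
    have "smooth_scheme (monomials {..n} s) (VSH n s f)"
      unfolding smooth_scheme_def
    proof
      fix a assume a: "a \<in> ?Z"
      hence "a \<noteq> 0" by (auto simp: zero_locus_def proj_space_def)
      hence "cvec.independent {a}" by simp
      \<comment> \<open>Only the radial direction is left; 1 is the dimension required by
        \<open>smooth_scheme\<close> where the local dimension is 0.\<close>
      hence "cvec.dim (tangent_cone_space (monomials {..n} s) (VSH n s f) a) = 1"
        unfolding tan[OF a] by (simp add: cvec.dim_eq_card_independent[of "{a}"])
      moreover have "local_dim (monomials {..n} s) ?Z a = 0"
        using local_dim_le_krull_dim[of "monomials {..n} s" ?Z a] k0 by simp
      ultimately show "enat (cvec.dim (tangent_cone_space (monomials {..n} s) (VSH n s f) a)) =
          local_dim (monomials {..n} s) ?Z a + 1"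
        by (simp add: one_enat_def)
    qed
    moreover have "reduced_scheme (monomials {..n} s) (VSH n s f)"
      using tan by (intro reduced_of_smooth VSH_poly_ideal VSH_homc[OF s f(1)]) auto
    ultimately show ?thesis by blast
  qed
  thus ?thesis using U(1,2) unfolding s_def[symmetric] by blast
qed

end
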